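(* Let $N$ be a member of $\overline{\mathcal{K}}^{\,\ast}(5)$ (i.e. a neighborly triangulated $5$-manifold with boundary all of whose vertex links are stacked $4$-balls) with $f_0(N)=15$ vertices, and suppose that the automorphism group of $N$ contains a subgroup isomorphic to $\mathbb{Z}_3$. Then $N\cong N_i$ for some $i\in\{1,2,\ldots,12\}$, where $N_1,\ldots,N_{12}$ are the explicit $15$-vertex simplicial complexes listed in the context.
   Context: All simplicial complexes are finite and abstract; facets are maximal faces; a complex is pure if all facets have the same dimension; $f_0(X)$ is the number of vertices of $X$. A complex is neighborly if its edge graph ($1$-skeleton) is a complete graph on its vertex set. The link of a vertex $x$ in $X$ is $\{\alpha\in X:\ x\notin\alpha,\ \alpha\cup\{x\}\in X\}$. A standard $d$-ball is the pure $d$-dimensional complex with one facet. A stacked $d$-ball is a complex obtained from a standard $d$-ball by successively pasting $d$-simplices along $(d-1)$-faces (at each step, a new facet $\sigma\cup\{v\}$ is added with $\sigma$ a $(d-1)$-face in the boundary of the current complex and $v$ a new vertex). $\overline{\mathcal{K}}(d)$ is the class of triangulated $d$-manifolds (with boundary) all of whose vertex links are stacked $(d-1)$-balls, and $\overline{\mathcal{K}}^{\,\ast}(d)$ is the class of its neighborly members. $\cong$ denotes simplicial isomorphism, and an automorphism is an isomorphism of a complex with itself. Definition of $N_1,\ldots,N_{12}$. Let $V=\bigcup_{i=1}^5\{a_i,b_i,c_i\}$ be a $15$-element set and let $\varphi=(a_1,b_1,c_1)(a_2,b_2,c_2)(a_3,b_3,c_3)(a_4,b_4,c_4)(a_5,b_5,c_5)$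 (so $a_i\mapsto b_i\mapsto c_i\mapsto a_i$). A set of vertices is written as the concatenation of its elements. $N_i$ is the simplicial complex on $V$ whose facets are $z=a_1b_1c_1a_2b_2c_2$ together with $u_{i,k},\ \varphi(u_{i,k}),\ \varphi^2(u_{i,k})$ for $1\le k\le 8$, where $u_{i,1},\ldots,u_{i,8}$ are, in order: $i=1$: $a_1b_1c_1a_2b_2a_3$, $a_1b_1a_2b_2a_3a_4$, $a_1a_2b_2a_3a_4a_5$, $a_1a_2a_3a_4b_4a_5$, $a_1a_3a_4b_4a_5b_5$, $a_3b_3a_4b_4a_5b_5$, $c_2a_3b_3b_4a_5b_5$, $b_1c_2b_3b_4a_5b_5$. $i=2$: $a_1b_1c_1a_2b_2a_3$, $a_1b_1a_2b_2a_3a_4$, $a_1a_2b_2a_3a_4a_5$, $a_1a_2a_3a_4b_4a_5$, $a_1a_2a_3b_4a_5b_5$, $a_2a_3b_3b_4a_5b_5$, $a_3b_3b_4c_4a_5b_5$, $b_1b_3b_4c_4a_5b_5$. $i=3$: $a_1b_1c_1a_2b_2a_3$, $a_1b_1a_2b_2a_3a_4$, $a_1b_1a_2a_3a_4a_5$, $a_1a_2a_3a_4b_4a_5$, $a_1a_2a_3b_4a_5b_5$, $a_2a_3b_3b_4a_5b_5$, $a_3b_3b_4c_4a_5b_5$, $b_2b_3b_4c_4a_5b_5$. $i=4$: $a_1b_1c_1a_2b_2a_3$, $a_1b_1a_2b_2a_3a_4$, $a_1b_1a_2a_3a_4a_5$, $b_1a_2a_3a_4a_5c_5$, $a_2a_3b_3a_4a_5c_5$,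 $a_2a_3b_3a_4b_4a_5$, $a_2b_3a_4b_4a_5b_5$, $c_1b_3a_4b_4a_5b_5$. $i=5$: $a_1b_1c_1a_2b_2a_3$, $a_1b_1c_1a_2a_3a_4$, $a_1b_1a_2a_3a_4a_5$, $a_1a_2a_3a_4a_5b_5$, $a_2a_3a_4b_4a_5b_5$, $a_2a_3b_3b_4a_5b_5$, $a_2a_3b_3b_4c_4b_5$, $a_2b_3b_4c_4b_5c_5$. $i=6$: $a_1b_1c_1a_2b_2a_3$, $a_1b_1c_1a_2a_3a_4$, $a_1b_1a_2a_3a_4a_5$, $a_1a_2a_3a_4a_5b_5$, $a_2a_3a_4b_4a_5b_5$, $a_2a_3b_3a_4b_4b_5$, $a_2a_3b_3b_4b_5c_5$, $a_2b_3b_4c_4b_5c_5$. $i=7$: $a_1b_1c_1a_2b_2a_3$, $a_1b_1c_1a_2a_3a_4$, $a_1b_1a_2a_3a_4a_5$, $b_1a_2a_3a_4a_5c_5$, $a_2a_3a_4b_4a_5c_5$, $a_2a_3b_3b_4a_5c_5$, $a_2a_3b_3b_4c_4a_5$, $a_2b_3b_4c_4a_5b_5$. $i=8$: $a_1b_1c_1a_2b_2a_3$, $a_1b_1c_1a_2a_3a_4$, $a_1b_1a_2a_3a_4a_5$, $b_1a_2a_3a_4a_5c_5$, $a_2a_3a_4b_4a_5c_5$, $a_2a_3b_3a_4b_4a_5$, $a_2a_3b_3b_4a_5b_5$, $a_2b_3b_4c_4a_5b_5$. $i=9$: $a_1b_1c_1a_2b_2a_3$, $a_1b_1c_1a_2a_3a_4$,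 $a_1b_1a_2a_3a_4a_5$, $a_1a_2a_3a_4a_5b_5$, $a_2a_3a_4c_4a_5b_5$, $a_2a_3b_3a_4c_4b_5$, $a_2a_3b_3a_4b_5c_5$, $a_2b_3a_4b_4b_5c_5$. $i=10$: $a_1b_1c_1a_2b_2a_3$, $a_1b_1c_1a_2a_3a_4$, $a_1b_1a_2a_3a_4a_5$, $b_1a_2a_3a_4a_5c_5$, $a_2a_3a_4c_4a_5c_5$, $a_2a_3b_3a_4c_4a_5$, $a_2a_3b_3a_4a_5b_5$, $a_2b_3a_4b_4a_5b_5$. $i=11$: $a_1b_1c_1a_2b_2a_3$, $a_1b_1c_1a_2a_3a_4$, $a_1b_1a_2a_3a_4a_5$, $a_1a_2a_3a_4a_5b_5$, $a_2a_3b_3a_4a_5b_5$, $a_2b_3a_4b_4a_5b_5$, $b_2b_3a_4b_4a_5b_5$, $b_2b_3c_3a_4b_4b_5$. $i=12$: $a_1b_1c_1a_2b_2a_3$, $a_1b_1c_1a_2a_3a_4$, $a_1b_1a_2a_3a_4a_5$, $b_1a_2a_3a_4a_5c_5$, $a_2a_3b_3a_4a_5c_5$, $a_2b_3a_4b_4a_5c_5$, $b_2b_3a_4b_4a_5c_5$, $b_2b_3c_3a_4b_4a_5$. *)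

theory Defs
  imports
    "HOL-Analysis.Abstract_Topological_Spaces"
    "HOL-Analysis.Abstract_Euclidean_Space"
    "HOL-Algebra.Bij"
    "HOL-Algebra.Elementary_Groups"
begin

text \<open>A complex is the set of all its faces, the empty face included. A face of dimension
  \<open>k\<close> is a set of \<open>k + 1\<close> vertices. The vertex set of \<open>X\<close> is \<open>\<Union>X\<close>.\<close>

definition fin_complex :: "'a set set \<Rightarrow> bool" where
  "fin_complex X \<longleftrightarrow>
     finite X \<and> {} \<in> X \<and> (\<forall>\<sigma>\<in>X. finite \<sigma> \<and> (\<forall>\<tau>. \<tau> \<subseteq> \<sigma> \<longrightarrow> \<tau> \<in> X))"

definition facets :: "'a set set \<Rightarrow> 'a set set" where
  "facets X = {\<sigma> \<in> X. \<forall>\<tau>\<in>X. \<sigma> \<subseteq> \<tau> \<longrightarrow> \<tau> = \<sigma>}"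

definition generated_complex :: "'a set set \<Rightarrow> 'a set set" where
  "generated_complex \<F> = {\<sigma>. \<exists>F\<in>\<F>. \<sigma> \<subseteq> F}"

definition vertex_link :: "'a \<Rightarrow> 'a set set \<Rightarrow> 'a set set" where
  "vertex_link x X = {\<alpha> \<in> X. x \<notin> \<alpha> \<and> insert x \<alpha> \<in> X}"

definition neighborly :: "'a set set \<Rightarrow> bool" where
  "neighborly X \<longleftrightarrow> (\<forall>x\<in>\<Union>X. \<forall>y\<in>\<Union>X. x \<noteq> y \<longrightarrow> {x, y} \<in> X)"

definition complex_iso_map :: "('a \<Rightarrow> 'b) \<Rightarrow> 'a set set \<Rightarrow> 'b set set \<Rightarrow> bool" where
  "complex_iso_map f X Y \<longleftrightarrow> bij_betw f (\<Union>X) (\<Union>Y) \<and> (`) f ` X = Y"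

definition complex_iso :: "'a set set \<Rightarrow> 'b set set \<Rightarrow> bool" where
  "complex_iso X Y \<longleftrightarrow> (\<exists>f. complex_iso_map f X Y)"

text \<open>As in \<^const>\<open>BijGroup\<close>, automorphisms are extensional, so that distinct elements of the
  group are distinct permutations of the vertex set.\<close>

definition aut_group :: "'a set set \<Rightarrow> ('a \<Rightarrow> 'a) monoid" where
  "aut_group X = (BijGroup (\<Union>X)) \<lparr>carrier := {f \<in> Bij (\<Union>X). complex_iso_map f X X}\<rparr>"

text \<open>A \<open>(d - 1)\<close>-face of a \<open>d\<close>-ball lies in the boundary iff exactly one facet contains it.\<close>

inductive stacked_ball :: "nat \<Rightarrow> 'a set set \<Rightarrow> bool" for d :: nat where
  standard: "finite \<sigma> \<Longrightarrow> card \<sigma> = d + 1 \<Longrightarrow> stacked_ball d (Pow \<sigma>)"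
| paste: "stacked_ball d X \<Longrightarrow> \<sigma> \<in> X \<Longrightarrow> card \<sigma> = d \<Longrightarrow> \<exists>!F. F \<in> facets X \<and> \<sigma> \<subseteq> F
    \<Longrightarrow> v \<notin> \<Union>X \<Longrightarrow> stacked_ball d (X \<union> Pow (insert v \<sigma>))"

text \<open>Points of the geometric carrier are given by their barycentric coordinates.\<close>

definition geometric_carrier :: "'a set set \<Rightarrow> ('a \<Rightarrow> real) topology" where
  "geometric_carrier X = subtopology (powertop_real UNIV)
     {t. (\<forall>v. 0 \<le> t v) \<and> {v. t v \<noteq> 0} \<in> X \<and> (\<Sum>v\<in>\<Union>X. t v) = 1}"

definition half_space :: "nat \<Rightarrow> (nat \<Rightarrow> real) topology" where
  "half_space d = subtopology (Euclidean_space d) {x. 0 \<le> x 0}"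

definition manifold_with_boundary :: "nat \<Rightarrow> 'a topology \<Rightarrow> bool" where
  "manifold_with_boundary d T \<longleftrightarrow>
     Hausdorff_space T \<and> second_countable T \<and>
     (\<forall>x\<in>topspace T. \<exists>U W. openin T U \<and> x \<in> U \<and> openin (half_space d) W \<and>
        subtopology T U homeomorphic_space subtopology (half_space d) W)"

definition triangulated_manifold :: "nat \<Rightarrow> 'a set set \<Rightarrow> bool" where
  "triangulated_manifold d X \<longleftrightarrow>
     fin_complex X \<and> manifold_with_boundary d (geometric_carrier X)"

definition Kbar :: "nat \<Rightarrow> 'a set set set" where
  "Kbar d = {X. triangulated_manifold d X \<and>
                (\<forall>x\<in>\<Union>X. stacked_ball (d - 1) (vertex_link x X))}"

definition Kbar_star :: "nat \<Rightarrow> 'a set set set" where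
  "Kbar_star d = {X \<in> Kbar d. neighborly X}"

datatype vertex =
  a1 | b1 | c1 | a2 | b2 | c2 | a3 | b3 | c3 | a4 | b4 | c4 | a5 | b5 | c5

fun \<phi> :: "vertex \<Rightarrow> vertex" where
  "\<phi> a1 = b1" | "\<phi> b1 = c1" | "\<phi> c1 = a1"
| "\<phi> a2 = b2" | "\<phi> b2 = c2" | "\<phi> c2 = a2"
| "\<phi> a3 = b3" | "\<phi> b3 = c3" | "\<phi> c3 = a3"
| "\<phi> a4 = b4" | "\<phi> b4 = c4" | "\<phi> c4 = a4"
| "\<phi> a5 = b5" | "\<phi> b5 = c5" | "\<phi> c5 = a5"

text \<open>Counting from 1, the \<open>i\<close>-th inner list consists of the representatives \<open>u\<^bsub>i,1\<^esub>, \<dots>, u\<^bsub>i,8\<^esub>\<close>.\<close>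

definition facet_orbit_reps :: "vertex set list list" where
  "facet_orbit_reps =
    [[{a1, b1, c1, a2, b2, a3},
      {a1, b1, a2, b2, a3, a4},
      {a1, a2, b2, a3, a4, a5},
      {a1, a2, a3, a4, b4, a5},
      {a1, a3, a4, b4, a5, b5},
      {a3, b3, a4, b4, a5, b5},
      {c2, a3, b3, b4, a5, b5},
      {b1, c2, b3, b4, a5, b5}],
     [{a1, b1, c1, a2, b2, a3},
      {a1, b1, a2, b2, a3, a4},
      {a1, a2, b2, a3, a4, a5},
      {a1, a2, a3, a4, b4, a5},
      {a1, a2, a3, b4, a5, b5},
      {a2, a3, b3, b4, a5, b5},
      {a3, b3, b4, c4, a5, b5},
      {b1, b3, b4, c4, a5, b5}],
     [{a1, b1, c1, a2, b2, a3},
      {a1, b1, a2, b2, a3, a4},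
      {a1, b1, a2, a3, a4, a5},
      {a1, a2, a3, a4, b4, a5},
      {a1, a2, a3, b4, a5, b5},
      {a2, a3, b3, b4, a5, b5},
      {a3, b3, b4, c4, a5, b5},
      {b2, b3, b4, c4, a5, b5}],
     [{a1, b1, c1, a2, b2, a3},
      {a1, b1, a2, b2, a3, a4},
      {a1, b1, a2, a3, a4, a5},
      {b1, a2, a3, a4, a5, c5},
      {a2, a3, b3, a4, a5, c5},
      {a2, a3, b3, a4, b4, a5},
      {a2, b3, a4, b4, a5, b5},
      {c1, b3, a4, b4, a5, b5}],
     [{a1, b1, c1, a2, b2, a3},
      {a1, b1, c1, a2, a3, a4},
      {a1, b1, a2, a3, a4, a5},
      {a1, a2, a3, a4, a5, b5},
      {a2, a3, a4, b4, a5, b5},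
      {a2, a3, b3, b4, a5, b5},
      {a2, a3, b3, b4, c4, b5},
      {a2, b3, b4, c4, b5, c5}],
     [{a1, b1, c1, a2, b2, a3},
      {a1, b1, c1, a2, a3, a4},
      {a1, b1, a2, a3, a4, a5},
      {a1, a2, a3, a4, a5, b5},
      {a2, a3, a4, b4, a5, b5},
      {a2, a3, b3, a4, b4, b5},
      {a2, a3, b3, b4, b5, c5},
      {a2, b3, b4, c4, b5, c5}],
     [{a1, b1, c1, a2, b2, a3},
      {a1, b1, c1, a2, a3, a4},
      {a1, b1, a2, a3, a4, a5},
      {b1, a2, a3, a4, a5, c5},
      {a2, a3, a4, b4, a5, c5},
      {a2, a3, b3, b4, a5, c5},
      {a2, a3, b3, b4, c4, a5},
      {a2, b3, b4, c4, a5, b5}],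
     [{a1, b1, c1, a2, b2, a3},
      {a1, b1, c1, a2, a3, a4},
      {a1, b1, a2, a3, a4, a5},
      {b1, a2, a3, a4, a5, c5},
      {a2, a3, a4, b4, a5, c5},
      {a2, a3, b3, a4, b4, a5},
      {a2, a3, b3, b4, a5, b5},
      {a2, b3, b4, c4, a5, b5}],
     [{a1, b1, c1, a2, b2, a3},
      {a1, b1, c1, a2, a3, a4},
      {a1, b1, a2, a3, a4, a5},
      {a1, a2, a3, a4, a5, b5},
      {a2, a3, a4, c4, a5, b5},
      {a2, a3, b3, a4, c4, b5},
      {a2, a3, b3, a4, b5, c5},
      {a2, b3, a4, b4, b5, c5}],
     [{a1, b1, c1, a2, b2, a3},
      {a1, b1, c1, a2, a3, a4},
      {a1, b1, a2, a3, a4, a5},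
      {b1, a2, a3, a4, a5, c5},
      {a2, a3, a4, c4, a5, c5},
      {a2, a3, b3, a4, c4, a5},
      {a2, a3, b3, a4, a5, b5},
      {a2, b3, a4, b4, a5, b5}],
     [{a1, b1, c1, a2, b2, a3},
      {a1, b1, c1, a2, a3, a4},
      {a1, b1, a2, a3, a4, a5},
      {a1, a2, a3, a4, a5, b5},
      {a2, a3, b3, a4, a5, b5},
      {a2, b3, a4, b4, a5, b5},
      {b2, b3, a4, b4, a5, b5},
      {b2, b3, c3, a4, b4, b5}],
     [{a1, b1, c1, a2, b2, a3},
      {a1, b1, c1, a2, a3, a4},
      {a1, b1, a2, a3, a4, a5},
      {b1, a2, a3, a4, a5, c5},
      {a2, a3, b3, a4, a5, c5},
      {a2, b3, a4, b4, a5, c5},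
      {b2, b3, a4, b4, a5, c5},
      {b2, b3, c3, a4, b4, a5}]]"

definition N_facets :: "nat \<Rightarrow> vertex set set" where
  "N_facets i = insert {a1, b1, c1, a2, b2, c2}
     (\<Union>u \<in> set (facet_orbit_reps ! (i - 1)). {u, \<phi> ` u, \<phi> ` \<phi> ` u})"

definition N_complex :: "nat \<Rightarrow> vertex set set" where
  "N_complex i = generated_complex (N_facets i)"

end

theory Submission
  imports Defs
begin

text \<open>Call two facets adjacent if they share five vertices. In a stacked ball the adjacency graph is a
  tree, so counting in the vertex links gives 25 facets and 27 adjacencies. An automorphism of order
  three fixes a facet \<open>z\<close>; following adjacencies from a moved neighbour of \<open>z\<close> without backtracking
  shows that the graph is a subdivision of \<open>K\<^sub>4\<close> that the automorphism rotates about \<open>z\<close>: three spokes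
  lead from \<open>z\<close> to branch facets that are joined by a rim, and apart from \<open>z\<close> there are 8 orbits of facets.
  Since the stars of vertices are connected and have 10 facets, a vertex that is dropped along the spoke
  or the rim has been present since its beginning. This bounds the length of the spoke and excludes fixed
  vertices. What remains is a finite search for 8 facets: neighborliness requires that each of the 35
  orbits of pairs of vertices lies in a facet, hence at most 10 orbits can be covered repeatedly. The search
  is evaluated by the simplifier.\<close>

section \<open>Facets of stacked balls\<close>

text \<open>All degrees are at least two, and their total excess over two is
  \<open>54 - 2 * 25 = 4\<close>. A fixed facet with a moved neighbour has at least three
  neighbours. If some moved facet also has degree at least three, its three rotated copies and
  \<open>z\<close> use up the excess, and there is no other branching. The hard case is the opposite
  one: two fixed facets of excess two each, joined by three rotated paths. It is excluded by the
  sizes of vertex stars. The bound 10 on repeated pairs becomes effective through forced repeats.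
  The rim runs from a facet to its rotated copy, and a vertex added on the rim stays to the end;
  hence it forms pairs that were covered when the rim began. The forced repeats amount to 10, 10, 9
  and 7 for spokes with 3, 4, 5 and 6 steps and leave 0, 0, 1 and 3 free ones. A candidate that
  survives is one of the listed complexes up to relabelling, or it has two facets that share five
  vertices where the shape of the graph forbids it.\<close>

lemma facets_Pow: "facets (Pow \<sigma>) = {\<sigma>}"
  unfolding facets_def by auto

text \<open>Only faces with \<open>v\<close> are new. An old facet inside the pasted simplex would
  avoid \<open>v\<close>, hence lie in \<open>\<sigma>\<close> and equal it by maximality; but
  \<open>\<sigma>\<close> is no facet.\<close>

lemma facets_paste:
  assumes "\<sigma> \<in> X" "\<sigma> \<notin> facets X" "v \<notin> \<Union>X" "\<And>\<rho> \<tau>. \<rho> \<in> X \<Longrightarrow> \<tau> \<subseteq> \<rho> \<Longrightarrow> \<tau> \<in> X"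
  shows "facets (X \<union> Pow (insert v \<sigma>)) = insert (insert v \<sigma>) (facets X)"
proof -
  have v: "v \<notin> \<tau>" if "\<tau> \<in> X" for \<tau> using that assms(3) by auto
  have P: "\<tau> \<in> X" if "\<tau> \<subseteq> insert v \<sigma>" "v \<notin> \<tau>" for \<tau>
    using assms(4)[OF assms(1), of \<tau>] that by auto
  have new: "insert v \<sigma> \<in> facets (X \<union> Pow (insert v \<sigma>))"
    unfolding facets_def using v by auto
  have old: "\<tau> \<in> facets (X \<union> Pow (insert v \<sigma>)) \<longleftrightarrow> \<tau> \<in> facets X" if "\<tau> \<noteq> insert v \<sigma>" for \<tau>
  proof
    assume t: "\<tau> \<in> facets (X \<union> Pow (insert v \<sigma>))"
    then have "\<not> \<tau> \<subseteq> insert v \<sigma>" using that unfolding facets_def by auto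
    with t show "\<tau> \<in> facets X" unfolding facets_def by auto
  next
    assume t: "\<tau> \<in> facets X"
    have "\<not> \<tau> \<subseteq> insert v \<sigma>"
    proof
      assume "\<tau> \<subseteq> insert v \<sigma>"
      moreover have "v \<notin> \<tau>" using t v unfolding facets_def by auto
      ultimately have "\<tau> \<subseteq> \<sigma>" by auto
      with t assms(1) have "\<sigma> = \<tau>" unfolding facets_def by auto
      with t assms(2) show False by simp
    qed
    with t show "\<tau> \<in> facets (X \<union> Pow (insert v \<sigma>))" unfolding facets_def by auto
  qed
  show ?thesis
  proof (rule Set.set_eqI)
    fix \<tau> show "\<tau> \<in> facets (X \<union> Pow (insert v \<sigma>)) \<longleftrightarrow> \<tau> \<in> insert (insert v \<sigma>) (facets X)"
      using new old[of \<tau>] by (cases "\<tau> = insert v \<sigma>") simp_all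
  qed
qed

lemma card_Int_eq_imp_subset: "finite A \<Longrightarrow> card (A \<inter> B) = card A \<Longrightarrow> A \<subseteq> B"
  by (metis Int_lower1 card_subset_eq inf.absorb_iff1)

text \<open>The pairs are ordered, so every adjacency counts twice and a tree with \<open>n\<close>
  facets has \<open>2 * (n - 1)\<close> of them.\<close>

definition adjacent_pairs :: "nat \<Rightarrow> 'a set set \<Rightarrow> ('a set \<times> 'a set) set" where
  "adjacent_pairs d \<F> = {(X, Y). X \<in> \<F> \<and> Y \<in> \<F> \<and> card (X \<inter> Y) = d}"

text \<open>An old facet meets the pasted simplex inside \<open>\<sigma>\<close>, so it shares
  \<open>d\<close> vertices with it only if it contains \<open>\<sigma>\<close>, and there is just
  one such facet. Each step therefore attaches a leaf to the adjacency graph, which stays a tree.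
  The parts go through one induction because they need each other; purity, for instance, shows that
  \<open>\<sigma>\<close> is no facet.\<close>

lemma stacked_ball_facets:
  assumes "stacked_ball d X"
  shows "finite X \<and> (\<forall>\<sigma>\<in>X. finite \<sigma>) \<and> (\<forall>\<rho>\<in>X. \<forall>\<tau>\<subseteq>\<rho>. \<tau> \<in> X) \<and> (\<forall>\<sigma>\<in>facets X. card \<sigma> = d + 1) \<and>
    (\<forall>\<sigma>\<in>X. \<exists>F\<in>facets X. \<sigma> \<subseteq> F) \<and>
    facets X \<noteq> {} \<and> card (facets X) + d = card (\<Union>X) \<and>
    card (adjacent_pairs d (facets X)) + 2 = 2 * card (facets X) \<and>
    (\<forall>A\<subseteq>facets X. A \<noteq> {} \<longrightarrow> (\<forall>F\<in>A. \<forall>G\<in>facets X. card (F \<inter> G) = d \<longrightarrow> G \<in> A) \<longrightarrow> A = facets X) \<and>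
    (\<forall>F\<in>facets X. \<forall>G\<in>facets X. \<forall>H\<in>facets X. d \<le> card (F \<inter> G \<inter> H) \<longrightarrow> F = G \<or> G = H \<or> F = H)"
  using assms
proof (induction rule: stacked_ball.induct)
  case (standard \<sigma>)
  have "adjacent_pairs d {\<sigma>} = {}" unfolding adjacent_pairs_def using standard by auto
  with standard show ?case by (auto simp: facets_Pow subset_singleton_iff dest: finite_subset[OF _ standard(1)])
next
  case (paste X \<sigma> v)
  note IH = paste.IH
  define G where "G = insert v \<sigma>"
  obtain F0 where F0: "F0 \<in> facets X" "\<sigma> \<subseteq> F0" and uniq: "\<And>F. F \<in> facets X \<Longrightarrow> \<sigma> \<subseteq> F \<Longrightarrow> F = F0"
    using paste(4) by blast
  have nf: "\<sigma> \<notin> facets X" using IH paste(3) by auto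
  have fin: "finite \<sigma>" using IH paste(2) by auto
  have fc: "facets (X \<union> Pow (insert v \<sigma>)) = insert G (facets X)"
    unfolding G_def by (rule facets_paste) (use paste(2,5) nf IH in auto)
  have vX: "v \<notin> \<tau>" if "\<tau> \<in> X" for \<tau> using that paste(5) by auto
  have vf: "v \<notin> \<tau>" if "\<tau> \<in> facets X" for \<tau> using that vX unfolding facets_def by auto
  have vs: "v \<notin> \<sigma>" using vX paste(2) by auto
  have cG: "card G = d + 1" using fin vs paste(3) unfolding G_def by auto
  have Gn: "G \<notin> facets X" using vf unfolding G_def by auto
  have GI: "G \<inter> F = \<sigma> \<inter> F" if "F \<in> facets X" for F using vf[OF that] unfolding G_def by auto
  have adjG: "card (G \<inter> F) = d \<longleftrightarrow> F = F0" if "F \<in> facets X" for F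
  proof
    assume "card (G \<inter> F) = d"
    then have "card (\<sigma> \<inter> F) = card \<sigma>" using GI[OF that] paste(3) by simp
    then have "\<sigma> \<subseteq> F" using fin by (rule card_Int_eq_imp_subset[rotated])
    then show "F = F0" using uniq that by auto
  next
    assume "F = F0"
    then have "G \<inter> F = \<sigma>" using GI[OF that] F0 by auto
    then show "card (G \<inter> F) = d" using paste(3) by simp
  qed
  have finf: "finite (facets X)" using IH unfolding facets_def by auto
  have U: "\<Union>(X \<union> Pow G) = insert v (\<Union>X)" using paste(2) unfolding G_def by auto
  have finU: "finite (\<Union>X)" using IH by auto
  have 1: "card (insert G (facets X)) + d = card (\<Union>(X \<union> Pow G))"
    unfolding U using IH finf Gn finU paste(5) by simp
  have "adjacent_pairs d (insert G (facets X)) = {(G,F0),(F0,G)} \<union> adjacent_pairs d (facets X)"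
  proof -
    have "G \<inter> G = G" "\<And>F. F \<inter> G = G \<inter> F" by auto
    then have "(A, B) \<in> adjacent_pairs d (insert G (facets X)) \<longleftrightarrow>
        (A, B) \<in> {(G,F0),(F0,G)} \<union> adjacent_pairs d (facets X)" for A B
      unfolding adjacent_pairs_def using adjG[of A] adjG[of B] cG F0(1) Gn
      by (cases "A = G"; cases "B = G") auto
    then show ?thesis by auto
  qed
  moreover have "{(G,F0),(F0,G)} \<inter> adjacent_pairs d (facets X) = {}" using Gn unfolding adjacent_pairs_def by auto
  moreover have "finite (adjacent_pairs d (facets X))"
    by (rule finite_subset[of _ "facets X \<times> facets X"]) (use finf in \<open>auto simp: adjacent_pairs_def\<close>)
  moreover have "G \<noteq> F0" using F0(1) Gn by auto
  then have "card {(G,F0),(F0,G)} = 2" by simp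
  ultimately have "card (adjacent_pairs d (insert G (facets X))) = 2 + card (adjacent_pairs d (facets X))"
    using card_Un_disjoint[of "{(G,F0),(F0,G)}" "adjacent_pairs d (facets X)"] by simp
  then have 2: "card (adjacent_pairs d (insert G (facets X))) + 2 = 2 * card (insert G (facets X))"
    using IH finf Gn by simp
  have 3: "A = insert G (facets X)"
    if A: "A \<subseteq> insert G (facets X)" "A \<noteq> {}"
      and cl: "\<forall>F\<in>A. \<forall>H\<in>insert G (facets X). card (F \<inter> H) = d \<longrightarrow> H \<in> A" for A
  proof -
    have ne: "A \<inter> facets X \<noteq> {}"
    proof (cases "G \<in> A")
      case True
      then have "F0 \<in> A" using cl F0(1) adjG by auto
      then show ?thesis using F0 by auto
    qed (use A in auto)
    have "A \<inter> facets X \<subseteq> facets X" "\<forall>F\<in>A \<inter> facets X. \<forall>H\<in>facets X. card (F \<inter> H) = d \<longrightarrow> H \<in> A \<inter> facets X"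
      using cl by auto
    then have "A \<inter> facets X = facets X" using IH ne by blast
    then have "facets X \<subseteq> A" by auto
    moreover then have "G \<in> A" using cl F0(1) adjG by (auto simp: Int_commute)
    ultimately show ?thesis using A by auto
  qed
  \<comment> \<open>Two old facets that share \<open>d\<close> vertices with each other and with the
    new one both contain \<open>\<sigma>\<close>.\<close>
  have thin2: "F = H" if "F \<in> facets X" "H \<in> facets X" "d \<le> card (G \<inter> F \<inter> H)" for F H
  proof -
    have e: "G \<inter> F \<inter> H = \<sigma> \<inter> (F \<inter> H)" using GI[OF that(1)] by auto
    have "card (\<sigma> \<inter> (F \<inter> H)) \<le> card \<sigma>" using fin by (simp add: card_mono)
    then have "card (\<sigma> \<inter> (F \<inter> H)) = card \<sigma>" using that(3) e paste(3) by simp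
    then have "\<sigma> \<subseteq> F \<inter> H" by (rule card_Int_eq_imp_subset[OF fin])
    then show ?thesis using uniq that by auto
  qed
  have 4: "F = H \<or> H = K \<or> F = K"
    if "F \<in> insert G (facets X)" "H \<in> insert G (facets X)" "K \<in> insert G (facets X)"
      "d \<le> card (F \<inter> H \<inter> K)" for F H K
  proof -
    have e: "F \<inter> H \<inter> K = H \<inter> F \<inter> K" "F \<inter> H \<inter> K = K \<inter> F \<inter> H" by auto
    show ?thesis using that IH thin2[of H K] thin2[of F K] thin2[of F H] e by (metis insertE)
  qed
  have sub: "\<forall>\<rho>\<in>X. \<forall>\<tau>\<subseteq>\<rho>. \<tau> \<in> X" and cov: "\<forall>\<tau>\<in>X. \<exists>F\<in>facets X. \<tau> \<subseteq> F"
    and finX: "finite X" "\<forall>\<tau>\<in>X. finite \<tau>" and cd: "\<forall>\<tau>\<in>facets X. card \<tau> = d + 1"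
    using IH by auto
  have 5: "\<forall>\<rho>\<in>X \<union> Pow G. \<forall>\<tau>\<subseteq>\<rho>. \<tau> \<in> X \<union> Pow G" using sub by auto
  have 6: "\<forall>\<tau>\<in>X \<union> Pow G. \<exists>F\<in>insert G (facets X). \<tau> \<subseteq> F" using cov by auto
  have finG: "finite G" using fin by (simp add: G_def)
  have 7: "finite (X \<union> Pow G)" "\<forall>\<tau>\<in>X \<union> Pow G. finite \<tau>" "\<forall>\<tau>\<in>insert G (facets X). card \<tau> = d + 1"
    using finX cd finG cG by (auto dest: finite_subset[OF _ finG])
  show ?case unfolding fc unfolding G_def[symmetric]
    apply (intro conjI)
    subgoal by (rule 7(1))
    subgoal by (rule 7(2))
    subgoal by (rule 5)
    subgoal by (rule 7(3))
    subgoal by (rule 6)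
    subgoal by simp
    subgoal by (rule 1)
    subgoal by (rule 2)
    subgoal by (intro allI impI; rule 3; assumption)
    subgoal by (intro ballI impI; rule 4; assumption)
    done
qed

lemma facets_vertex_link:
  assumes X: "fin_complex X" and v: "v \<in> \<Union>X"
  shows "facets (vertex_link v X) = (\<lambda>F. F - {v}) ` {F \<in> facets X. v \<in> F}"
proof -
  have sub: "\<And>\<sigma> \<tau>. \<sigma> \<in> X \<Longrightarrow> \<tau> \<subseteq> \<sigma> \<Longrightarrow> \<tau> \<in> X" using X unfolding fin_complex_def by auto
  show ?thesis
  proof (intro equalityI subsetI)
    fix \<alpha> assume a: "\<alpha> \<in> facets (vertex_link v X)"
    then have al: "v \<notin> \<alpha>" "insert v \<alpha> \<in> X" unfolding facets_def vertex_link_def by auto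
    have "insert v \<alpha> \<in> facets X"
      unfolding facets_def
    proof (intro CollectI conjI ballI impI al(2))
      fix \<tau> assume t: "\<tau> \<in> X" "insert v \<alpha> \<subseteq> \<tau>"
      have e: "insert v (\<tau> - {v}) = \<tau>" using t by auto
      have "\<tau> - {v} \<in> vertex_link v X" unfolding vertex_link_def using t sub[OF t(1), of "\<tau> - {v}"] e by auto
      moreover have "\<alpha> \<subseteq> \<tau> - {v}" using t al by auto
      ultimately have "\<tau> - {v} = \<alpha>" using a unfolding facets_def by auto
      then show "\<tau> = insert v \<alpha>" using e by auto
    qed
    then show "\<alpha> \<in> (\<lambda>F. F - {v}) ` {F \<in> facets X. v \<in> F}" using al by (intro image_eqI[of _ _ "insert v \<alpha>"]) auto
  next
    fix \<alpha> assume "\<alpha> \<in> (\<lambda>F. F - {v}) ` {F \<in> facets X. v \<in> F}"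
    then obtain F where F: "F \<in> facets X" "v \<in> F" "\<alpha> = F - {v}" by auto
    have FX: "F \<in> X" using F unfolding facets_def by auto
    have "\<alpha> \<in> vertex_link v X" using F FX sub[OF FX, of \<alpha>] unfolding vertex_link_def by (auto simp: insert_absorb)
    moreover have "\<tau> = \<alpha>" if "\<tau> \<in> vertex_link v X" "\<alpha> \<subseteq> \<tau>" for \<tau>
    proof -
      have "insert v \<tau> \<in> X" "v \<notin> \<tau>" "F \<subseteq> insert v \<tau>" using that F unfolding vertex_link_def by auto
      then have "insert v \<tau> = F" using F(1) unfolding facets_def by auto
      then show ?thesis using F(3) \<open>v \<notin> \<tau>\<close> by auto
    qed
    ultimately show "\<alpha> \<in> facets (vertex_link v X)" unfolding facets_def by auto
  qed
qed

section \<open>The adjacency graph of the facets\<close>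

text \<open>One orbit is removed at a time. The lemma serves to find fixed elements: neither the 25
  facets nor the 10 facets of a star can be permuted freely.\<close>

lemma three_dvd_card_if_free:
  assumes "finite S" "\<And>x. x \<in> S \<Longrightarrow> g x \<in> S" "\<And>x. x \<in> S \<Longrightarrow> g (g (g x)) = x" "\<And>x. x \<in> S \<Longrightarrow> g x \<noteq> x"
  shows "3 dvd card S"
  using assms
proof (induction S rule: finite_psubset_induct)
  case (psubset S)
  show ?case
  proof (cases "S = {}")
    case False
    then obtain x where x: "x \<in> S" by auto
    define Q where "Q = {x, g x, g (g x)}"
    have QS: "Q \<subseteq> S" using x psubset(3) unfolding Q_def by auto
    have d: "g (g x) \<noteq> x" using psubset(4,5) x by metis
    then have c: "card Q = 3" using psubset(3,5) x unfolding Q_def by (auto simp: eq_commute)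
    have gS: "g y \<in> S - Q" if "y \<in> S - Q" for y
    proof -
      have "g y \<notin> Q"
      proof
        assume "g y \<in> Q"
        then have "g (g (g y)) \<in> Q" using psubset(4)[OF x] unfolding Q_def by auto
        then show False using psubset(4) that by auto
      qed
      then show ?thesis using that psubset(3) by auto
    qed
    have "S - Q \<subset> S" using x unfolding Q_def by auto
    then have "3 dvd card (S - Q)" using psubset(2)[of "S - Q"] gS psubset(4,5) by auto
    moreover have "card S = card (S - Q) + 3"
      using c QS psubset(1) by (metis card_Diff_subset card_mono finite_subset le_add_diff_inverse2)
    ultimately show ?thesis by simp
  qed simp
qed

text \<open>What the links and neighborliness say about facets alone. Every link has 14 vertices,
  hence \<open>14 - 4 = 10\<close> facets and \<open>2 * 9 = 18\<close> ordered adjacencies.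
  \<open>thin\<close> says that a face of codimension one lies in at most two facets.\<close>

locale facet_system =
  fixes V :: "'a set" and \<F> :: "'a set set"
  assumes finV: "finite V" and cardV: "card V = 15"
    and facet: "X \<in> \<F> \<Longrightarrow> X \<subseteq> V \<and> card X = 6"
    and star_card: "v \<in> V \<Longrightarrow> card {X \<in> \<F>. v \<in> X} = 10"
    and star_conn: "\<lbrakk>v \<in> V; A \<subseteq> {X \<in> \<F>. v \<in> X}; A \<noteq> {};
        \<And>X Y. X \<in> A \<Longrightarrow> Y \<in> \<F> \<Longrightarrow> v \<in> Y \<Longrightarrow> card (X \<inter> Y) = 5 \<Longrightarrow> Y \<in> A\<rbrakk> \<Longrightarrow> A = {X \<in> \<F>. v \<in> X}"
    and star_adj: "v \<in> V \<Longrightarrow> card {(X, Y). X \<in> \<F> \<and> Y \<in> \<F> \<and> v \<in> X \<and> v \<in> Y \<and> card (X \<inter> Y) = 5} = 18"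
    and meet: "v \<in> V \<Longrightarrow> w \<in> V \<Longrightarrow> \<exists>X\<in>\<F>. v \<in> X \<and> w \<in> X"
    and thin: "\<lbrakk>X \<in> \<F>; Y \<in> \<F>; Z \<in> \<F>; 5 \<le> card (X \<inter> Y \<inter> Z)\<rbrakk> \<Longrightarrow> X = Y \<or> Y = Z \<or> X = Z"
begin

definition nb :: "'a set \<Rightarrow> 'a set set" where
  "nb X = {Y \<in> \<F>. card (X \<inter> Y) = 5}"

lemma nb_sym: "X \<in> \<F> \<Longrightarrow> Y \<in> nb X \<Longrightarrow> X \<in> nb Y"
  unfolding nb_def by (auto simp: Int_commute)

lemma nb_F: "Y \<in> nb X \<Longrightarrow> Y \<in> \<F>" unfolding nb_def by auto

lemma finF: "finite \<F>"
  using facet finV by (meson finite_Pow_iff finite_subset PowI subsetI)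

lemma fin_nb: "finite (nb X)" using finF unfolding nb_def by auto

lemma fin_facet: "X \<in> \<F> \<Longrightarrow> finite X" using facet finV finite_subset by blast

lemma facet_eq: "X \<in> \<F> \<Longrightarrow> Y \<in> \<F> \<Longrightarrow> X \<subseteq> Y \<Longrightarrow> X = Y"
  using facet fin_facet by (metis card_subset_eq)

lemma nb_irrefl: "X \<in> \<F> \<Longrightarrow> X \<notin> nb X" using facet unfolding nb_def by auto

lemma star_ex: "v \<in> V \<Longrightarrow> \<exists>X\<in>\<F>. v \<in> X" using meet by blast

text \<open>A closed set that has one facet of a star contains the whole star, and by neighborliness
  any two stars have a common facet.\<close>

lemma conn:
  assumes "A \<subseteq> \<F>" "A \<noteq> {}" "\<And>X. X \<in> A \<Longrightarrow> nb X \<subseteq> A"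
  shows "A = \<F>"
proof -
  have st: "{X \<in> \<F>. v \<in> X} \<subseteq> A" if "X \<in> A" "v \<in> X" for X v
  proof -
    have "v \<in> V" using that assms(1) facet by auto
    then have "A \<inter> {X \<in> \<F>. v \<in> X} = {X \<in> \<F>. v \<in> X}"
      by (rule star_conn) (use that assms in \<open>auto simp: nb_def\<close>)
    then show ?thesis by auto
  qed
  have ne: "\<exists>v. v \<in> X" if "X \<in> \<F>" for X using facet[OF that] by (metis all_not_in_conv card.empty zero_neq_numeral)
  have "Y \<in> A" if Y: "Y \<in> \<F>" for Y
  proof -
    obtain X where X: "X \<in> A" using assms(2) by auto
    then have XF: "X \<in> \<F>" using assms(1) by auto
    then obtain v w where vw: "v \<in> X" "w \<in> Y" using ne Y by blast
    then have "v \<in> V" "w \<in> V" using facet[OF XF] facet[OF Y] by auto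
    then obtain Z where Z: "Z \<in> \<F>" "v \<in> Z" "w \<in> Z" using meet by blast
    then have "Z \<in> A" using st[OF X vw(1)] by auto
    then show "Y \<in> A" using st[OF _ Z(3)] Y vw by auto
  qed
  then show ?thesis using assms by auto
qed

lemma star_closed:
  assumes "v \<in> V" "A \<subseteq> {X \<in> \<F>. v \<in> X}" "A \<noteq> {}" "\<And>X Y. X \<in> A \<Longrightarrow> Y \<in> nb X \<Longrightarrow> v \<in> Y \<Longrightarrow> Y \<in> A"
  shows "A = {X \<in> \<F>. v \<in> X}" "card A = 10"
proof -
  show "A = {X \<in> \<F>. v \<in> X}" by (rule star_conn) (use assms in \<open>auto simp: nb_def\<close>)
  then show "card A = 10" using star_card assms(1) by auto
qed

text \<open>All stars of vertices outside \<open>z\<close> avoid \<open>z\<close>, are connected and meet each other, so they lie on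
  one side of \<open>z\<close>; a facet on the other side would be contained in \<open>z\<close>.\<close>

lemma no_cut_facet:
  assumes S: "S \<subseteq> \<F>" "S \<noteq> {}" "z \<notin> S" "z \<in> \<F>" and cl: "\<And>X. X \<in> S \<Longrightarrow> nb X \<subseteq> insert z S"
  shows "\<F> = insert z S"
proof (rule ccontr)
  assume "\<F> \<noteq> insert z S"
  then obtain Y where Y: "Y \<in> \<F>" "Y \<noteq> z" "Y \<notin> S" using S by auto
  have side: "{X \<in> \<F>. v \<in> X} \<subseteq> S" if "v \<in> V - z" "X \<in> S" "v \<in> X" for v X
  proof -
    have "S \<inter> {X \<in> \<F>. v \<in> X} = {X \<in> \<F>. v \<in> X}"
      by (rule star_closed) (use that S cl in auto)
    then show ?thesis by auto
  qed
  obtain X where X: "X \<in> S" using S by auto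
  have "X \<in> \<F>" "X \<noteq> z" using X S by auto
  then obtain v where v: "v \<in> X" "v \<notin> z" using facet_eq S(4) by blast
  obtain w where w: "w \<in> Y" "w \<notin> z" using facet_eq S(4) Y by blast
  have vw: "v \<in> V" "w \<in> V" using v w X Y S facet by auto
  then obtain Z where Z: "Z \<in> \<F>" "v \<in> Z" "w \<in> Z" using meet by blast
  have "Z \<in> S" using side[of v X] v vw X Z by auto
  then have "Y \<in> S" using side[of w Z] w vw Z Y by auto
  then show False using Y by simp
qed

text \<open>Incidences of vertices and facets: \<open>15 * 10 = 25 * 6\<close>.\<close>

lemma cardF: "card \<F> = 25"
proof -
  have "sum (\<lambda>X. card {v \<in> V. v \<in> X}) \<F> = 10 * card V"
    by (rule sum_multicount[OF finF finV]) (use star_card in auto)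
  moreover have "card {v \<in> V. v \<in> X} = 6" if "X \<in> \<F>" for X
  proof -
    have "{v \<in> V. v \<in> X} = X" using facet[OF that] by auto
    then show ?thesis using facet[OF that] by simp
  qed
  ultimately show ?thesis using cardV by simp
qed

text \<open>For a facet \<open>X\<close> with a single neighbour \<open>Y\<close>, a vertex of
  \<open>X\<close> outside \<open>Y\<close> would have the star \<open>{X}\<close> instead of ten
  facets.\<close>

lemma deg_ge2: assumes X: "X \<in> \<F>" shows "2 \<le> card (nb X)"
proof (rule ccontr)
  assume a: "\<not> 2 \<le> card (nb X)"
  have "nb X \<noteq> {}"
  proof
    assume "nb X = {}"
    then have "\<F> = {X}" using conn[of "{X}"] X by auto
    then show False using cardF by simp
  qed
  then have "card (nb X) = 1" using a fin_nb[of X] by (metis One_nat_def Suc_1 card_0_eq less_2_cases not_le)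
  then obtain Y where Y: "nb X = {Y}" by (auto simp: card_1_singleton_iff)
  then have "Y \<in> \<F>" "Y \<noteq> X" using nb_F[of Y X] nb_irrefl X by auto
  then obtain v where v: "v \<in> X" "v \<notin> Y" using X facet_eq by blast
  have "card {X} = 10" by (rule star_closed(2)[of v]) (use v X Y facet in auto)
  then show False by simp
qed

text \<open>Counts the vertices shared by ordered adjacent pairs:
  \<open>15 * 18 = 54 * 5\<close>.\<close>

lemma sum_deg: "(\<Sum>X\<in>\<F>. card (nb X)) = 54"
proof -
  define P where "P = Sigma \<F> nb"
  have finP: "finite P" unfolding P_def using finF fin_nb by auto
  have "sum (\<lambda>p. card {v \<in> V. v \<in> fst p \<inter> snd p}) P = 18 * card V"
  proof (rule sum_multicount[OF finP finV], intro ballI)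
    fix v assume v: "v \<in> V"
    have "{p \<in> P. v \<in> fst p \<inter> snd p} = {(X, Y). X \<in> \<F> \<and> Y \<in> \<F> \<and> v \<in> X \<and> v \<in> Y \<and> card (X \<inter> Y) = 5}"
      unfolding P_def nb_def by auto
    then show "card {p \<in> P. v \<in> fst p \<inter> snd p} = 18" using star_adj[OF v] by simp
  qed
  moreover have "card {v \<in> V. v \<in> fst p \<inter> snd p} = 5" if "p \<in> P" for p
  proof -
    have "{v \<in> V. v \<in> fst p \<inter> snd p} = fst p \<inter> snd p"
      using that facet[of "fst p"] unfolding P_def nb_def by auto
    then show ?thesis using that unfolding P_def nb_def by auto
  qed
  ultimately have "card P = 54" using cardV by simp
  then show ?thesis unfolding P_def using finF fin_nb by simp
qed

lemma sum_excess: "(\<Sum>X\<in>\<F>. card (nb X) - 2) = 4"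
proof -
  have "(\<Sum>X\<in>\<F>. card (nb X)) = (\<Sum>X\<in>\<F>. (card (nb X) - 2) + 2)"
    by (intro sum.cong refl le_add_diff_inverse2[symmetric] deg_ge2)
  then show ?thesis using sum_deg cardF by (simp only: sum.distrib) simp
qed

lemma sum_excess_le: "A \<subseteq> \<F> \<Longrightarrow> (\<Sum>X\<in>A. card (nb X) - 2) \<le> 4"
  using sum_mono2[OF finF, of A "\<lambda>X. card (nb X) - 2"] sum_excess by simp

lemma step_facet:
  assumes "X \<in> \<F>" "Y \<in> nb X"
  obtains d v where "d \<in> X" "v \<notin> X" "Y = insert v (X - {d})" "v \<in> V"
proof -
  have YF: "Y \<in> \<F>" and c: "card (X \<inter> Y) = 5" using assms unfolding nb_def by auto
  have fX: "finite X" "finite Y" using assms YF fin_facet by auto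
  have "card (X - Y) = 1" using c facet[OF assms(1)] fX card_Diff_subset_Int[of X Y] by simp
  moreover have "card (Y - X) = 1" using c facet[OF YF] fX card_Diff_subset_Int[of Y X] by (simp add: Int_commute)
  ultimately obtain d v where d: "X - Y = {d}" and v: "Y - X = {v}" by (auto simp: card_1_singleton_iff)
  have "Y = insert v (X - {d})" using d v by blast
  moreover have "d \<in> X" "v \<notin> X" "v \<in> V" using d v facet[OF YF] by auto
  ultimately show thesis using that by blast
qed

end

section \<open>The action of an automorphism of order three\<close>

locale auto_system = facet_system +
  fixes h :: "'a \<Rightarrow> 'a"
  assumes hV: "v \<in> V \<Longrightarrow> h v \<in> V" and h3: "v \<in> V \<Longrightarrow> h (h (h v)) = v"
    and hF: "X \<in> \<F> \<Longrightarrow> h ` X \<in> \<F>" and nontriv: "\<exists>v\<in>V. h v \<noteq> v"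
begin

definition g :: "'a set \<Rightarrow> 'a set" where "g X = h ` X"

definition orb :: "'a set \<Rightarrow> 'a set set" where
  "orb X = {X, g X, g (g X)}"

lemma gF: "X \<in> \<F> \<Longrightarrow> g X \<in> \<F>" unfolding g_def by (rule hF)

lemma inj_h: "inj_on h V" by (rule inj_on_inverseI[of V "\<lambda>v. h (h v)"]) (rule h3)

lemma g3: "X \<in> \<F> \<Longrightarrow> g (g (g X)) = X"
  using facet[of X] h3 unfolding g_def by (force simp: image_image)

lemma nb_h: assumes "X \<in> \<F>" "Y \<in> nb X" shows "g Y \<in> nb (g X)"
proof -
  have Y: "Y \<in> \<F>" "card (X \<inter> Y) = 5" using assms unfolding nb_def by auto
  have "g X \<inter> g Y = h ` (X \<inter> Y)" unfolding g_def using inj_on_image_Int[OF inj_h] facet assms(1) Y(1) by metis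
  moreover have "card (h ` (X \<inter> Y)) = 5"
    using Y facet[OF assms(1)] card_image[OF inj_on_subset[OF inj_h], of "X \<inter> Y"] by auto
  ultimately show ?thesis using gF Y unfolding nb_def by auto
qed

lemma nb_h_iff: assumes "X \<in> \<F>" "Y \<in> \<F>" shows "g Y \<in> nb (g X) \<longleftrightarrow> Y \<in> nb X"
proof
  assume "g Y \<in> nb (g X)"
  then have "g (g (g Y)) \<in> nb (g (g (g X)))" using nb_h gF assms by auto
  then show "Y \<in> nb X" using g3 assms by simp
qed (rule nb_h[OF assms(1)])

lemma nb_image: assumes "X \<in> \<F>" shows "nb (g X) = g ` nb X"
proof (intro equalityI subsetI)
  fix Y assume Y: "Y \<in> nb (g X)"
  then have "Y = g (g (g Y))" "g (g Y) \<in> \<F>" using nb_F g3 gF by auto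
  then show "Y \<in> g ` nb X" using Y nb_h_iff[OF assms, of "g (g Y)"] by auto
qed (use nb_h assms in auto)

lemma g_inj: "X \<in> \<F> \<Longrightarrow> Y \<in> \<F> \<Longrightarrow> g X = g Y \<Longrightarrow> X = Y" using g3 by metis

lemma deg_h: "X \<in> \<F> \<Longrightarrow> card (nb (g X)) = card (nb X)"
  unfolding nb_image by (rule card_image, rule inj_onI) (use g_inj nb_F in blast)

lemma orb_h: "X \<in> \<F> \<Longrightarrow> orb (g X) = orb X" unfolding orb_def using g3 by auto

lemma orb_F: "X \<in> \<F> \<Longrightarrow> orb X \<subseteq> \<F>" unfolding orb_def using gF by auto

lemma orb_eq: "X \<in> \<F> \<Longrightarrow> Y \<in> orb X \<Longrightarrow> orb Y = orb X"
proof -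
  assume X: "X \<in> \<F>" and "Y \<in> orb X"
  then have "Y = X \<or> Y = g X \<or> Y = g (g X)" unfolding orb_def by auto
  then show "orb Y = orb X" using orb_h[OF X] orb_h[OF gF[OF X]] by metis
qed

lemma orb_self: "X \<in> orb X" unfolding orb_def by auto

lemma orb_deg: "X \<in> \<F> \<Longrightarrow> Y \<in> orb X \<Longrightarrow> card (nb Y) = card (nb X)"
  unfolding orb_def using deg_h gF by auto

lemma fixed_h_iff: "X \<in> \<F> \<Longrightarrow> g (g X) = g X \<longleftrightarrow> g X = X" using g3 by metis

lemma fixed_hh_iff: "X \<in> \<F> \<Longrightarrow> g (g X) = X \<longleftrightarrow> g X = X" using g3 by metis

lemma orb_fixed_iff: "X \<in> \<F> \<Longrightarrow> Y \<in> orb X \<Longrightarrow> g Y = Y \<longleftrightarrow> g X = X"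
proof -
  assume X: "X \<in> \<F>" and "Y \<in> orb X"
  then have "Y = X \<or> Y = g X \<or> Y = g (g X)" unfolding orb_def by simp
  then show ?thesis using fixed_h_iff[OF X] fixed_h_iff[OF gF[OF X]] by metis
qed

lemma card_orb: assumes "X \<in> \<F>" "g X \<noteq> X" shows "card (orb X) = 3"
proof -
  have "g (g X) \<noteq> X" "g (g X) \<noteq> g X" using fixed_h_iff fixed_hh_iff assms by auto
  then show ?thesis using assms(2) unfolding orb_def by (simp add: eq_commute)
qed

text \<open>If all facets were invariant, take two adjacent ones of which only the first contains a
  moved vertex \<open>v\<close>. The step between them drops nothing but \<open>v\<close>, so
  \<open>h v\<close> stays, and invariance of the second facet brings \<open>v\<close> back.\<close>

lemma ex_nonfixed_facet: "\<exists>X\<in>\<F>. g X \<noteq> X"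
proof (rule ccontr)
  assume "\<not> (\<exists>X\<in>\<F>. g X \<noteq> X)"
  then have fx: "g X = X" if "X \<in> \<F>" for X using that by auto
  obtain v where v: "v \<in> V" "h v \<noteq> v" using nontriv by auto
  define A where "A = {X \<in> \<F>. v \<in> X}"
  have "card A = 10" unfolding A_def using star_card v by auto
  then have "A \<noteq> \<F>" "A \<noteq> {}" using cardF by auto
  moreover have "A \<subseteq> \<F>" unfolding A_def by auto
  ultimately obtain X where X: "X \<in> A" "\<not> nb X \<subseteq> A" using conn by blast
  then obtain Y where Y: "Y \<in> nb X" "Y \<notin> A" by auto
  have XF: "X \<in> \<F>" "v \<in> X" using X A_def by auto
  obtain d w where dw: "d \<in> X" "w \<notin> X" "Y = insert w (X - {d})" using step_facet[OF XF(1) Y(1)] by metis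
  have "Y \<in> \<F>" using nb_F Y by auto
  then have "v \<notin> Y" using Y A_def by auto
  then have "v = d" using dw XF by auto
  have "h v \<in> X" using fx[OF XF(1)] XF unfolding g_def by auto
  then have "h v \<in> Y" using dw v \<open>v = d\<close> by auto
  then have "h (h (h v)) \<in> Y" using fx[OF \<open>Y \<in> \<F>\<close>] unfolding g_def by blast
  then show False using h3 v \<open>v \<notin> Y\<close> by simp
qed

lemma ex_fixed_facet: "\<exists>X\<in>\<F>. g X = X"
proof (rule ccontr)
  assume "\<not> ?thesis"
  then have "3 dvd card \<F>"
    by (intro three_dvd_card_if_free[of _ "g"]) (use finF gF g3 in auto)
  then show False using cardF by simp
qed

lemma ex_boundary_facet: obtains z y where "z \<in> \<F>" "g z = z" "y \<in> nb z" "g y \<noteq> y"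
proof -
  define A where "A = {X \<in> \<F>. g X = X}"
  have "A \<noteq> \<F>" "A \<noteq> {}" "A \<subseteq> \<F>" using ex_nonfixed_facet ex_fixed_facet unfolding A_def by auto
  then obtain X where X: "X \<in> A" "\<not> nb X \<subseteq> A" using conn by blast
  then show thesis using that nb_F unfolding A_def by blast
qed

lemma orb_nb_fixed: "z \<in> \<F> \<Longrightarrow> g z = z \<Longrightarrow> y \<in> nb z \<Longrightarrow> orb y \<subseteq> nb z"
  unfolding orb_def using nb_h[of z] by (metis empty_subsetI insert_subset)

text \<open>The rotated copies of a moved neighbour are neighbours as well.\<close>

lemma deg_fixed: "z \<in> \<F> \<Longrightarrow> g z = z \<Longrightarrow> y \<in> nb z \<Longrightarrow> g y \<noteq> y \<Longrightarrow> 3 \<le> card (nb z)"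
  using orb_nb_fixed[of z y] card_orb[of y] nb_F card_mono[OF fin_nb] by metis

lemma nb_fixed_deg2: "X \<in> \<F> \<Longrightarrow> g X = X \<Longrightarrow> card (nb X) = 2 \<Longrightarrow> Y \<in> nb X \<Longrightarrow> g Y = Y"
  using deg_fixed by force

text \<open>The facets after \<open>z\<close> lie in pairwise different orbits, which is stronger
  than being distinct: the chain must not run into rotated copies of itself either.\<close>

definition chain :: "'a set \<Rightarrow> 'a set \<Rightarrow> (nat \<Rightarrow> 'a set) \<Rightarrow> nat \<Rightarrow> bool" where
  "chain z y p n \<longleftrightarrow> p 0 = z \<and> p 1 = y \<and> 1 \<le> n \<and> (\<forall>i<n. p (Suc i) \<in> nb (p i)) \<and>
     (\<forall>i\<in>{1..n}. p i \<in> \<F> \<and> g (p i) \<noteq> p i) \<and> inj_on (\<lambda>i. orb (p i)) {1..n}"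

section \<open>Chains of facets that leave a fixed facet\<close>

context
  fixes z y assumes z: "z \<in> \<F>" "g z = z" and y: "y \<in> nb z" "g y \<noteq> y"
begin

lemma chain_1: "chain z y (\<lambda>i. if i = 0 then z else y) 1"
  unfolding chain_def using y nb_F by auto

text \<open>A crude bound, whose purpose is that a longest chain exists.\<close>

lemma chain_bound: "chain z y p n \<Longrightarrow> n \<le> 25"
proof -
  assume c: "chain z y p n"
  have "card {1..n} \<le> card (orb ` \<F>)"
    by (rule card_inj_on_le[of "\<lambda>i. orb (p i)"]) (use c finF in \<open>auto simp: chain_def\<close>)
  also have "\<dots> \<le> 25" using card_image_le[OF finF] cardF by metis
  finally show ?thesis by simp
qed

lemma chain_F: "chain z y p n \<Longrightarrow> i \<le> n \<Longrightarrow> p i \<in> \<F>"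
  using z unfolding chain_def by (cases "i = 0") auto

lemma chain_orb: "chain z y p n \<Longrightarrow> i \<le> n \<Longrightarrow> 1 \<le> k \<Longrightarrow> k \<le> n \<Longrightarrow> p i \<in> orb (p k) \<Longrightarrow> i = k"
proof (cases "i = 0")
  case True
  assume "chain z y p n" "1 \<le> k" "k \<le> n" "p i \<in> orb (p k)"
  then show ?thesis using True z orb_fixed_iff[of "p k" "p i"] unfolding chain_def by auto
next
  case False
  assume c: "chain z y p n" "i \<le> n" "1 \<le> k" "k \<le> n" "p i \<in> orb (p k)"
  have "orb (p i) = orb (p k)" using orb_eq c chain_F by blast
  then show ?thesis using c False inj_onD[of "\<lambda>i. orb (p i)" "{1..n}" i k] unfolding chain_def by auto
qed

lemma chain_not_orb: "chain z y p n \<Longrightarrow> i \<le> n \<Longrightarrow> 1 \<le> k \<Longrightarrow> k \<le> n \<Longrightarrow> i \<noteq> k \<Longrightarrow> p i \<notin> orb (p k)"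
  using chain_orb by blast

lemma chain_step: "chain z y p n \<Longrightarrow> i < n \<Longrightarrow> p (Suc i) \<in> nb (p i)"
  unfolding chain_def by simp

lemma chain_prev: assumes "chain z y p n" "1 \<le> i" "i \<le> n" shows "p (i - 1) \<in> nb (p i)"
proof -
  obtain k where k: "i = Suc k" using assms(2) by (cases i) auto
  then have "p i \<in> nb (p k)" using chain_step assms by simp
  then show ?thesis using nb_sym[of "p k"] chain_F[OF assms(1), of k] k assms by simp
qed

lemma chain_nb:
  assumes c: "chain z y p n" and i: "1 \<le> i" "i < n" and d: "card (nb (p i)) = 2"
  shows "nb (p i) = {p (i - 1), p (Suc i)}"
proof -
  have s: "{p (i - 1), p (Suc i)} \<subseteq> nb (p i)" using chain_step[OF c] chain_prev[OF c] i by simp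
  have "p (i - 1) \<noteq> p (Suc i)"
  proof
    assume "p (i - 1) = p (Suc i)"
    then have "p (i - 1) \<in> orb (p (Suc i))" using orb_self by simp
    then show False using chain_orb[OF c, of "i - 1" "Suc i"] i by linarith
  qed
  then have "card {p (i - 1), p (Suc i)} = card (nb (p i))" using d by simp
  then show ?thesis using card_subset_eq[OF fin_nb s] by simp
qed

text \<open>A facet of degree two in the interior of the chain has its two neighbours on the chain.
  If the continuation \<open>q\<close> were a rotated copy of it, rotating back would make a copy of
  the end \<open>p n\<close> one more neighbour.\<close>

lemma chain_new:
  assumes c: "chain z y p n" and q: "q \<in> nb (p n)" "q \<noteq> p (n - 1)"
    and i: "1 \<le> i" "i \<le> n" and d: "card (nb (p i)) = 2"
  shows "q \<notin> orb (p i)"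
proof
  assume qi: "q \<in> orb (p i)"
  have n: "1 \<le> n" using c unfolding chain_def by auto
  have pn: "p n \<in> \<F>" "p i \<in> \<F>" "g (p n) \<noteq> p n" using chain_F[OF c] c i n unfolding chain_def by auto
  have qF: "q \<in> \<F>" using q nb_F by auto
  have sy: "p n \<in> nb q" using nb_sym pn q by auto
  \<comment> \<open>For \<open>i = n\<close> the facet \<open>p i\<close> would have the three
    neighbours \<open>p (n - 1)\<close>, \<open>q\<close> and \<open>r\<close>. For
    \<open>i < n\<close> its neighbours are on the chain, and the only one of them in the orbit of
    \<open>p n\<close> is \<open>p n\<close> itself.\<close>
  have key: False if r: "r \<in> orb (p n)" "r \<in> nb (p i)" "r \<noteq> p n" "i = n \<Longrightarrow> r \<noteq> q" for r
  proof (cases "i = n")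
    case True
    have "p (n - 1) \<notin> orb (p n)" using chain_orb[OF c, of "n - 1" n] n by auto
    then have "r \<noteq> p (n - 1)" using r by auto
    then have "card {p (n - 1), q, r} = 3" using r(4)[OF True] q by auto
    moreover have "{p (n - 1), q, r} \<subseteq> nb (p n)" using r True q chain_prev[OF c n] by auto
    ultimately have "3 \<le> card (nb (p n))" using card_mono[OF fin_nb] by metis
    then show False using d True by simp
  next
    case False
    then have "r = p (i - 1) \<or> r = p (Suc i)" using chain_nb[OF c i(1) _ d] i r by auto
    then have "p (i - 1) \<in> orb (p n) \<or> r = p (Suc i) \<and> p (Suc i) \<in> orb (p n)" using r by auto
    then have "r = p n" using chain_orb[OF c, of "i - 1" n] chain_orb[OF c, of "Suc i" n] i n False by force
    then show False using r by simp
  qed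
  consider "q = p i" | "q = g (p i)" | "q = g (g (p i))" using qi unfolding orb_def by auto
  then show False
  proof cases
    case 1
    then have "i \<noteq> n" using q nb_irrefl pn by auto
    then have "p n = p (i - 1) \<or> p n = p (Suc i)" using chain_nb[OF c i(1) _ d] i sy 1 by auto
    then have "p (i - 1) \<in> orb (p n) \<or> p (Suc i) \<in> orb (p n)" using orb_self by metis
    then have "Suc i = n" using chain_orb[OF c, of "i - 1" n] chain_orb[OF c, of "Suc i" n] i n \<open>i \<noteq> n\<close> by force
    then show False using q 1 by auto
  next
    case 2
    have "g (g (p n)) \<in> nb (g (g q))" using nb_h gF qF sy by auto
    then have "g (g (p n)) \<in> nb (p i)" using 2 g3 pn by simp
    then show False
      by (rule key[rotated]) (use fixed_hh_iff fixed_h_iff pn 2 in \<open>auto simp: orb_def\<close>)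
  next
    case 3
    have "g (p n) \<in> nb (g q)" using nb_h qF sy by auto
    then have "g (p n) \<in> nb (p i)" using 3 g3 pn by simp
    then show False
      by (rule key[rotated]) (use fixed_hh_iff fixed_h_iff pn 3 in \<open>auto simp: orb_def\<close>)
  qed
qed

lemma chain_ext:
  assumes c: "chain z y p n" and q: "q \<in> nb (p n)" "g q \<noteq> q" "\<And>i. 1 \<le> i \<Longrightarrow> i \<le> n \<Longrightarrow> q \<notin> orb (p i)"
  shows "chain z y (p(Suc n := q)) (Suc n)"
proof -
  have qF: "q \<in> \<F>" using q nb_F by auto
  have "orb q \<noteq> orb (p i)" if "1 \<le> i" "i \<le> n" for i using q(3)[OF that] orb_self[of q] by auto
  then have "orb q \<notin> (\<lambda>i. orb (p i)) ` {1..n}" by (metis (no_types, lifting) imageE atLeastAtMost_iff)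
  then have "orb q \<notin> (\<lambda>i. orb ((p(Suc n := q)) i)) ` {1..n}" by (auto simp: image_iff)
  moreover have "inj_on (\<lambda>i. orb ((p(Suc n := q)) i)) {1..n}"
    using c unfolding chain_def by (subst inj_on_cong[of _ _ "\<lambda>i. orb (p i)"]) auto
  moreover have "{1..Suc n} = insert (Suc n) {1..n}" by auto
  ultimately have "inj_on (\<lambda>i. orb ((p(Suc n := q)) i)) {1..Suc n}" by simp
  then show ?thesis using c q(1,2) qF unfolding chain_def by (auto simp: less_Suc_eq le_Suc_eq)
qed

lemma ex_maximal_chain:
  obtains p n where "chain z y p n"
    "\<And>q. q \<in> nb (p n) \<Longrightarrow> g q \<noteq> q \<Longrightarrow> \<exists>i. 1 \<le> i \<and> i \<le> n \<and> q \<in> orb (p i)"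
proof -
  have "\<exists>n. (\<exists>p. chain z y p n) \<and> (\<forall>m. (\<exists>p. chain z y p m) \<longrightarrow> m \<le> n)"
    using Greatest_le_nat[of "\<lambda>n. \<exists>p. chain z y p n" _ 25] GreatestI_nat[of "\<lambda>n. \<exists>p. chain z y p n" 1 25]
      chain_bound chain_1 by blast
  then obtain n p where np: "chain z y p n" "\<And>m p'. chain z y p' m \<Longrightarrow> m \<le> n" by blast
  show thesis
  proof (rule that[OF np(1)])
    fix q assume "q \<in> nb (p n)" "g q \<noteq> q"
    then show "\<exists>i. 1 \<le> i \<and> i \<le> n \<and> q \<in> orb (p i)"
      using chain_ext[OF np(1)] np(2)[of _ "Suc n"] by fastforce
  qed
qed

lemma card_chain_orbits:
  assumes c: "chain z y p n" shows "card (\<Union>i\<in>{1..n}. orb (p i)) = 3 * n"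
proof -
  have "card (\<Union>i\<in>{1..n}. orb (p i)) = (\<Sum>i\<in>{1..n}. card (orb (p i)))"
  proof (rule card_UN_disjoint)
    show "\<forall>i\<in>{1..n}. \<forall>k\<in>{1..n}. i \<noteq> k \<longrightarrow> orb (p i) \<inter> orb (p k) = {}"
    proof (intro ballI impI)
      fix i k assume ik: "i \<in> {1..n}" "k \<in> {1..n}" "i \<noteq> k"
      have False if "X \<in> orb (p i)" "X \<in> orb (p k)" for X
      proof -
        have "orb (p i) = orb (p k)" using that orb_eq[of "p i" X] orb_eq[of "p k" X] chain_F[OF c] ik by simp
        then show False using chain_orb[OF c, of i k] orb_self[of "p i"] ik by simp
      qed
      then show "orb (p i) \<inter> orb (p k) = {}" by auto
    qed
  qed (auto simp: orb_def)
  also have "\<dots> = (\<Sum>i\<in>{1..n}. 3)" using c card_orb by (intro sum.cong) (auto simp: chain_def)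
  finally show ?thesis by simp
qed

lemma card_nb_ge: "T \<subseteq> nb X \<Longrightarrow> card T \<le> card (nb X)" by (rule card_mono[OF fin_nb])

lemma ex_continuation: assumes c: "chain z y p n" obtains q where "q \<in> nb (p n)" "q \<noteq> p (n - 1)"
proof -
  have "\<not> nb (p n) \<subseteq> {p (n - 1)}"
    using card_mono[of "{p (n - 1)}" "nb (p n)"] deg_ge2[OF chain_F[OF c], of n] by auto
  then show thesis using that by auto
qed

lemma chain_end:
  assumes c: "chain z y p n" and q: "q \<in> nb (p n)" "q \<noteq> p (n - 1)" and d: "card (nb (p n)) = 2"
  shows "nb (p n) = {p (n - 1), q}"
proof -
  have n: "1 \<le> n" using c unfolding chain_def by simp
  have "{p (n - 1), q} \<subseteq> nb (p n)" using q chain_prev[OF c n] by simp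
  moreover have "card {p (n - 1), q} = card (nb (p n))" using q d by simp
  ultimately show ?thesis using card_subset_eq[OF fin_nb] by metis
qed

lemma chain_z: "chain z y p n \<Longrightarrow> 1 \<le> i \<Longrightarrow> i \<le> n \<Longrightarrow> p i \<noteq> z"
proof
  assume "chain z y p n" "1 \<le> i" "i \<le> n" "p i = z"
  then have "g z \<noteq> z" unfolding chain_def by (metis atLeastAtMost_iff)
  then show False using z(2) by simp
qed

lemma nb_orbits:
  assumes M: "\<And>X. X \<in> M \<Longrightarrow> g X \<in> M" and X: "X \<in> \<F>" "nb X \<subseteq> M" and Y: "Y \<in> orb X"
  shows "nb Y \<subseteq> M"
proof -
  have "nb (g X) \<subseteq> M" "nb (g (g X)) \<subseteq> M" using nb_image gF X M by auto
  then show ?thesis using Y X unfolding orb_def by auto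
qed

lemma orb_g: "X \<in> \<F> \<Longrightarrow> Y \<in> orb X \<Longrightarrow> g Y \<in> orb X"
  unfolding orb_def using g3 by auto

text \<open>The orbit of \<open>x\<close> and \<open>z\<close> are four facets of excess at least
  one, so their degree is three and every other degree is two. A longest chain can then end only
  next to a rotated copy of a branch facet \<open>p j\<close> on it, and the rotated chains together
  with \<open>z\<close> are closed under adjacency.\<close>

lemma lollipop_structure:
  assumes x: "x \<in> \<F>" "g x \<noteq> x" "3 \<le> card (nb x)"
  shows "\<exists>p j. chain z y p 8 \<and> 1 \<le> j \<and> j \<le> 8 \<and> (g (p j) \<in> nb (p 8) \<or> g (g (p j)) \<in> nb (p 8)) \<and>
    (\<forall>i\<in>{1..7}. i \<noteq> j \<longrightarrow> nb (p i) = {p (i - 1), p (Suc i)}) \<and>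
    (j \<noteq> 8 \<longrightarrow> nb (p 8) = {p 7, g (p j)} \<or> nb (p 8) = {p 7, g (g (p j))}) \<and>
    nb z = orb (p 1) \<and> \<F> = insert z (\<Union>i\<in>{1..8}. orb (p i))"
proof -
  define A where "A = insert z (orb x)"
  have zx: "z \<notin> orb x" using orb_fixed_iff x z by metis
  have cA: "card A = 4" "finite A" "A \<subseteq> \<F>"
    unfolding A_def using zx card_orb[OF x(1,2)] orb_F[OF x(1)] z by (auto simp: orb_def)
  have dA: "3 \<le> card (nb X)" if "X \<in> A" for X
    using that deg_fixed[OF z y] orb_deg[OF x(1)] x(3) unfolding A_def by auto
  have s: "card B \<le> (\<Sum>X\<in>B. card (nb X) - 2)" if "B \<subseteq> A" for B
    using sum_mono[of B "\<lambda>_. 1" "\<lambda>X. card (nb X) - 2"] dA that by fastforce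
  have d2: "card (nb X) = 2" if "X \<in> \<F>" "X \<notin> A" for X
    using sum_excess_le[of "insert X A"] s[of A] that cA deg_ge2[of X] by simp
  have d3: "card (nb X) = 3" if "X \<in> A" for X
    using sum_excess_le[of A] s[of "A - {X}"] sum.remove[OF cA(2) that, of "\<lambda>X. card (nb X) - 2"] that cA dA[OF that]
    by simp
  have nbz: "nb z = orb y"
    using card_subset_eq[OF fin_nb orb_nb_fixed[OF z y(1)]] card_orb[OF nb_F[OF y(1)] y(2)] d3[of z]
    unfolding A_def by simp
  obtain p n where c: "chain z y p n"
    and mx: "\<And>q. q \<in> nb (p n) \<Longrightarrow> g q \<noteq> q \<Longrightarrow> \<exists>i. 1 \<le> i \<and> i \<le> n \<and> q \<in> orb (p i)"
    using ex_maximal_chain by blast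
  have n: "1 \<le> n" and p0: "p 0 = z" and p1: "p 1 = y" using c unfolding chain_def by auto
  obtain q where q: "q \<in> nb (p n)" "q \<noteq> p (n - 1)" by (rule ex_continuation[OF c])
  have pF: "p i \<in> \<F>" if "i \<le> n" for i using chain_F[OF c that] .
  have pf: "g (p i) \<noteq> p i" if "1 \<le> i" "i \<le> n" for i using c that unfolding chain_def by auto
  have qF: "q \<in> \<F>" using q nb_F by simp
  have sy: "p n \<in> nb q" using nb_sym pF q by simp
  \<comment> \<open>A fixed \<open>q\<close> with the moved neighbour \<open>p n\<close> has degree
    three and must be \<open>z\<close>. Then \<open>n = 1\<close>, and \<open>q\<close> is the
    predecessor of \<open>p n\<close>, which was excluded.\<close>
  have "g q \<noteq> q"
  proof
    assume gq: "g q = q"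
    then have "3 \<le> card (nb q)" using deg_fixed[OF qF _ sy] pf n by simp
    then have "q \<in> A" using d2 qF by force
    then have "q = z" using gq orb_fixed_iff[OF x(1)] x(2) unfolding A_def by auto
    then have "p n \<in> orb (p 1)" using sy nbz p1 by simp
    then have "n = 1" using chain_orb[OF c, of n 1] n by simp
    then show False using q \<open>q = z\<close> p0 by simp
  qed
  then obtain j where j: "1 \<le> j" "j \<le> n" "q \<in> orb (p j)" using mx q by blast
  have "card (nb (p j)) \<noteq> 2" using chain_new[OF c q j(1,2)] j(3) by blast
  then have "p j \<in> A" using d2 pF j by blast
  then have jx: "p j \<in> orb x" using chain_z[OF c j(1,2)] unfolding A_def by simp
  have deg2: "card (nb (p i)) = 2" if "1 \<le> i" "i \<le> n" "i \<noteq> j" for i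
  proof (rule d2[OF pF[OF that(2)]])
    have "p i \<notin> orb x"
    proof
      assume "p i \<in> orb x"
      then have "orb (p i) = orb (p j)" using orb_eq x(1) jx by metis
      then show False using chain_orb[OF c that(2) j(1,2)] orb_self that(3) by metis
    qed
    then show "p i \<notin> A" using chain_z[OF c that(1,2)] unfolding A_def by simp
  qed
  have nbi: "nb (p i) = {p (i - 1), p (Suc i)}" if "1 \<le> i" "i < n" "i \<noteq> j" for i
    using chain_nb[OF c that(1,2) deg2] that by simp
  have nbn: "nb (p n) = {p (n - 1), q}" if "j \<noteq> n"
    using chain_end[OF c q deg2] n that by simp
  \<comment> \<open>If the chain closed up at \<open>p j\<close> itself, the facets after
    \<open>p j\<close> would form a loop attached to the rest only at \<open>p j\<close>, against
    \<open>no_cut_facet\<close>.\<close>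
  have qj: "q \<noteq> p j"
  proof
    assume e: "q = p j"
    then have jn: "j < n" using nb_irrefl pF[of n] q j by (metis le_neq_implies_less order_refl)
    have "\<F> = insert (p j) (p ` {Suc j..n})"
    proof (rule no_cut_facet)
      show "p ` {Suc j..n} \<subseteq> \<F>" "p ` {Suc j..n} \<noteq> {}" "p j \<in> \<F>" using pF j(2) jn by (simp_all add: image_subset_iff)
      show "p j \<notin> p ` {Suc j..n}"
      proof
        assume "p j \<in> p ` {Suc j..n}"
        then obtain i where i: "Suc j \<le> i" "i \<le> n" "p j = p i" by (metis atLeastAtMost_iff imageE)
        then have "p i \<in> orb (p j)" using orb_self by metis
        then show False using chain_orb[OF c i(2) j(1,2)] i by simp
      qed
      show "nb X \<subseteq> insert (p j) (p ` {Suc j..n})" if X: "X \<in> p ` {Suc j..n}" for X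
      proof -
        obtain i where i: "Suc j \<le> i" "i \<le> n" "X = p i" using X by auto
        have m: "p (i - 1) \<in> insert (p j) (p ` {Suc j..n})"
        proof (cases "i = Suc j")
          case False
          then have "i - 1 \<in> {Suc j..n}" using i by auto
          then show ?thesis by blast
        qed simp
        show ?thesis
        proof (cases "i = n")
          case True then show ?thesis using nbn jn e m i by simp
        next
          case False
          then have "p (Suc i) \<in> p ` {Suc j..n}" using i by simp
          then show ?thesis using nbi[of i] i m j False by simp
        qed
      qed
    qed
    then have "z \<in> insert (p j) (p ` {Suc j..n})" using z by simp
    then obtain i where "j \<le> i" "i \<le> n" "z = p i" using j(2) by (metis Suc_leD atLeastAtMost_iff imageE insertE order_refl)
    then show False using chain_z[OF c] j(1) by (metis le_trans)
  qed
  have qq: "q = g (p j) \<or> q = g (g (p j))" using j(3) qj unfolding orb_def by simp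
  \<comment> \<open>Rotating the adjacency of \<open>p n\<close> and \<open>q\<close> such that
    \<open>q\<close> becomes \<open>p j\<close> yields the third neighbour of the branch
    facet.\<close>
  obtain r where r: "r \<in> nb (p j)" "r \<in> orb (p n)" "r \<noteq> p n" "j = n \<Longrightarrow> r \<noteq> q"
  proof (cases "q = g (p j)")
    case True
    have "g (g (p n)) \<in> nb (g (g q))" using nb_h gF qF sy by simp
    then show thesis using that[of "g (g (p n))"] True g3 pF j pf[OF n] fixed_h_iff[of "p n"] fixed_hh_iff[of "p n"]
      by (simp add: orb_def)
  next
    case False
    have "g (p n) \<in> nb (g q)" using nb_h qF sy by simp
    then show thesis using that[of "g (p n)"] False qq g3 pF j pf[OF n] fixed_h_iff[of "p n"] fixed_hh_iff[of "p n"]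
      by (simp add: orb_def)
  qed
  define M where "M = insert z (\<Union>i\<in>{1..n}. orb (p i))"
  have pM: "p i \<in> M" if "i \<le> n" for i unfolding M_def using that p0 orb_self by (cases "i = 0") force+
  have oM: "orb (p i) \<subseteq> M" if "1 \<le> i" "i \<le> n" for i unfolding M_def using that by auto
  have gM: "g X \<in> M" if "X \<in> M" for X
  proof (cases "X = z")
    case False
    then have "X \<in> (\<Union>i\<in>{1..n}. orb (p i))" using that unfolding M_def by blast
    then obtain i where i: "i \<in> {1..n}" "X \<in> orb (p i)" by blast
    then have "g X \<in> orb (p i)" using orb_g pF by simp
    then show ?thesis using i unfolding M_def by blast
  qed (use z(2) in \<open>simp add: M_def\<close>)
  have nbj: "nb (p j) \<subseteq> M"
  proof (cases "j = n")
    case True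
    have "p (n - 1) \<notin> orb (p n)" by (rule chain_not_orb[OF c]) (use n in auto)
    then have "r \<noteq> p (n - 1)" using r by auto
    then have "card {p (n - 1), q, r} = card (nb (p j))" using r(4)[OF True] q d3[OF \<open>p j \<in> A\<close>] by auto
    moreover have "{p (n - 1), q, r} \<subseteq> nb (p j)" using r True q chain_prev[OF c n] by auto
    ultimately have "nb (p j) = {p (n - 1), q, r}" using card_subset_eq[OF fin_nb] by metis
    moreover have "p (n - 1) \<in> M" "q \<in> M" "r \<in> M" using pM[of "n - 1"] subsetD[OF oM[OF j(1,2)] j(3)] subsetD[OF oM[OF n order_refl] r(2)] by simp_all
    ultimately show ?thesis by simp
  next
    case False
    then have jn: "Suc j \<le> n" using j by simp
    have "p (j - 1) \<notin> orb (p n)" by (rule chain_not_orb[OF c]) (use n j in auto)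
    then have 1: "r \<noteq> p (j - 1)" using r by auto
    have 2: "r \<noteq> p (Suc j)"
    proof
      assume "r = p (Suc j)"
      then show False using chain_orb[OF c jn n] r by auto
    qed
    have "p (j - 1) \<notin> orb (p (Suc j))" by (rule chain_not_orb[OF c]) (use jn in auto)
    then have 3: "p (j - 1) \<noteq> p (Suc j)" using orb_self by metis
    have "card {p (j - 1), p (Suc j), r} = card (nb (p j))" using 1 2 3 d3[OF \<open>p j \<in> A\<close>] by auto
    moreover have "{p (j - 1), p (Suc j), r} \<subseteq> nb (p j)" using r chain_prev[OF c j(1,2)] chain_step[OF c, of j] jn by auto
    ultimately have "nb (p j) = {p (j - 1), p (Suc j), r}" using card_subset_eq[OF fin_nb] by metis
    moreover have "p (j - 1) \<in> M" "p (Suc j) \<in> M" "r \<in> M" using pM[of "j - 1"] pM[OF jn] j(2) subsetD[OF oM[OF n order_refl] r(2)] by simp_all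
    ultimately show ?thesis by simp
  qed
  have "M = \<F>"
  proof (rule conn)
    show "M \<subseteq> \<F>" unfolding M_def using z orb_F pF by (simp add: UN_subset_iff)
    show "M \<noteq> {}" unfolding M_def by auto
    have a: "nb (p i) \<subseteq> M" if i: "1 \<le> i" "i \<le> n" for i
    proof -
      consider "i = j" | "i \<noteq> j" "i = n" | "i \<noteq> j" "i < n" using i by linarith
      then show ?thesis
      proof cases
        case 1 then show ?thesis using nbj by simp
      next
        case 2
        have "p (n - 1) \<in> M" "q \<in> M" using pM[of "n - 1"] subsetD[OF oM[OF j(1,2)] j(3)] by simp_all
        then show ?thesis using 2 nbn by simp
      next
        case 3 then show ?thesis using nbi[OF i(1)] pM[of "i - 1"] pM[of "Suc i"] by simp
      qed
    qed
    show "nb X \<subseteq> M" if "X \<in> M" for X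
    proof (cases "X = z")
      case True then show ?thesis using nbz oM[of 1] n p1 by simp
    next
      case False
      then have "X \<in> (\<Union>i\<in>{1..n}. orb (p i))" using \<open>X \<in> M\<close> unfolding M_def by blast
      then obtain i where i: "1 \<le> i" "i \<le> n" "X \<in> orb (p i)" by auto
      show ?thesis by (rule nb_orbits[OF gM pF[OF i(2)] a[OF i(1,2)] i(3)])
    qed
  qed
  moreover have "z \<notin> (\<Union>i\<in>{1..n}. orb (p i))"
  proof
    assume "z \<in> (\<Union>i\<in>{1..n}. orb (p i))"
    then obtain i where i: "1 \<le> i" "i \<le> n" "z \<in> orb (p i)" by auto
    then show False using orb_fixed_iff[OF pF[OF i(2)] i(3)] z(2) pf[OF i(1,2)] by simp
  qed
  moreover have "finite (\<Union>i\<in>{1..n}. orb (p i))" unfolding orb_def by auto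
  ultimately have "Suc (3 * n) = 25" using cardF card_chain_orbits[OF c] unfolding M_def by (metis card_insert_disjoint)
  then have n8: "n = 8" by simp
  have "\<forall>i\<in>{1..7}. i \<noteq> j \<longrightarrow> nb (p i) = {p (i - 1), p (Suc i)}" using nbi n8 by simp
  moreover have "j \<noteq> 8 \<longrightarrow> nb (p 8) = {p 7, g (p j)} \<or> nb (p 8) = {p 7, g (g (p j))}" using nbn qq n8 by auto
  moreover have "\<F> = insert z (\<Union>i\<in>{1..8}. orb (p i))" using \<open>M = \<F>\<close> unfolding M_def n8 by simp
  moreover have "g (p j) \<in> nb (p 8) \<or> g (g (p j)) \<in> nb (p 8)" using q qq n8 by auto
  ultimately show ?thesis using c j nbz p1 unfolding n8 by blast
qed

text \<open>If all facets moved by \<open>g\<close> have degree two, they form three paths with common end facets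
  \<open>z\<close> and \<open>q\<close>, both of degree four. All fixed facets then contain all moved vertices, and the
  first vertex that is added on such a path is a fixed one, so that its star contains the three paths.\<close>

lemma moved_facets_not_all_deg_2:
  assumes D: "\<And>X. X \<in> \<F> \<Longrightarrow> g X \<noteq> X \<Longrightarrow> card (nb X) = 2"
  shows False
proof -
  obtain p n where c: "chain z y p n"
    and mx: "\<And>q. q \<in> nb (p n) \<Longrightarrow> g q \<noteq> q \<Longrightarrow> \<exists>i. 1 \<le> i \<and> i \<le> n \<and> q \<in> orb (p i)"
    using ex_maximal_chain by blast
  have n: "1 \<le> n" and p0: "p 0 = z" and p1: "p 1 = y" using c unfolding chain_def by auto
  obtain q where q: "q \<in> nb (p n)" "q \<noteq> p (n - 1)" by (rule ex_continuation[OF c])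
  have pF: "p i \<in> \<F>" if "i \<le> n" for i using chain_F[OF c that] .
  have pf: "g (p i) \<noteq> p i" if "1 \<le> i" "i \<le> n" for i using c that unfolding chain_def by simp
  have deg2: "card (nb (p i)) = 2" if "1 \<le> i" "i \<le> n" for i using D pF pf that by simp
  have qF: "q \<in> \<F>" using q nb_F by simp
  have sy: "p n \<in> nb q" using nb_sym pF q by simp
  have gq: "g q = q"
  proof (rule ccontr)
    assume "g q \<noteq> q"
    then obtain i where "1 \<le> i" "i \<le> n" "q \<in> orb (p i)" using mx q by blast
    then show False using chain_new[OF c q] deg2 by blast
  qed
  have nbi: "nb (p i) = {p (i - 1), p (Suc i)}" if "1 \<le> i" "i < n" for i
    using chain_nb[OF c that deg2] that by simp
  have nbn: "nb (p n) = {p (n - 1), q}" using chain_end[OF c q deg2] n by simp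
  define P where "P = p ` {1..n}"
  define S where "S = (\<Union>i\<in>{1..n}. orb (p i))"
  have PF: "P \<subseteq> \<F>" unfolding P_def using pF by (simp add: image_subset_iff)
  have PS: "P \<subseteq> S"
  proof
    fix X assume "X \<in> P"
    then obtain i where "i \<in> {1..n}" "X = p i" unfolding P_def by (metis imageE)
    then show "X \<in> S" unfolding S_def using orb_self by (metis UN_I)
  qed
  have pP: "p i \<in> P" if "1 \<le> i" "i \<le> n" for i unfolding P_def using that by simp
  have nbP: "nb (p i) \<subseteq> insert z (insert q P)" if "1 \<le> i" "i \<le> n" for i
  proof -
    have 1: "p (i - 1) \<in> insert z P" using that p0 pP[of "i - 1"] by (cases "i = 1") simp_all
    show ?thesis
    proof (cases "i = n")
      case True then show ?thesis using nbn 1 by simp blast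
    next
      case False
      then show ?thesis using nbi[of i] 1 pP[of "Suc i"] that by simp blast
    qed
  qed
  have SE: "\<exists>i. 1 \<le> i \<and> i \<le> n \<and> X \<in> orb (p i)" if "X \<in> S" for X
    using that unfolding S_def UN_iff Bex_def atLeastAtMost_iff by (simp only: conj_assoc)
  have gS: "g X \<in> S" if X: "X \<in> S" for X
  proof -
    obtain i where i: "1 \<le> i" "i \<le> n" "X \<in> orb (p i)" using SE X by blast
    then have "g X \<in> orb (p i)" using orb_g pF by simp
    then show ?thesis unfolding S_def using i by (intro UN_I[of i]) simp_all
  qed
  have SF: "S \<subseteq> \<F>" unfolding S_def using orb_F pF by (simp add: UN_subset_iff)
  have Sf: "g X \<noteq> X" if "X \<in> S" for X
    using SE[OF that] orb_fixed_iff[OF pF] pf by metis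
  have cS: "card S = 3 * n" unfolding S_def by (rule card_chain_orbits[OF c])
  have zS: "z \<notin> S" "q \<notin> S" using Sf z gq by auto
  have nbS: "nb X \<subseteq> insert z (insert q S)" if "X \<in> S" for X
  proof -
    obtain i where i: "1 \<le> i" "i \<le> n" "X \<in> orb (p i)" using SE \<open>X \<in> S\<close> by blast
    show ?thesis
    proof (rule nb_orbits[OF _ pF[OF i(2)] _ i(3)])
      show "nb (p i) \<subseteq> insert z (insert q S)" using nbP[OF i(1,2)] PS by blast
      show "g Y \<in> insert z (insert q S)" if "Y \<in> insert z (insert q S)" for Y
        using that gS z(2) gq by (metis insert_iff)
    qed
  qed
  \<comment> \<open>A path that led back to \<open>z\<close> would be attached to the rest only at
    \<open>z\<close> and thus be everything. But its rotated copies are missing from it.\<close>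
  have qz: "q \<noteq> z"
  proof
    assume e: "q = z"
    have "\<F> = insert z P"
    proof (rule no_cut_facet)
      show "P \<noteq> {}" "z \<notin> P" using pP[OF _ n] zS PS by auto
      show "nb X \<subseteq> insert z P" if X: "X \<in> P" for X
      proof -
        obtain i where "1 \<le> i" "i \<le> n" "X = p i" using X unfolding P_def by (metis atLeastAtMost_iff imageE)
        then show ?thesis using nbP[of i] e by simp
      qed
    qed (use PF z in auto)
    then have "g (p 1) \<in> insert z P" using gF pF n by simp
    moreover have "g (p 1) \<noteq> z"
    proof
      assume "g (p 1) = z"
      then have "g (g (p 1)) = g (p 1)" using z(2) by simp
      then show False using fixed_h_iff[OF pF[OF n]] pf[OF order_refl n] by simp
    qed
    ultimately obtain i where i: "1 \<le> i" "i \<le> n" "g (p 1) = p i" unfolding P_def by (metis atLeastAtMost_iff imageE insertE)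
    then have "p i \<in> orb (p 1)" unfolding orb_def by simp
    then have "i = 1" using chain_orb[OF c i(2)] n by simp
    then show False using i pf n by simp
  qed
  define R where "R = \<F> - insert z (insert q S)"
  \<comment> \<open>Otherwise \<open>3 * n + 2 = 25\<close>, which is impossible modulo
    three.\<close>
  have "R \<noteq> {}"
  proof
    assume "R = {}"
    then have "\<F> = insert z (insert q S)" unfolding R_def using SF z qF by auto
    then have "card \<F> = 3 * n + 2" using cS zS qz finite_subset[OF SF finF] by simp
    then show False using cardF by presburger
  qed
  have RS: "Y \<notin> S" if "X \<in> R" "Y \<in> nb X" for X Y
    using nbS[of Y] nb_sym[of X Y] that unfolding R_def by blast
  \<comment> \<open>If one end of the three paths had all its neighbours on them, the remaining
    facets \<open>R\<close> would be attached only at the other end.\<close>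
  have cut: False if ab: "a = z \<and> b = q \<or> a = q \<and> b = z" "nb a \<subseteq> S" for a b
  proof -
    have abF: "a \<in> \<F>" "b \<in> \<F>" "a \<noteq> b" "a \<notin> R" "b \<notin> R" using ab(1) z(1) qF qz by (auto simp only: R_def Diff_iff insert_iff)
    have "\<F> = insert b R"
    proof (rule no_cut_facet)
      show "nb X \<subseteq> insert b R" if X: "X \<in> R" for X
      proof
        fix Y assume Y: "Y \<in> nb X"
        have "X \<in> nb Y" using nb_sym[of X Y] X Y unfolding R_def by simp
        then have "Y \<noteq> a" using ab(2) X unfolding R_def by blast
        moreover have "Y \<noteq> a \<Longrightarrow> Y \<noteq> b \<Longrightarrow> Y \<noteq> z \<and> Y \<noteq> q" using ab(1) by metis
        ultimately show "Y \<in> insert b R" using RS[OF X Y] nb_F[OF Y] unfolding R_def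
          by (cases "Y = b") simp_all
      qed
      show "R \<subseteq> \<F>" by (simp add: R_def)
    qed (use \<open>R \<noteq> {}\<close> abF in simp_all)
    then show False using abF by simp
  qed
  have oz: "orb (p 1) \<subseteq> nb z" using orb_nb_fixed[OF z] y p1 by simp
  have oq: "orb (p n) \<subseteq> nb q" using orb_nb_fixed[OF qF gq sy] .
  have fin_orb: "finite (orb X)" for X unfolding orb_def by simp
  have c3: "card (orb (p i)) = 3" if "1 \<le> i" "i \<le> n" for i using card_orb pF pf that by simp
  have oS: "orb (p i) \<subseteq> S" if "1 \<le> i" "i \<le> n" for i unfolding S_def by (rule UN_upper) (use that in simp)
  have dz: "4 \<le> card (nb z)"
  proof (rule ccontr)
    assume "\<not> 4 \<le> card (nb z)"
    then have "card (orb (p 1)) = card (nb z)" using card_nb_ge[OF oz] c3[OF order_refl n] by simp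
    then have "nb z = orb (p 1)" using card_subset_eq[OF fin_nb oz] by simp
    then show False using cut[of z q] oS n by simp
  qed
  have dq: "4 \<le> card (nb q)"
  proof (rule ccontr)
    assume "\<not> 4 \<le> card (nb q)"
    then have "card (orb (p n)) = card (nb q)" using card_nb_ge[OF oq] c3[OF n order_refl] by simp
    then have "nb q = orb (p n)" using card_subset_eq[OF fin_nb oq] by simp
    then show False using cut[of q z] oS n by (simp add: insert_commute)
  qed
  have z4: "card (nb z) = 4" and q4: "card (nb q) = 4"
    using sum_excess_le[of "{z, q}"] dz dq z qF qz by auto
  have d2: "card (nb X) = 2" if "X \<in> \<F>" "X \<noteq> z" "X \<noteq> q" for X
    using sum_excess_le[of "{X, z, q}"] dz dq z qF qz that deg_ge2[OF that(1)] by auto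
  \<comment> \<open>A fixed facet with a moved neighbour is \<open>z\<close> or \<open>q\<close>. A
    second orbit of moved neighbours would raise its degree from four to at least six.\<close>
  have fixed_nb: "g Y = Y" if X: "X \<in> \<F>" "g X = X" and Y: "Y \<in> nb X" "Y \<notin> S" for X Y
  proof (rule ccontr)
    assume gY: "g Y \<noteq> Y"
    have YF: "Y \<in> \<F>" using Y nb_F by simp
    have oY: "orb Y \<subseteq> nb X" using orb_nb_fixed[OF X Y(1)] .
    have "3 \<le> card (nb X)" using deg_fixed[OF X Y(1) gY] .
    then have Xzq: "X = z \<or> X = q" using d2[OF X(1)] by fastforce
    then obtain i where i: "1 \<le> i" "i \<le> n" "orb (p i) \<subseteq> nb X" using oz oq n by blast
    have "orb Y \<inter> orb (p i) = {}"
    proof (rule ccontr)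
      assume "orb Y \<inter> orb (p i) \<noteq> {}"
      then obtain Z where "Z \<in> orb Y" "Z \<in> orb (p i)" by blast
      then have "orb Y = orb (p i)" using orb_eq[OF YF] orb_eq[OF pF[OF i(2)]] by metis
      then show False using orb_self[of Y] Y(2) oS[OF i(1,2)] by blast
    qed
    then have "card (orb Y \<union> orb (p i)) = 6" using card_orb[OF YF gY] c3[OF i(1,2)]
      by (subst card_Un_disjoint) (simp_all add: fin_orb)
    then show False using card_nb_ge[of "orb Y \<union> orb (p i)" X] oY i(3) Xzq z4 q4 by auto
  qed
  define T where "T = {X \<in> \<F>. g X \<noteq> X \<and> X \<notin> S}"
  have "T = {}"
  proof (rule ccontr)
    assume "T \<noteq> {}"
    have "T = \<F>"
    proof (rule conn)
      show "nb X \<subseteq> T" if X: "X \<in> T" for X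
      proof
        fix Y assume Y: "Y \<in> nb X"
        have XF: "X \<in> \<F>" "g X \<noteq> X" "X \<notin> S" using X unfolding T_def by auto
        have YF: "Y \<in> \<F>" "X \<in> nb Y" using nb_F[OF Y] nb_sym[OF XF(1) Y] by simp_all
        then have 1: "g Y \<noteq> Y" using fixed_nb[OF YF(1) _ YF(2)] XF by metis
        have "X \<notin> insert z (insert q S)" using XF z(2) gq by (metis insert_iff)
        then have "Y \<notin> S" using nbS[of Y] YF(2) by (metis subsetD)
        then show "Y \<in> T" using 1 YF unfolding T_def by simp
      qed
    qed (use \<open>T \<noteq> {}\<close> in \<open>auto simp: T_def\<close>)
    then show False using z unfolding T_def by blast
  qed
  then have moved: "X \<in> S" if "X \<in> \<F>" "g X \<noteq> X" for X using that unfolding T_def by blast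
  \<comment> \<open>The moved vertices of a facet. A step between fixed facets exchanges two fixed
    vertices, so \<open>W\<close> is constant along such steps.\<close>
  define W where "W = (\<lambda>X. {v \<in> X. h v \<noteq> v})"
  have W_nb: "W X = W Y" if X: "X \<in> \<F>" "g X = X" and Y: "Y \<in> nb X" "g Y = Y" for X Y
  proof -
    obtain d w where dw: "d \<in> X" "w \<notin> X" "Y = insert w (X - {d})" "w \<in> V" using step_facet[OF X(1) Y(1)] by metis
    have hX: "h v \<in> X" if "v \<in> X" for v using X(2) that unfolding g_def by blast
    have hY: "h v \<in> Y" if "v \<in> Y" for v using Y(2) that unfolding g_def by blast
    have dV: "d \<in> V" using dw facet[OF X(1)] by blast
    have "h d = d"
    proof (rule ccontr)
      assume "h d \<noteq> d"
      then have "h d \<in> Y" using hX[OF dw(1)] dw(3) by simp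
      then have "d \<in> Y" using hY[of "h d"] hY[of "h (h d)"] h3[OF dV] by simp
      then show False using dw by auto
    qed
    moreover have "h w = w"
    proof (rule ccontr)
      assume a: "h w \<noteq> w"
      have "w \<in> Y" using dw by simp
      then have "h w \<in> X" using hY[of w] a dw(3) by auto
      then have "w \<in> X" using hX[of "h w"] hX[of "h (h w)"] h3[OF dw(4)] by simp
      then show False using dw by simp
    qed
    ultimately show ?thesis unfolding W_def dw(3) by auto
  qed
  define Q where "Q = {X \<in> \<F>. g X = X \<and> W X = W z}"
  have nbQ: "nb X \<subseteq> Q" if X: "X \<in> Q" "X \<noteq> z" "X \<noteq> q" for X
  proof
    fix Y assume Y: "Y \<in> nb X"
    have XF: "X \<in> \<F>" "g X = X" "W X = W z" using X unfolding Q_def by auto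
    have "g Y = Y" using nb_fixed_deg2[OF XF(1,2) d2[OF XF(1) X(2,3)] Y] .
    then show "Y \<in> Q" using W_nb[OF XF(1,2) Y] XF nb_F[OF Y] unfolding Q_def by simp
  qed
  have zQ: "z \<in> Q" unfolding Q_def using z by simp
  \<comment> \<open>The fourth neighbour of \<open>z\<close> is fixed and belongs to
    \<open>Q\<close>. Without \<open>q\<close>, the set \<open>Q\<close> would be attached to the
    rest only at \<open>z\<close>.\<close>
  have "q \<in> Q"
  proof (rule ccontr)
    assume nq: "q \<notin> Q"
    have "\<not> nb z \<subseteq> orb (p 1)"
      using card_mono[of "orb (p 1)" "nb z"] z4 c3[OF order_refl n] by (auto simp: fin_orb)
    then obtain Y where Y: "Y \<in> nb z" "Y \<notin> orb (p 1)" by blast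
    have "g Y = Y"
    proof (rule ccontr)
      assume gY: "g Y \<noteq> Y"
      have YF: "Y \<in> \<F>" using Y nb_F by simp
      have "orb Y \<inter> orb (p 1) = {}"
      proof (rule ccontr)
        assume "orb Y \<inter> orb (p 1) \<noteq> {}"
        then obtain Z where "Z \<in> orb Y" "Z \<in> orb (p 1)" by blast
        then have "orb Y = orb (p 1)" using orb_eq[OF YF] orb_eq[OF pF[OF n]] by metis
        then show False using orb_self[of Y] Y(2) by blast
      qed
      then have "card (orb Y \<union> orb (p 1)) = 6" using card_orb[OF YF gY] c3[OF order_refl n]
        by (subst card_Un_disjoint) (simp_all add: fin_orb)
      then show False using card_nb_ge[of "orb Y \<union> orb (p 1)" z] orb_nb_fixed[OF z Y(1)] oz z4 by simp
    qed
    then have YQ: "Y \<in> Q" using W_nb[OF z Y(1)] nb_F[OF Y(1)] unfolding Q_def by simp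
    have "Y \<noteq> z" using Y nb_irrefl z by blast
    have "\<F> = insert z (Q - {z})"
    proof (rule no_cut_facet)
      show "nb X \<subseteq> insert z (Q - {z})" if X: "X \<in> Q - {z}" for X
      proof -
        have "X \<noteq> q" using nq X by blast
        then show ?thesis using nbQ[of X] X by blast
      qed
    qed (use YQ \<open>Y \<noteq> z\<close> z in \<open>auto simp: Q_def\<close>)
    then show False using qF qz nq by blast
  qed
  define T2 where "T2 = {X \<in> \<F>. g X = X} - Q"
  have "T2 = {}"
  proof (rule ccontr)
    assume "T2 \<noteq> {}"
    have "T2 = \<F>"
    proof (rule conn)
      show "nb X \<subseteq> T2" if X: "X \<in> T2" for X
      proof
        fix Y assume Y: "Y \<in> nb X"
        have XF: "X \<in> \<F>" "g X = X" "X \<notin> Q" using X unfolding T2_def by auto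
        then have "X \<noteq> z" "X \<noteq> q" using zQ \<open>q \<in> Q\<close> by metis+
        then have gY: "g Y = Y" using nb_fixed_deg2[OF XF(1,2) d2[OF XF(1)] Y] by simp
        have "Y \<notin> Q" using W_nb[OF XF(1,2) Y gY] XF unfolding Q_def by simp
        then show "Y \<in> T2" using gY nb_F[OF Y] unfolding T2_def by simp
      qed
    qed (use \<open>T2 \<noteq> {}\<close> in \<open>auto simp: T2_def\<close>)
    then show False using z zQ unfolding T2_def by blast
  qed
  then have fixedQ: "X \<in> Q" if "X \<in> \<F>" "g X = X" for X using that unfolding T2_def by blast
  have S_or: "X \<in> S \<or> X \<in> Q" if "X \<in> \<F>" for X using moved fixedQ that by blast
  have gstar: "v \<in> X \<Longrightarrow> h v \<in> g X" for v X unfolding g_def by simp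
  \<comment> \<open>A moved vertex outside \<open>z\<close> is in no fixed facet, so its star lies
    on a single path. A facet that contains both \<open>v\<close> and \<open>h v\<close> has a
    rotated copy that also contains \<open>v\<close>, and both would be on that path.\<close>
  have aux: False if v: "v \<in> V" "v \<notin> z" "h v \<notin> z" "h (h v) \<notin> z" "h v \<noteq> v" and i: "1 \<le> i" "i \<le> n" "v \<in> p i" for v i
  proof -
    have nQ: "v \<notin> X" if X: "X \<in> Q" for X
    proof
      assume "v \<in> X"
      then have "v \<in> W X" using v unfolding W_def by simp
      then have "v \<in> W z" using X unfolding Q_def by simp
      then show False using v unfolding W_def by simp
    qed
    have "{X \<in> P. v \<in> X} = {X \<in> \<F>. v \<in> X}"
    proof (rule star_closed(1)[OF v(1)])
      show "Y \<in> {X \<in> P. v \<in> X}" if X: "X \<in> {X \<in> P. v \<in> X}" and Y: "Y \<in> nb X" "v \<in> Y" for X Y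
      proof -
        obtain m where "1 \<le> m" "m \<le> n" "X = p m" using X unfolding P_def by (metis (no_types, lifting) atLeastAtMost_iff imageE mem_Collect_eq)
        then have "Y \<in> insert z (insert q P)" using nbP[of m] Y by blast
        then show ?thesis using nQ[OF zQ] nQ[OF \<open>q \<in> Q\<close>] Y by blast
      qed
    qed (use PF pP[OF i(1,2)] i in auto)
    then have star: "X \<in> P" if "X \<in> \<F>" "v \<in> X" for X using that by blast
    obtain X where X: "X \<in> \<F>" "v \<in> X" "h v \<in> X" using meet[of v "h v"] v hV by blast
    have "X \<in> P" using star X by blast
    then obtain m where m: "1 \<le> m" "m \<le> n" "X = p m" unfolding P_def by (metis atLeastAtMost_iff imageE)
    have "h (h (h v)) \<in> g (g X)" using X gstar by simp
    then have "g (g X) \<in> P" using star[of "g (g X)"] h3 v X gF by simp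
    then obtain k where k: "1 \<le> k" "k \<le> n" "g (g X) = p k" unfolding P_def by (metis atLeastAtMost_iff imageE)
    then have "p k \<in> orb (p m)" using m unfolding orb_def by simp
    then have "k = m" using chain_orb[OF c k(2) m(1,2)] by simp
    then show False using k m fixed_hh_iff[OF pF[OF m(2)]] pf[OF m(1,2)] by simp
  qed
  have zinv: "v \<in> z \<Longrightarrow> h v \<in> z" for v using z(2) unfolding g_def by blast
  have zW: "v \<in> z" if v: "v \<in> V" "h v \<noteq> v" for v
  proof (rule ccontr)
    assume vz: "v \<notin> z"
    have hv: "h v \<in> V" "h (h v) \<in> V" "h (h (h v)) = v" using v hV h3 by auto
    have nz: "h v \<notin> z" "h (h v) \<notin> z" using vz zinv[of "h v"] zinv[of "h (h v)"] hv by auto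
    have ne: "h (h v) \<noteq> h v" "h (h (h v)) \<noteq> h (h v)" using v hv by metis+
    obtain X where X: "X \<in> \<F>" "v \<in> X" using star_ex v by blast
    have "X \<notin> Q"
    proof
      assume a: "X \<in> Q"
      have "v \<in> W X" using v X unfolding W_def by simp
      then have "v \<in> W z" using a unfolding Q_def by simp
      then show False using vz unfolding W_def by simp
    qed
    then have "X \<in> S" using S_or X by blast
    then obtain i where i: "1 \<le> i" "i \<le> n" "X \<in> orb (p i)" using SE by blast
    consider "X = p i" | "X = g (p i)" | "X = g (g (p i))" using i(3) unfolding orb_def by blast
    then show False
    proof cases
      case 1
      then show False using aux[of v i] v vz nz i X by simp
    next
      case 2
      have "h (h v) \<in> g (g X)" using X gstar by simp
      then have "h (h v) \<in> p i" using 2 g3[OF pF[OF i(2)]] by simp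
      then show False using aux[of "h (h v)" i] hv ne vz nz i by simp
    next
      case 3
      have "h v \<in> g X" using X gstar by simp
      then have "h v \<in> p i" using 3 g3[OF pF[OF i(2)]] by simp
      then show False using aux[of "h v" i] hv ne vz nz i by simp
    qed
  qed
  obtain v where v: "v \<in> V" "h v \<noteq> v" using nontriv by blast
  have "{X \<in> \<F>. g X = X} \<subseteq> {X \<in> \<F>. v \<in> X}"
  proof
    fix X assume X: "X \<in> {X \<in> \<F>. g X = X}"
    have "v \<in> W z" using zW[OF v] v unfolding W_def by simp
    then have "v \<in> W X" using fixedQ X unfolding Q_def by simp
    then show "X \<in> {X \<in> \<F>. v \<in> X}" using X unfolding W_def by simp
  qed
  \<comment> \<open>All fixed facets contain \<open>v\<close>, so at most ten facets are fixed and
    the three paths have at least 15 facets.\<close>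
  then have "card {X \<in> \<F>. g X = X} \<le> 10" using card_mono[of "{X \<in> \<F>. v \<in> X}"] star_card[OF v(1)] finF by simp
  moreover have "\<F> = S \<union> {X \<in> \<F>. g X = X}" using moved SF by blast
  then have "25 \<le> card S + card {X \<in> \<F>. g X = X}" using card_Un_le[of S "{X \<in> \<F>. g X = X}"] cardF by simp
  ultimately have n5: "5 \<le> n" using cS by simp
  obtain d w where dw: "d \<in> z" "w \<notin> z" "p 1 = insert w (z - {d})" "w \<in> V" using step_facet[OF z(1) y(1)] p1 by metis
  have hw: "h w = w" using zW dw by blast
  \<comment> \<open>If \<open>w\<close> were dropped on the path, its star would be an initial
    section of this path. But \<open>w\<close> is fixed, so its star also contains
    \<open>g (p 1)\<close>. Hence \<open>w\<close> stays, and its star contains all three paths,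
    which are too many facets.\<close>
  have wp: "w \<in> p m" if "1 \<le> m" "m \<le> n" for m
    using that
  proof (induction m rule: less_induct)
    case (less m)
    show ?case
    proof (cases "m = 1")
      case False
      then have m: "1 < m" "m \<le> n" using less by auto
      show ?thesis
      proof (rule ccontr)
        assume wm: "w \<notin> p m"
        have "p ` {1..<m} = {X \<in> \<F>. w \<in> X}"
        proof (rule star_closed(1)[OF dw(4)])
          show "p ` {1..<m} \<subseteq> {X \<in> \<F>. w \<in> X}" using less.IH pF m by (auto simp only: image_subset_iff atLeastLessThan_iff mem_Collect_eq)
          show "p ` {1..<m} \<noteq> {}" using m by simp
          show "Y \<in> p ` {1..<m}" if X: "X \<in> p ` {1..<m}" and Y: "Y \<in> nb X" "w \<in> Y" for X Y
          proof -
            obtain i where i: "1 \<le> i" "i < m" "X = p i" using X by (metis atLeastLessThan_iff imageE)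
            then have "Y = p (i - 1) \<or> Y = p (Suc i)" using nbi[of i] Y m by simp
            moreover have "i = 1 \<longrightarrow> Y \<noteq> p (i - 1)" using p0 dw Y by auto
            moreover have "Suc i = m \<longrightarrow> Y \<noteq> p (Suc i)" using wm Y by auto
            ultimately consider "Y = p (i - 1)" "i \<noteq> 1" | "Y = p (Suc i)" "Suc i \<noteq> m" by metis
            then show ?thesis
            proof cases
              case 1
              then have "i - 1 \<in> {1..<m}" using i 1 by auto
              then show ?thesis using 1 by simp
            next
              case 2
              then have "Suc i \<in> {1..<m}" using i by simp
              then show ?thesis using 2 by simp
            qed
          qed
        qed
        moreover have "g (p 1) \<in> {X \<in> \<F>. w \<in> X}"
        proof -
          have "w \<in> p 1" using dw by simp
          then have "w \<in> g (p 1)" using gstar hw by metis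
          then show ?thesis using gF pF[OF n] by simp
        qed
        ultimately obtain i where i: "1 \<le> i" "i < m" "g (p 1) = p i" by (metis (no_types, lifting) atLeastLessThan_iff imageE)
        then have "p i \<in> orb (p 1)" unfolding orb_def by simp
        then have "i = 1" using chain_orb[OF c _ order_refl n, of i] i m by simp
        then show False using i pf n by simp
      qed
    qed (use dw in simp)
  qed
  have "S \<subseteq> {X \<in> \<F>. w \<in> X}"
  proof
    fix X assume X: "X \<in> S"
    then obtain i where i: "1 \<le> i" "i \<le> n" "X \<in> orb (p i)" using SE by blast
    have "w \<in> p i" using wp i by simp
    then have "w \<in> g (p i)" "w \<in> g (g (p i))" using gstar hw by metis+
    then have "w \<in> X" using i \<open>w \<in> p i\<close> unfolding orb_def by blast
    then show "X \<in> {X \<in> \<F>. w \<in> X}" using SF X by blast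
  qed
  then have "card S \<le> 10" using card_mono[of "{X \<in> \<F>. w \<in> X}" S] star_card[OF dw(4)] finF by simp
  then show False using cS n5 by simp
qed

end
end

section \<open>Spoke and rim\<close>

text \<open>\<open>p 0, \<dots>, p j\<close> is a spoke, and \<open>p j, \<dots>, p 9\<close> is the section of the rim from the branch facet
  \<open>p j\<close> to its rotated copy.\<close>

locale lollipop = auto_system +
  fixes p :: "nat \<Rightarrow> 'a set" and j :: nat
  assumes j: "1 \<le> j" "j \<le> 8" and p0: "p 0 \<in> \<F>" "g (p 0) = p 0" and p9: "p 9 = g (p j)"
    and chain: "chain (p 0) (p 1) p 8" and close: "p 9 \<in> nb (p 8)"
    and nbp: "1 \<le> i \<Longrightarrow> i \<le> 8 \<Longrightarrow> i \<noteq> j \<Longrightarrow> nb (p i) = {p (i - 1), p (Suc i)}"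
    and nb0: "nb (p 0) = orb (p 1)" and all: "\<F> = insert (p 0) (\<Union>i\<in>{1..8}. orb (p i))"

context auto_system
begin

text \<open>A chain may close at \<open>g (p j)\<close> or at \<open>g (g (p j))\<close>. Passing
  from \<open>h\<close> to its square, which has the same orbits, turns the second case into the
  first.\<close>

lemma auto_system_square: "auto_system V \<F> (h \<circ> h)"
proof
  show "(h \<circ> h) v \<in> V" if "v \<in> V" for v using hV that by simp
  show "(h \<circ> h) ((h \<circ> h) ((h \<circ> h) v)) = v" if "v \<in> V" for v using h3 hV that by simp
  show "(h \<circ> h) ` X \<in> \<F>" if "X \<in> \<F>" for X using hF[OF hF[OF that]] by (simp add: image_comp)
  obtain v where v: "v \<in> V" "h v \<noteq> v" using nontriv by blast
  then have "h (h v) \<noteq> v" using h3 by metis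
  then show "\<exists>v\<in>V. (h \<circ> h) v \<noteq> v" using v by auto
qed

lemma ex_lollipop: "\<exists>f p j. lollipop V \<F> f p j"
proof -
  obtain z y where z: "z \<in> \<F>" "g z = z" and y: "y \<in> nb z" "g y \<noteq> y" by (rule ex_boundary_facet)
  obtain x where x: "x \<in> \<F>" "g x \<noteq> x" "card (nb x) \<noteq> 2" using moved_facets_not_all_deg_2[OF z y] by blast
  then have "3 \<le> card (nb x)" using deg_ge2[of x] by linarith
  then obtain p j where c: "chain z y p 8" and j: "1 \<le> j" "j \<le> 8"
    and q: "g (p j) \<in> nb (p 8) \<or> g (g (p j)) \<in> nb (p 8)"
    and nbp: "\<forall>i\<in>{1..7}. i \<noteq> j \<longrightarrow> nb (p i) = {p (i - 1), p (Suc i)}"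
    and nb8: "j \<noteq> 8 \<longrightarrow> nb (p 8) = {p 7, g (p j)} \<or> nb (p 8) = {p 7, g (g (p j))}"
    and nbz: "nb z = orb (p 1)" and al: "\<F> = insert z (\<Union>i\<in>{1..8}. orb (p i))"
    using lollipop_structure[OF z y x(1,2)] by metis
  have pF: "p i \<in> \<F>" if "i \<le> 8" for i using chain_F[OF z y c that] .
  have z0: "z = p 0" and y1: "y = p 1" using c unfolding chain_def by simp_all
  have split: "g (p j) \<in> nb (p 8) \<and> (j \<noteq> 8 \<longrightarrow> nb (p 8) = {p 7, g (p j)}) \<or>
      g (g (p j)) \<in> nb (p 8) \<and> (j \<noteq> 8 \<longrightarrow> nb (p 8) = {p 7, g (g (p j))})"
    using q nb8 by (cases "j = 8") auto
  have nb': "nb (p i) = {p (i - 1), if i = 8 then r else p (Suc i)}"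
    if "j \<noteq> 8 \<longrightarrow> nb (p 8) = {p 7, r}" "1 \<le> i" "i \<le> 8" "i \<noteq> j" for r i
    using nbp[rule_format, of i] that by (cases "i = 8") auto
  show ?thesis
  proof (cases "g (p j) \<in> nb (p 8) \<and> (j \<noteq> 8 \<longrightarrow> nb (p 8) = {p 7, g (p j)})")
    case True
    define p' where "p' = p(9 := g (p j))"
    have p': "p' i = p i" if "i \<le> 8" for i unfolding p'_def using that by simp
    have "lollipop V \<F> h p' j"
    proof
      show "1 \<le> j" "j \<le> 8" "p' 0 \<in> \<F>" "g (p' 0) = p' 0" "p' 9 = g (p' j)" "p' 9 \<in> nb (p' 8)" "nb (p' 0) = orb (p' 1)"
        using j z z0 True nbz unfolding p'_def by simp_all
      show "chain (p' 0) (p' 1) p' 8" using c unfolding chain_def by (simp add: p' inj_on_def)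
      show "\<F> = insert (p' 0) (\<Union>i\<in>{1..8}. orb (p' i))" using al by (simp add: p' z0)
      show "nb (p' i) = {p' (i - 1), p' (Suc i)}" if "1 \<le> i" "i \<le> 8" "i \<noteq> j" for i
      proof -
        have "i - 1 \<noteq> 9" using that by simp
        then show ?thesis using nb'[OF conjunct2[OF True] that] that unfolding p'_def by simp
      qed
    qed
    then show ?thesis by blast
  next
    case False
    then have t: "g (g (p j)) \<in> nb (p 8)" "j \<noteq> 8 \<longrightarrow> nb (p 8) = {p 7, g (g (p j))}" using split by blast+
    interpret S: auto_system V \<F> "h \<circ> h" by (rule auto_system_square)
    have Sg: "S.g X = g (g X)" for X unfolding S.g_def g_def by (simp add: image_comp)
    have So: "S.orb X = orb X" if "X \<in> \<F>" for X
      unfolding S.orb_def orb_def Sg using g3[OF gF[OF that]] by (simp add: insert_commute)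
    define p' where "p' = p(9 := g (g (p j)))"
    have p': "p' i = p i" if "i \<le> 8" for i unfolding p'_def using that by simp
    have "lollipop V \<F> (h \<circ> h) p' j"
    proof
      show "1 \<le> j" "j \<le> 8" "p' 0 \<in> \<F>" "S.g (p' 0) = p' 0" "p' 9 = S.g (p' j)" "p' 9 \<in> nb (p' 8)" "nb (p' 0) = S.orb (p' 1)"
        using j z z0 t nbz unfolding p'_def Sg by (simp_all add: So pF)
      have "\<forall>i\<in>{1..8}. S.g (p i) \<noteq> p i" using c fixed_hh_iff[OF pF] unfolding chain_def Sg by simp
      then show "S.chain (p' 0) (p' 1) p' 8" using c unfolding chain_def S.chain_def
        by (simp add: p' inj_on_def So pF)
      show "\<F> = insert (p' 0) (\<Union>i\<in>{1..8}. S.orb (p' i))"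
      proof -
        have "(\<Union>i\<in>{1..8}. S.orb (p' i)) = (\<Union>i\<in>{1..8}. orb (p i))" by (rule SUP_cong) (simp_all add: p' So pF)
        then show ?thesis using al by (simp add: p' z0)
      qed
      show "nb (p' i) = {p' (i - 1), p' (Suc i)}" if "1 \<le> i" "i \<le> 8" "i \<noteq> j" for i
      proof -
        have "i - 1 \<noteq> 9" using that by simp
        then show ?thesis using nb'[OF t(2) that] that unfolding p'_def by simp
      qed
    qed
    then show ?thesis by blast
  qed
qed

end

section \<open>How long a vertex stays on the spoke and on the rim\<close>

context lollipop
begin

lemma y: "p 1 \<in> nb (p 0)" "g (p 1) \<noteq> p 1" using chain unfolding chain_def by simp_all

lemma pF: "i \<le> 8 \<Longrightarrow> p i \<in> \<F>" by (rule chain_F[OF p0 y chain])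

lemma pf: "1 \<le> i \<Longrightarrow> i \<le> 8 \<Longrightarrow> g (p i) \<noteq> p i" using chain unfolding chain_def by simp

lemma step: "i \<le> 8 \<Longrightarrow> p (Suc i) \<in> nb (p i)"
  using chain_step[OF p0 y chain, of i] close by (cases "i = 8") simp_all

lemma pF9: "i \<le> 9 \<Longrightarrow> p i \<in> \<F>" using pF nb_F[OF close] by (cases "i = 9") simp_all

text \<open>Away from the branch facet, the neighbours of a facet are its predecessor and its
  successor. Such a run would be the whole star of \<open>v\<close>, with at most 8 facets instead
  of 10.\<close>

lemma segment:
  assumes ab: "1 \<le> a" "a \<le> b" "b \<le> 8" and v: "\<And>i. a \<le> i \<Longrightarrow> i \<le> b \<Longrightarrow> i \<noteq> j \<and> v \<in> p i"
    and ends: "v \<notin> p (a - 1)" "v \<notin> p (Suc b)"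
  shows False
proof -
  have vV: "v \<in> V" using facet[OF pF[OF ab(3)]] v[OF ab(2) order_refl] by blast
  have "card (p ` {a..b}) = 10"
  proof (rule star_closed(2)[OF vV])
    show "p ` {a..b} \<subseteq> {X \<in> \<F>. v \<in> X}" using pF v ab by (auto simp only: image_subset_iff atLeastAtMost_iff mem_Collect_eq)
    show "p ` {a..b} \<noteq> {}" using ab by simp
    show "Y \<in> p ` {a..b}" if X: "X \<in> p ` {a..b}" and Y: "Y \<in> nb X" "v \<in> Y" for X Y
    proof -
      obtain i where i: "a \<le> i" "i \<le> b" "X = p i" using X by (metis atLeastAtMost_iff imageE)
      then have "Y = p (i - 1) \<or> Y = p (Suc i)" using nbp[of i] v[of i] Y ab by simp
      moreover have "i = a \<longrightarrow> Y \<noteq> p (i - 1)" "i = b \<longrightarrow> Y \<noteq> p (Suc i)" using ends Y by metis+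
      ultimately consider "Y = p (i - 1)" "i \<noteq> a" | "Y = p (Suc i)" "i \<noteq> b" by metis
      then show ?thesis
      proof cases
        case 1
        then have "i - 1 \<in> {a..b}" using i by auto
        then show ?thesis using 1 by simp
      next
        case 2
        then have "Suc i \<in> {a..b}" using i by simp
        then show ?thesis using 2 by simp
      qed
    qed
  qed
  moreover have "card (p ` {a..b}) \<le> card {a..b}" by (rule card_image_le) simp
  ultimately show False using ab by simp
qed

text \<open>After the last earlier facet without \<open>v\<close>, the facets up to the drop would
  form a run that avoids the branch facet, which \<open>segment\<close> forbids.\<close>

lemma drop:
  assumes k: "lo \<le> k" "k \<le> 8" "\<And>i. lo < i \<Longrightarrow> i \<le> k \<Longrightarrow> i \<noteq> j"
    and v: "v \<in> p k" "v \<notin> p (Suc k)" and i: "lo \<le> i" "i \<le> k"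
  shows "v \<in> p i"
proof (rule ccontr)
  assume n: "v \<notin> p i"
  define M where "M = {m. i \<le> m \<and> m \<le> k \<and> v \<notin> p m}"
  have M: "finite M" "M \<noteq> {}" unfolding M_def using n i by auto
  define m where "m = Max M"
  have m: "i \<le> m" "m \<le> k" "v \<notin> p m" using Max_in[OF M] unfolding m_def M_def by auto
  then have mk: "m < k" using v by (metis le_neq_implies_less)
  have up: "v \<in> p l" if "Suc m \<le> l" "l \<le> k" for l
  proof (rule ccontr)
    assume "v \<notin> p l"
    then have "l \<in> M" unfolding M_def using that m by simp
    then have "l \<le> m" unfolding m_def using M by simp
    then show False using that by simp
  qed
  show False
    by (rule segment[of "Suc m" k v]) (use k m mk up v i in auto)
qed

lemma drop_spoke: "k < j \<Longrightarrow> v \<in> p k \<Longrightarrow> v \<notin> p (Suc k) \<Longrightarrow> i \<le> k \<Longrightarrow> v \<in> p i"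
  by (rule drop[of 0 k]) (use j in auto)

lemma drop_rim: "j \<le> k \<Longrightarrow> k \<le> 8 \<Longrightarrow> v \<in> p k \<Longrightarrow> v \<notin> p (Suc k) \<Longrightarrow> j \<le> i \<Longrightarrow> i \<le> k \<Longrightarrow> v \<in> p i"
  by (rule drop[of j k]) auto

text \<open>A vertex that an earlier rim facet lacks cannot be dropped later on the rim.\<close>

lemma add_rim:
  assumes "j \<le> k" "v \<notin> p k" "v \<in> p (Suc k)" "Suc k \<le> i" "i \<le> 9" shows "v \<in> p i"
  using assms(4,5)
proof (induction i rule: dec_induct)
  case (step n)
  then show ?case using drop_rim[of n v k] assms(1,2) by auto
qed (rule assms(3))

text \<open>The dropped vertex has been in all facets so far, so each step takes exactly one vertex
  away from their intersection.\<close>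

lemma card_common:
  assumes dr: "\<And>k v i. lo \<le> k \<Longrightarrow> k < hi \<Longrightarrow> v \<in> p k \<Longrightarrow> v \<notin> p (Suc k) \<Longrightarrow> lo \<le> i \<Longrightarrow> i \<le> k \<Longrightarrow> v \<in> p i"
    and "lo + m \<le> hi" "hi \<le> 9"
  shows "card (\<Inter>i\<in>{lo..lo + m}. p i) + m = 6"
  using assms(2)
proof (induction m)
  case 0
  then show ?case using facet[OF pF9[of lo]] assms(3) by simp
next
  case (Suc m)
  define k where "k = lo + m"
  have k: "k \<le> 8" "k < hi" using Suc assms(3) unfolding k_def by auto
  obtain d w where dw: "d \<in> p k" "w \<notin> p k" "p (Suc k) = insert w (p k - {d})"
    using step_facet[OF pF[OF k(1)] step[OF k(1)]] by metis
  define I where "I = (\<Inter>i\<in>{lo..k}. p i)"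
  have "{lo..Suc k} = insert (Suc k) {lo..k}" unfolding k_def by auto
  then have "(\<Inter>i\<in>{lo..Suc k}. p i) = p (Suc k) \<inter> I" unfolding I_def by simp
  also have "\<dots> = I - {d}"
  proof -
    have "I \<subseteq> p k" unfolding I_def k_def by auto
    then show ?thesis unfolding dw(3) using dw(1,2) by blast
  qed
  finally have e: "(\<Inter>i\<in>{lo..lo + Suc m}. p i) = I - {d}" unfolding k_def by simp
  have "d \<notin> p (Suc k)" using dw by auto
  then have dI: "d \<in> I" unfolding I_def using dr[of k d] k dw(1) by (auto simp: k_def)
  have "finite I" unfolding I_def using fin_facet[OF pF[OF k(1)]] by (rule finite_subset[rotated]) (auto simp: k_def)
  then have "card I = Suc (card (I - {d}))" using dI by (rule card.remove)
  then show ?case using Suc unfolding e I_def k_def by simp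
qed

text \<open>After \<open>m\<close> steps six minus \<open>m\<close> common vertices remain. So
  neither the spoke with \<open>j\<close> steps nor the rim section with \<open>9 - j\<close> steps
  has more than six.\<close>

lemma j_bounds: "3 \<le> j" "j \<le> 6"
proof -
  have "card (\<Inter>i\<in>{j..j + (9 - j)}. p i) + (9 - j) = 6"
  proof (rule card_common[of j 9])
    show "v \<in> p i" if "j \<le> k" "k < 9" "v \<in> p k" "v \<notin> p (Suc k)" "j \<le> i" "i \<le> k" for k v i
      using drop_rim[of k v i] that by simp
  qed (use j in simp_all)
  then show "3 \<le> j" by linarith
  have "card (\<Inter>i\<in>{0..0 + j}. p i) + j = 6"
  proof (rule card_common[of 0 j])
    show "v \<in> p i" if "0 \<le> k" "k < j" "v \<in> p k" "v \<notin> p (Suc k)" "0 \<le> i" "i \<le> k" for k v i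
      using drop_spoke[of k v i] that by simp
  qed (use j in simp_all)
  then show "j \<le> 6" by linarith
qed

section \<open>Stars of fixed vertices\<close>

lemma all_cases: "X \<in> \<F> \<Longrightarrow> X = p 0 \<or> (\<exists>i. 1 \<le> i \<and> i \<le> 8 \<and> X \<in> orb (p i))"
proof -
  assume "X \<in> \<F>"
  then have "X \<in> insert (p 0) (\<Union>i\<in>{1..8}. orb (p i))" using all by simp
  then show ?thesis unfolding insert_iff UN_iff Bex_def atLeastAtMost_iff by (simp only: conj_assoc)
qed

lemma chain_le: "1 \<le> m \<Longrightarrow> m \<le> 8 \<Longrightarrow> chain (p 0) (p 1) p m"
  using chain unfolding chain_def by (auto elim: inj_on_subset)

lemma card_spokes:
  assumes m: "m \<le> 8" shows "card (insert (p 0) (\<Union>i\<in>{1..m}. orb (p i))) = 1 + 3 * m"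
proof (cases "m = 0")
  case False
  then have "card (\<Union>i\<in>{1..m}. orb (p i)) = 3 * m" using card_chain_orbits[OF p0 y chain_le] m by simp
  moreover have "p 0 \<notin> (\<Union>i\<in>{1..m}. orb (p i))"
  proof
    assume "p 0 \<in> (\<Union>i\<in>{1..m}. orb (p i))"
    then obtain i where i: "1 \<le> i" "i \<le> m" "p 0 \<in> orb (p i)" unfolding UN_iff Bex_def atLeastAtMost_iff by blast
    then show False using chain_orb[OF p0 y chain, of 0 i] m by simp
  qed
  moreover have "finite (\<Union>i\<in>{1..m}. orb (p i))" unfolding orb_def by simp
  ultimately show ?thesis by simp
qed simp

lemma gstar: "v \<in> X \<Longrightarrow> h v \<in> g X" unfolding g_def by simp

lemma orb_star_fixed: assumes "X \<in> \<F>" "Y \<in> orb X" "h v = v" "v \<in> V" shows "v \<in> Y \<longleftrightarrow> v \<in> X"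
proof -
  have a: "v \<in> Z \<Longrightarrow> v \<in> g Z" for Z using gstar[of v Z] assms(3) by simp
  have "v \<in> g X \<Longrightarrow> v \<in> X" "v \<in> g (g X) \<Longrightarrow> v \<in> X" using a[of "g X"] a[of "g (g X)"] g3[OF assms(1)] by auto
  then show ?thesis using assms(2) a[of X] a[of "g X"] unfolding orb_def by blast
qed

text \<open>The star of a fixed vertex has \<open>10 = 1 + 3 * 3\<close> facets, namely \<open>p 0\<close> and the orbits of
  \<open>p 1, p 2, p 3\<close>.\<close>

lemma fixed_vertex_star:
  assumes v: "v \<in> V" "h v = v" shows "v \<in> p 0" "v \<in> p 3" "v \<notin> p 4"
proof -
  define T where "T = {X \<in> \<F>. v \<in> X}"
  have T10: "card T = 10" unfolding T_def by (rule star_card[OF v(1)])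
  have gT: "g X \<in> T" if "X \<in> T" for X using that gF gstar[of v X] v(2) unfolding T_def by simp
  show v0: "v \<in> p 0"
  proof (rule ccontr)
    assume n: "v \<notin> p 0"
    \<comment> \<open>Without \<open>p 0\<close>, the star would consist of free orbits
      only.\<close>
    have "3 dvd card T"
    proof (rule three_dvd_card_if_free[of T g])
      show "finite T" using finF unfolding T_def by simp
      show "g (g (g X)) = X" if "X \<in> T" for X using g3 that unfolding T_def by simp
      show "g X \<noteq> X" if X: "X \<in> T" for X
      proof -
        have XF: "X \<in> \<F>" "v \<in> X" using X unfolding T_def by simp_all
        then have "X \<noteq> p 0" using n by metis
        then obtain i where i: "1 \<le> i" "i \<le> 8" "X \<in> orb (p i)" using all_cases[OF XF(1)] by metis
        then show ?thesis using orb_fixed_iff[OF pF[OF i(2)] i(3)] pf[OF i(1,2)] by simp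
      qed
    qed (rule gT)
    then show False using T10 by simp
  qed
  \<comment> \<open>A star that ended at \<open>p a\<close> would consist of \<open>p 0\<close> and
    \<open>a\<close> orbits, which are \<open>1 + 3 * a\<close> facets and fewer than ten.\<close>
  have closed: "v \<in> p (Suc a)" if a: "a < 3" and va: "\<And>i. i \<le> a \<Longrightarrow> v \<in> p i" for a
  proof (rule ccontr)
    assume n: "v \<notin> p (Suc a)"
    define A where "A = insert (p 0) (\<Union>i\<in>{1..a}. orb (p i))"
    have inA: "Y \<in> A" if "1 \<le> i" "i \<le> a" "Y \<in> orb (p i)" for i Y unfolding A_def using that by auto
    have "card A = 10"
    proof (rule star_closed(2)[OF v(1)])
      show "A \<subseteq> {X \<in> \<F>. v \<in> X}"
      proof
        fix X assume "X \<in> A"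
        then have "X = p 0 \<or> (\<exists>i. 1 \<le> i \<and> i \<le> a \<and> X \<in> orb (p i))"
          unfolding A_def insert_iff UN_iff Bex_def atLeastAtMost_iff by (simp only: conj_assoc)
        then show "X \<in> {X \<in> \<F>. v \<in> X}"
        proof
          assume "X = p 0" then show ?thesis using v0 p0 by simp
        next
          assume "\<exists>i. 1 \<le> i \<and> i \<le> a \<and> X \<in> orb (p i)"
          then obtain i where i: "1 \<le> i" "i \<le> a" "X \<in> orb (p i)" by blast
          have F: "p i \<in> \<F>" using pF i a by simp
          then have "X \<in> \<F>" using orb_F i(3) by blast
          then show ?thesis using orb_star_fixed[OF F i(3) v(2,1)] va[OF i(2)] by simp
        qed
      qed
      show "A \<noteq> {}" unfolding A_def by simp
      show "Y \<in> A" if X: "X \<in> A" and Y: "Y \<in> nb X" "v \<in> Y" for X Y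
      proof -
        have "X = p 0 \<or> (\<exists>i. 1 \<le> i \<and> i \<le> a \<and> X \<in> orb (p i))"
          using X unfolding A_def insert_iff UN_iff Bex_def atLeastAtMost_iff by (simp only: conj_assoc)
        then show ?thesis
        proof
          assume "X = p 0"
          then have Y1: "Y \<in> orb (p 1)" using Y nb0 by simp
          then have "v \<in> p 1" using orb_star_fixed[OF pF Y1 v(2,1)] Y by simp
          then have "1 \<le> a" using n by (cases a) simp_all
          then show ?thesis using inA[OF order_refl _ Y1] by simp
        next
          assume "\<exists>i. 1 \<le> i \<and> i \<le> a \<and> X \<in> orb (p i)"
          then obtain i where i: "1 \<le> i" "i \<le> a" "X \<in> orb (p i)" by blast
          have i8: "i \<le> 8" "Suc i \<le> 8" "i - 1 \<le> 8" "i \<noteq> j" using i a j_bounds by simp_all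
          have nbi: "nb (p i) = {p (i - 1), p (Suc i)}" using nbp i i8 by simp
          have "nb X \<subseteq> orb (p (i - 1)) \<union> orb (p (Suc i))"
          proof (rule nb_orbits[OF p0 y _ pF[OF i8(1)] _ i(3)])
            show "nb (p i) \<subseteq> orb (p (i - 1)) \<union> orb (p (Suc i))" using nbi orb_self by simp
            show "g Z \<in> orb (p (i - 1)) \<union> orb (p (Suc i))" if "Z \<in> orb (p (i - 1)) \<union> orb (p (Suc i))" for Z
              using that orb_g[OF p0 y pF[OF i8(2)]] orb_g[OF p0 y pF[OF i8(3)]] by blast
          qed
          then consider "Y \<in> orb (p (i - 1))" | "Y \<in> orb (p (Suc i))" using Y by blast
          then show ?thesis
          proof cases
            case 1
            show ?thesis
            proof (cases "i = 1")
              case True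
              then have "Y = p 0" using 1 p0(2) unfolding orb_def by simp
              then show ?thesis unfolding A_def by simp
            next
              case False
              then show ?thesis using inA[OF _ _ 1] i by simp
            qed
          next
            case 2
            then have "v \<in> p (Suc i)" using orb_star_fixed[OF pF[OF i8(2)] 2 v(2,1)] Y by simp
            then have "Suc i \<le> a" using n i by (metis le_neq_implies_less Suc_leI)
            then show ?thesis using inA[OF _ _ 2] by simp
          qed
        qed
      qed
    qed
    then show False using card_spokes[of a] a unfolding A_def by simp
  qed
  have v1: "v \<in> p 1" using closed[of 0] v0 by simp
  have "v \<in> p (Suc 1)"
  proof (rule closed)
    fix i :: nat assume "i \<le> 1"
    then have "i = 0 \<or> i = 1" by auto
    then show "v \<in> p i" using v0 v1 by metis
  qed simp
  then have v2: "v \<in> p 2" by (simp add: numeral_2_eq_2)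
  have "v \<in> p (Suc 2)"
  proof (rule closed)
    fix i :: nat assume "i \<le> 2"
    then have "i = 0 \<or> i = 1 \<or> i = 2" by auto
    then show "v \<in> p i" using v0 v1 v2 by metis
  qed simp
  then show v3: "v \<in> p 3" by (simp add: numeral_3_eq_3)
  show "v \<notin> p 4"
  proof
    assume v4: "v \<in> p 4"
    have "insert (p 0) (\<Union>i\<in>{1..4}. orb (p i)) \<subseteq> T"
    proof -
      have "orb (p i) \<subseteq> T" if "i \<in> {1..4}" for i
      proof
        fix X assume X: "X \<in> orb (p i)"
        have F: "p i \<in> \<F>" using pF that by simp
        have "i = 1 \<or> i = 2 \<or> i = 3 \<or> i = 4" using that by auto
        then have "v \<in> p i" using v1 v2 v3 v4 by metis
        then show "X \<in> T" using orb_star_fixed[OF F X v(2,1)] orb_F[OF F] X unfolding T_def by blast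
      qed
      then show ?thesis using v0 p0 unfolding T_def by (simp add: UN_subset_iff)
    qed
    then have "card (insert (p 0) (\<Union>i\<in>{1..4}. orb (p i))) \<le> card T"
      by (rule card_mono[rotated]) (use finF in \<open>simp add: T_def\<close>)
    then show False using card_spokes[of 4] T10 by simp
  qed
qed

text \<open>If \<open>d\<close> were fixed, the other five vertices of \<open>p 0\<close> would be
  an invariant set contained in the three facets \<open>p 0\<close>, \<open>p 1\<close> and
  \<open>g (p 1)\<close>, against \<open>thin\<close>.\<close>

lemma first_dropped_moves:
  assumes d: "d \<in> p 0" "w \<notin> p 0" "p 1 = insert w (p 0 - {d})" shows "h d \<noteq> d"
proof
  assume hd: "h d = d"
  have sub: "p 0 - {d} \<subseteq> g (p 1)"
  proof
    fix v assume v: "v \<in> p 0 - {d}"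
    have "g (g (p 0)) = p 0" using p0(2) by simp
    then obtain u where u: "u \<in> p 0" "v = h u" using p0(2) v unfolding g_def by blast
    then have "u \<in> p 1" using d v hd by auto
    then show "v \<in> g (p 1)" using gstar u by simp
  qed
  then have "p 0 - {d} \<subseteq> p 0 \<inter> p 1 \<inter> g (p 1)" using d by blast
  then have "card (p 0 - {d}) \<le> card (p 0 \<inter> p 1 \<inter> g (p 1))"
    by (rule card_mono[rotated]) (use fin_facet[OF p0(1)] in simp)
  then have "5 \<le> card (p 0 \<inter> p 1 \<inter> g (p 1))" using facet[OF p0(1)] fin_facet[OF p0(1)] d by simp
  then have "p 0 = p 1 \<or> p 1 = g (p 1) \<or> p 0 = g (p 1)" using thin[OF p0(1) pF[of 1] gF[OF pF[of 1]]] by simp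
  moreover have "p 0 \<noteq> p 1" using d by blast
  moreover have "p 0 \<noteq> g (p 1)"
  proof
    assume "p 0 = g (p 1)"
    then have "g (g (p 1)) = g (p 1)" using p0(2) by simp
    then show False using fixed_h_iff[OF pF[of 1]] y(2) by simp
  qed
  ultimately show False using y(2) by simp
qed

text \<open>\<open>p 0\<close> contains the moved orbit of its first dropped vertex. A fixed vertex
  among the other three forces all three to be fixed, since a second moved orbit would fill them.
  All three then belong to \<open>p 3\<close> but not to \<open>p 4\<close>, although one step drops
  a single vertex.\<close>

lemma free: assumes v: "v \<in> V" shows "h v \<noteq> v"
proof
  assume hv: "h v = v"
  obtain d w where d: "d \<in> p 0" "w \<notin> p 0" "p 1 = insert w (p 0 - {d})" using step_facet[OF p0(1) y(1)] by metis
  have hd: "h d \<noteq> d" using first_dropped_moves[OF d] .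
  have V0: "p 0 \<subseteq> V" "card (p 0) = 6" "finite (p 0)" using facet[OF p0(1)] fin_facet[OF p0(1)] by auto
  have inv: "h u \<in> p 0" if "u \<in> p 0" for u using gstar[OF that] p0(2) by simp
  have tri: "{u, h u, h (h u)} \<subseteq> p 0" "card {u, h u, h (h u)} = 3" if u: "u \<in> p 0" "h u \<noteq> u" for u
  proof -
    show "{u, h u, h (h u)} \<subseteq> p 0" using inv u by simp
    have "h (h (h u)) = u" using h3 u V0 by blast
    then have "h (h u) \<noteq> u" "h (h u) \<noteq> h u" using u by metis+
    then show "card {u, h u, h (h u)} = 3" using u by simp
  qed
  define Z where "Z = p 0 - {d, h d, h (h d)}"
  have cZ: "card Z = 3" unfolding Z_def using card_Diff_subset[of "{d, h d, h (h d)}" "p 0"] tri[OF d(1) hd] V0 by simp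
  have h3u: "h (h (h u)) = u" if "u \<in> p 0" for u using h3 that V0 by blast
  have vZ: "v \<in> Z" unfolding Z_def using fixed_vertex_star(1)[OF v hv] hv hd h3u[OF d(1)] by (metis DiffI insertE singletonD)
  have Zfix: "h u = u" if u: "u \<in> Z" for u
  proof (rule ccontr)
    assume hu: "h u \<noteq> u"
    have u0: "u \<in> p 0" "u \<notin> {d, h d, h (h d)}" using u unfolding Z_def by auto
    have "h u \<notin> {d, h d, h (h d)}" "h (h u) \<notin> {d, h d, h (h d)}"
      using u0 h3u[OF u0(1)] h3u[OF d(1)] by (metis insertCI insertE singletonD)+
    then have "{u, h u, h (h u)} \<subseteq> Z" using tri(1)[OF u0(1) hu] u0(2) by (simp add: Z_def)
    then have "{u, h u, h (h u)} = Z" using card_subset_eq[of Z "{u, h u, h (h u)}"] tri(2)[OF u0(1) hu] cZ V0 by (simp add: Z_def)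
    then have "v = u \<or> v = h u \<or> v = h (h u)" using vZ by blast
    then show False using hv hu h3u[OF u0(1)] by metis
  qed
  have "Z \<subseteq> p 3 - p 4"
  proof
    fix u assume u: "u \<in> Z"
    then have "u \<in> V" using V0 unfolding Z_def by blast
    then show "u \<in> p 3 - p 4" using fixed_vertex_star(2,3) Zfix[OF u] by blast
  qed
  moreover
  have "p 3 \<in> \<F>" "p (Suc 3) \<in> nb (p 3)" by (intro pF step; simp)+
  then obtain d' w' where "p (Suc 3) = insert w' (p 3 - {d'})" using step_facet by metis
  then have "p 3 - p 4 \<subseteq> {d'}" by auto
  ultimately have "card Z \<le> card {d'}" by (intro card_mono) auto
  then show False using cZ by simp
qed

end

section \<open>Counting covered pairs of vertices\<close>

lemma phi3: "\<phi> (\<phi> (\<phi> x)) = x" by (cases x) simp_all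

lemma funpow_phi_mod3: "(\<phi> ^^ (n mod 3)) x = (\<phi> ^^ n) x"
  by (rule funpow_mod_eq) (simp add: numeral_3_eq_3 phi3)

lemma bij_phi: "bij \<phi>"
  by (rule o_bij[of "\<lambda>x. \<phi> (\<phi> x)"]) (simp_all add: fun_eq_iff phi3)

lemma vertex_UNIV: "UNIV = {a1,b1,c1,a2,b2,c2,a3,b3,c3,a4,b4,c4,a5,b5,c5}"
  using vertex.exhaust by blast

instance vertex :: finite
  by standard (simp add: vertex_UNIV)

lemma card_vertex: "card (UNIV :: vertex set) = 15"
  by (simp add: vertex_UNIV)

definition covered :: "(nat \<Rightarrow> vertex set) \<Rightarrow> nat \<Rightarrow> vertex \<Rightarrow> vertex \<Rightarrow> bool" where
  "covered U k v w \<longleftrightarrow> v \<noteq> w \<and> (\<exists>i\<le>k. \<exists>s. (\<phi> ^^ s) v \<in> U i \<and> (\<phi> ^^ s) w \<in> U i)"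

definition repeats :: "(nat \<Rightarrow> vertex set) \<Rightarrow> nat \<Rightarrow> nat" where
  "repeats U k = card {w \<in> U k \<inter> U (Suc k). \<exists>v\<in>U (Suc k) - U k. covered U k v w}"

text \<open>The repeats of the first \<open>k\<close> steps together with those that the remaining steps on the rim
  must have by \<open>repeats_rim\<close> below. At most 10 of them are possible, so \<open>s\<close> with
  \<open>10 \<le> s + budget U j k\<close> bounds the unforced repeats that are still allowed.\<close>

definition budget :: "(nat \<Rightarrow> vertex set) \<Rightarrow> nat \<Rightarrow> nat \<Rightarrow> nat" where
  "budget U j k = (\<Sum>t\<in>{max j k..<8}. t - 3) + (\<Sum>i<k. repeats U i)"

text \<open>The spoke and the rim in terms of the standard names, where rotation is
  \<open>\<phi>\<close>. \<open>nbs\<close> keeps the fact that every facet except the branch facet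
  and \<open>U 0\<close> has only its two path neighbours.\<close>

locale config =
  fixes U :: "nat \<Rightarrow> vertex set" and j :: nat
  assumes j: "1 \<le> j" "j \<le> 6"
    and zero: "\<phi> ` U 0 = U 0" "card (U 0) = 6"
    and U9: "U 9 = \<phi> ` U j"
    and step: "k \<le> 8 \<Longrightarrow> \<exists>d v. d \<in> U k \<and> v \<notin> U k \<and> U (Suc k) = insert v (U k - {d}) \<and>
      (k < j \<longrightarrow> (\<forall>i\<le>k. d \<in> U i)) \<and> (j \<le> k \<longrightarrow> (\<forall>i. j \<le> i \<longrightarrow> i \<le> k \<longrightarrow> d \<in> U i) \<and> v \<in> U 9)"
    and cover: "v \<noteq> w \<Longrightarrow> covered U 8 v w"
    and nbs: "\<lbrakk>1 \<le> k; k \<le> 8; k \<noteq> j; i \<le> 8; card (U k \<inter> (\<phi> ^^ s) ` U i) = 5\<rbrakk> \<Longrightarrow>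
      (\<phi> ^^ s) ` U i = U (k - 1) \<or> (\<phi> ^^ s) ` U i = U (Suc k)"
begin

lemma card_U: "k \<le> 9 \<Longrightarrow> card (U k) = 6"
proof (induction k)
  case (Suc k)
  then obtain d v where "d \<in> U k" "v \<notin> U k" "U (Suc k) = insert v (U k - {d})" using step[of k] by auto
  then show ?case using Suc by simp
qed (rule zero)

text \<open>Every step adds at most one vertex of the final facet.\<close>

lemma card_target: "k \<le> 9 \<Longrightarrow> card (U 9 - U k) \<le> 9 - k"
proof (induction "9 - k" arbitrary: k)
  case 0
  then show ?case by simp
next
  case (Suc n)
  then have k: "k \<le> 8" "n = 9 - Suc k" "Suc k \<le> 9" by auto
  obtain d v where dv: "U (Suc k) = insert v (U k - {d})" using step[OF k(1)] by blast
  then have "U 9 - U k \<subseteq> insert v (U 9 - U (Suc k))" by auto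
  then have "card (U 9 - U k) \<le> card (insert v (U 9 - U (Suc k)))" by (rule card_mono[rotated]) simp
  also have "\<dots> \<le> Suc (card (U 9 - U (Suc k)))" by (rule card_insert_le_m1) simp_all
  finally show ?case using Suc(1)[OF k(2,3)] Suc(2) by linarith
qed

lemma covered_phi: "covered U k (\<phi> v) (\<phi> w) \<longleftrightarrow> covered U k v w"
proof -
  have "(\<exists>i\<le>k. \<exists>s. (\<phi> ^^ s) (\<phi> v) \<in> U i \<and> (\<phi> ^^ s) (\<phi> w) \<in> U i) \<longleftrightarrow>
      (\<exists>i\<le>k. \<exists>s. (\<phi> ^^ s) v \<in> U i \<and> (\<phi> ^^ s) w \<in> U i)" (is "?L \<longleftrightarrow> ?R")
  proof
    assume ?L
    then obtain i s where "i \<le> k" "(\<phi> ^^ Suc s) v \<in> U i" "(\<phi> ^^ Suc s) w \<in> U i" by (auto simp: funpow_swap1)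
    then show ?R by blast
  next
    assume ?R
    then obtain i s where i: "i \<le> k" "(\<phi> ^^ s) v \<in> U i" "(\<phi> ^^ s) w \<in> U i" by blast
    have "(\<phi> ^^ (s + 2)) (\<phi> x) = (\<phi> ^^ s) x" for x
    proof -
      have "(\<phi> ^^ 2) (\<phi> x) = x" by (simp add: numeral_2_eq_2 phi3)
      then show ?thesis by (simp only: funpow_add o_apply)
    qed
    then show ?L using i by metis
  qed
  moreover have "\<phi> v = \<phi> w \<longleftrightarrow> v = w" using phi3 by metis
  ultimately show ?thesis unfolding covered_def by simp
qed

lemma covered_funpow: "covered U k ((\<phi> ^^ s) v) ((\<phi> ^^ s) w) \<longleftrightarrow> covered U k v w"
  by (induction s) (simp_all add: covered_phi)

lemma covered_sym: "covered U k v w \<longleftrightarrow> covered U k w v"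
  unfolding covered_def by auto

lemma covered_mono: "covered U k v w \<Longrightarrow> k \<le> l \<Longrightarrow> covered U l v w"
  unfolding covered_def by (meson le_trans)

text \<open>\<open>U 0\<close> is invariant, so rotation adds nothing to its \<open>6 * 5\<close>
  ordered pairs.\<close>

lemma card_covered_0: "card {(v, w). covered U 0 v w} \<le> 30"
proof -
  have iff: "(\<phi> ^^ s) v \<in> U 0 \<longleftrightarrow> v \<in> U 0" for s v
  proof (induction s)
    case (Suc s)
    have "\<phi> x \<in> U 0 \<longleftrightarrow> x \<in> U 0" for x
      using zero(1) bij_phi by (metis bij_def inj_image_mem_iff)
    then show ?case using Suc by simp
  qed simp
  have "{(v, w). covered U 0 v w} \<subseteq> U 0 \<times> U 0 - (\<lambda>x. (x, x)) ` U 0"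
    unfolding covered_def using iff by auto
  then have "card {(v, w). covered U 0 v w} \<le> card (U 0 \<times> U 0 - (\<lambda>x. (x, x)) ` U 0)"
    by (rule card_mono[rotated]) simp
  also have "\<dots> = card (U 0 \<times> U 0) - card ((\<lambda>x. (x, x)) ` U 0)" by (rule card_Diff_subset) auto
  also have "card ((\<lambda>x. (x, x)) ` U 0) = card (U 0)" by (rule card_image) (simp add: inj_on_def)
  finally show ?thesis using zero by (simp add: card_cartesian_product)
qed

lemma card_covered_8: "card {(v, w). covered U 8 v w} = 210"
proof -
  have "{(v, w). covered U 8 v w} = UNIV \<times> UNIV - (\<lambda>x. (x, x)) ` UNIV"
  proof -
    have "covered U 8 v w \<longleftrightarrow> v \<noteq> w" for v w using cover[of v w] unfolding covered_def by blast
    then show ?thesis by auto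
  qed
  also have "card \<dots> = card (UNIV \<times> UNIV :: (vertex \<times> vertex) set) - card ((\<lambda>x. (x, x)) ` (UNIV :: vertex set))"
    by (rule card_Diff_subset) auto
  also have "card ((\<lambda>x. (x, x)) ` (UNIV :: vertex set)) = 15"
    unfolding card_vertex[symmetric] by (rule card_image) (simp add: inj_on_def)
  finally show ?thesis by (simp only: card_cartesian_product card_vertex)
qed

text \<open>A new pair consists of the new vertex and one of the five kept ones. With three
  rotations and two orders this gives at most 30 ordered pairs, and each repeat saves six of
  them.\<close>

lemma card_covered_Suc:
  assumes k: "k \<le> 8"
  shows "card {(v, w). covered U (Suc k) v w} + 6 * repeats U k \<le> card {(v, w). covered U k v w} + 30"
proof -
  obtain d v where dv: "d \<in> U k" "v \<notin> U k" "U (Suc k) = insert v (U k - {d})" using step[OF k] by blast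
  define K where "K = U k \<inter> U (Suc k)"
  define B where "B = {w \<in> K. \<not> covered U k v w}"
  define f where "f = (\<lambda>(t, w). ((\<phi> ^^ t) v, (\<phi> ^^ t) w))"
  have K1: "K = U k - {d}" unfolding K_def using dv by auto
  have K: "K = U k - {d}" "card K = 5" using K1 dv(1) card_U[of k] k by simp_all
  have r: "repeats U k = card {w \<in> K. covered U k v w}"
  proof -
    have "U (Suc k) - U k = {v}" using dv by auto
    then show ?thesis unfolding repeats_def K_def by simp
  qed
  have "card ({w \<in> K. covered U k v w} \<union> B) = card {w \<in> K. covered U k v w} + card B"
    by (rule card_Un_disjoint) (auto simp: B_def)
  moreover have "{w \<in> K. covered U k v w} \<union> B = K" unfolding B_def by auto
  ultimately have cB: "card B + repeats U k = 5" using r K(2) by simp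
  \<comment> \<open>Rotating by \<open>2 * s\<close> undoes a rotation by \<open>s\<close>; the
    remainder modulo three brings the exponent into the range of \<open>f\<close>.\<close>
  have new: "(x, y) \<in> f ` ({..<3} \<times> B)" if s: "(\<phi> ^^ s) x = v" "(\<phi> ^^ s) y \<in> K" and nc: "\<not> covered U k x y" for s x y
  proof -
    have inv: "(\<phi> ^^ (2 * s)) ((\<phi> ^^ s) u) = u" for u
    proof -
      have "(\<phi> ^^ (2 * s)) ((\<phi> ^^ s) u) = (\<phi> ^^ (3 * s)) u" by (simp add: funpow_add[symmetric, unfolded comp_def fun_eq_iff, rule_format])
      also have "\<dots> = (\<phi> ^^ (3 * s mod 3)) u" by (rule funpow_phi_mod3[symmetric])
      finally show ?thesis by simp
    qed
    define t where "t = 2 * s mod 3"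
    have "(\<phi> ^^ t) v = x" "(\<phi> ^^ t) ((\<phi> ^^ s) y) = y" unfolding t_def funpow_phi_mod3 using inv s by metis+
    moreover have "(\<phi> ^^ s) y \<in> B" unfolding B_def using s nc covered_funpow[of k s x y] by simp
    moreover have "t < 3" unfolding t_def by simp
    ultimately show ?thesis unfolding f_def by (intro image_eqI[of _ _ "(t, (\<phi> ^^ s) y)"]) simp_all
  qed
  have "{(x, y). covered U (Suc k) x y} \<subseteq> {(x, y). covered U k x y} \<union> (f ` ({..<3} \<times> B) \<union> prod.swap ` f ` ({..<3} \<times> B))"
  proof (rule subrelI)
    fix x y assume "(x, y) \<in> {(x, y). covered U (Suc k) x y}"
    then obtain i s where xy: "x \<noteq> y" "i \<le> Suc k" "(\<phi> ^^ s) x \<in> U i" "(\<phi> ^^ s) y \<in> U i" unfolding covered_def by blast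
    show "(x, y) \<in> {(x, y). covered U k x y} \<union> (f ` ({..<3} \<times> B) \<union> prod.swap ` f ` ({..<3} \<times> B))"
    proof (cases "covered U k x y")
      case nc: False
      then have i: "i = Suc k" using xy unfolding covered_def by (metis le_SucE)
      have ne: "(\<phi> ^^ s) x \<noteq> (\<phi> ^^ s) y" using xy(1) bij_fn[OF bij_phi, of s] by (metis bij_pointE)
      have "\<not> ((\<phi> ^^ s) x \<in> U k \<and> (\<phi> ^^ s) y \<in> U k)" using nc xy unfolding covered_def by blast
      then have "(\<phi> ^^ s) x = v \<and> (\<phi> ^^ s) y \<in> K \<or> (\<phi> ^^ s) y = v \<and> (\<phi> ^^ s) x \<in> K"
        using xy(3,4) ne unfolding i dv(3) K(1) by auto
      then show ?thesis
      proof
        assume "(\<phi> ^^ s) x = v \<and> (\<phi> ^^ s) y \<in> K"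
        then show ?thesis using new[of s x y] nc by blast
      next
        assume "(\<phi> ^^ s) y = v \<and> (\<phi> ^^ s) x \<in> K"
        then have "(y, x) \<in> f ` ({..<3} \<times> B)" using new[of s y x] nc covered_sym by blast
        then have "prod.swap (y, x) \<in> prod.swap ` f ` ({..<3} \<times> B)" by (rule imageI)
        then show ?thesis by simp
      qed
    qed simp
  qed
  then have "card {(x, y). covered U (Suc k) x y} \<le> card ({(x, y). covered U k x y} \<union> (f ` ({..<3} \<times> B) \<union> prod.swap ` f ` ({..<3} \<times> B)))"
    by (rule card_mono[rotated]) simp
  also have "\<dots> \<le> card {(x, y). covered U k x y} + (card (f ` ({..<3} \<times> B)) + card (prod.swap ` f ` ({..<3} \<times> B)))"
    by (intro order_trans[OF card_Un_le] add_left_mono card_Un_le)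
  also have "card (f ` ({..<3} \<times> B)) \<le> 3 * card B" using card_image_le[of "{..<3} \<times> B" f] by (simp add: card_cartesian_product)
  also have "card (prod.swap ` f ` ({..<3} \<times> B)) \<le> card (f ` ({..<3} \<times> B))" by (rule card_image_le) simp
  also have "\<dots> \<le> 3 * card B" using card_image_le[of "{..<3} \<times> B" f] by (simp add: card_cartesian_product)
  finally show ?thesis using cB by simp
qed

text \<open>There are 35 orbits of pairs of vertices; \<open>U 0\<close> covers 5 of them, and each of the eight steps
  at most 5 more.\<close>

lemma sum_repeats: "(\<Sum>k<8. repeats U k) \<le> 10"
proof -
  \<comment> \<open>An orbit of unordered pairs has six ordered ones. For \<open>n = 8\<close> the
    estimate reads \<open>210 + 6 * repeats \<le> 270\<close>.\<close>
  have "card {(v, w). covered U n v w} + 6 * (\<Sum>k<n. repeats U k) \<le> 30 + 30 * n" if "n \<le> 8" for n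
    using that
  proof (induction n)
    case 0 then show ?case using card_covered_0 by simp
  next
    case (Suc n)
    then show ?case using card_covered_Suc[of n] by simp
  qed
  from this[of 8] show ?thesis using card_covered_8 by simp
qed

text \<open>At most \<open>8 - k\<close> of the six vertices of \<open>U 9\<close> are missing from
  \<open>U (Suc k)\<close>. So \<open>U (Suc k)\<close> contains the new vertex and at least
  \<open>k - 3\<close> others of \<open>U 9\<close>. Since \<open>U 9\<close> is the rotated
  \<open>U j\<close>, their pairs with the new vertex are already covered.\<close>

lemma repeats_rim: assumes k: "j \<le> k" "k \<le> 7" shows "k - 3 \<le> repeats U k"
proof -
  obtain d v where dv: "d \<in> U k" "v \<notin> U k" "U (Suc k) = insert v (U k - {d})" "v \<in> U 9" using step[of k] k by auto
  have e: "U (Suc k) - U k = {v}" using dv by auto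
  have "card (U 9) = card (U 9 - U (Suc k)) + card (U 9 \<inter> U (Suc k))"
    by (subst card_Un_disjoint[symmetric]) (auto intro: arg_cong[where f = card])
  then have "6 \<le> 9 - Suc k + card (U 9 \<inter> U (Suc k))" using card_target[of "Suc k"] card_U[of 9] k by simp
  moreover have "U 9 \<inter> U (Suc k) = insert v (U 9 \<inter> U k \<inter> U (Suc k))" using dv by auto
  then have "card (U 9 \<inter> U (Suc k)) \<le> Suc (card (U 9 \<inter> U k \<inter> U (Suc k)))" using dv(2) by simp
  moreover have "card (U 9 \<inter> U k \<inter> U (Suc k)) \<le> repeats U k"
    unfolding repeats_def e
  proof (intro card_mono subsetI)
    fix w assume w: "w \<in> U 9 \<inter> U k \<inter> U (Suc k)"
    obtain v' w' where "v = \<phi> v'" "w = \<phi> w'" "v' \<in> U j" "w' \<in> U j" using w dv(4) unfolding U9 by blast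
    moreover have "v \<noteq> w" using w dv(2) by auto
    ultimately have "covered U k v' w'" unfolding covered_def using k by (intro conjI exI[of _ j] exI[of _ 0]) auto
    then have "covered U k v w" using covered_phi \<open>v = _\<close> \<open>w = _\<close> by simp
    then show "w \<in> {w \<in> U k \<inter> U (Suc k). \<exists>v\<in>{v}. covered U k v w}" using w by simp
  qed simp
  ultimately show ?thesis using k by linarith
qed

text \<open>The accounting of one search step: the \<open>e\<close> repeats that were set aside as
  forced are released, and the \<open>r\<close> repeats that are found are paid for.\<close>

lemma repeats_budget:
  assumes k: "k \<le> 7" and b: "10 \<le> s + budget U j k" and e: "e = (if k < j then 0 else k - 3)" and r: "r \<le> repeats U k"
  shows "r \<le> s + e" "10 \<le> (s + e - r) + budget U j (Suc k)"
proof -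
  have f: "(\<Sum>t\<in>{max j k..<8}. t - 3) = e + (\<Sum>t\<in>{max j (Suc k)..<8}. t - 3)"
  proof (cases "k < j")
    case True then show ?thesis using e by simp
  next
    case False
    then show ?thesis using e k by (simp add: max_def sum.atLeast_Suc_lessThan)
  qed
  have "(\<Sum>t\<in>{max j (Suc k)..<8}. t - 3) \<le> (\<Sum>t\<in>{max j (Suc k)..<8}. repeats U t)"
    by (rule sum_mono) (use repeats_rim in auto)
  also have "\<dots> \<le> (\<Sum>t\<in>{Suc k..<8}. repeats U t)" by (rule sum_mono2) auto
  finally have "(\<Sum>i<Suc k. repeats U i) + (\<Sum>t\<in>{max j (Suc k)..<8}. t - 3) \<le> (\<Sum>i<8. repeats U i)"
    using sum.atLeastLessThan_concat[of 0 "Suc k" 8 "repeats U"] k by (simp add: atLeast0LessThan[symmetric] del: sum.op_ivl_Suc)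
  then have "(\<Sum>i<k. repeats U i) + repeats U k + (\<Sum>t\<in>{max j (Suc k)..<8}. t - 3) \<le> 10"
    using sum_repeats by simp
  then show "r \<le> s + e" "10 \<le> (s + e - r) + budget U j (Suc k)" using b r unfolding budget_def f by simp_all
qed

end

section \<open>The search\<close>

text \<open>The covered pairs are stored up to rotation: a pair is rotated such that its first component
  is one of \<open>a1, \<dots>, a5\<close>, and the row of this vertex contains the second component.\<close>

fun unrot :: "vertex \<Rightarrow> vertex \<Rightarrow> vertex" where
  "unrot a1 w = w" | "unrot b1 w = \<phi> (\<phi> w)" | "unrot c1 w = \<phi> w"
| "unrot a2 w = w" | "unrot b2 w = \<phi> (\<phi> w)" | "unrot c2 w = \<phi> w"
| "unrot a3 w = w" | "unrot b3 w = \<phi> (\<phi> w)" | "unrot c3 w = \<phi> w"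
| "unrot a4 w = w" | "unrot b4 w = \<phi> (\<phi> w)" | "unrot c4 w = \<phi> w"
| "unrot a5 w = w" | "unrot b5 w = \<phi> (\<phi> w)" | "unrot c5 w = \<phi> w"

datatype rows = Rows "vertex list" "vertex list" "vertex list" "vertex list" "vertex list"

fun row :: "vertex \<Rightarrow> rows \<Rightarrow> vertex list" where
  "row a1 (Rows p q r s t) = p" | "row b1 (Rows p q r s t) = p" | "row c1 (Rows p q r s t) = p"
| "row a2 (Rows p q r s t) = q" | "row b2 (Rows p q r s t) = q" | "row c2 (Rows p q r s t) = q"
| "row a3 (Rows p q r s t) = r" | "row b3 (Rows p q r s t) = r" | "row c3 (Rows p q r s t) = r"
| "row a4 (Rows p q r s t) = s" | "row b4 (Rows p q r s t) = s" | "row c4 (Rows p q r s t) = s"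
| "row a5 (Rows p q r s t) = t" | "row b5 (Rows p q r s t) = t" | "row c5 (Rows p q r s t) = t"

fun put :: "vertex \<Rightarrow> vertex \<Rightarrow> rows \<Rightarrow> rows" where
  "put a1 x (Rows p q r s t) = Rows (x # p) q r s t"
| "put b1 x (Rows p q r s t) = Rows (x # p) q r s t"
| "put c1 x (Rows p q r s t) = Rows (x # p) q r s t"
| "put a2 x (Rows p q r s t) = Rows p (x # q) r s t"
| "put b2 x (Rows p q r s t) = Rows p (x # q) r s t"
| "put c2 x (Rows p q r s t) = Rows p (x # q) r s t"
| "put a3 x (Rows p q r s t) = Rows p q (x # r) s t"
| "put b3 x (Rows p q r s t) = Rows p q (x # r) s t"
| "put c3 x (Rows p q r s t) = Rows p q (x # r) s t"
| "put a4 x (Rows p q r s t) = Rows p q r (x # s) t"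
| "put b4 x (Rows p q r s t) = Rows p q r (x # s) t"
| "put c4 x (Rows p q r s t) = Rows p q r (x # s) t"
| "put a5 x (Rows p q r s t) = Rows p q r s (x # t)"
| "put b5 x (Rows p q r s t) = Rows p q r s (x # t)"
| "put c5 x (Rows p q r s t) = Rows p q r s (x # t)"

definition seen :: "rows \<Rightarrow> vertex \<Rightarrow> vertex \<Rightarrow> bool" where
  "seen R v w \<longleftrightarrow> unrot v w \<in> set (row v R)"

text \<open>A pair is entered in both orders, because only the first component is
  normalised.\<close>

fun see :: "vertex \<Rightarrow> vertex list \<Rightarrow> rows \<Rightarrow> rows" where
  "see v [] R = R"
| "see v (w # ws) R = see v ws (if seen R v w then R else put v (unrot v w) (put w (unrot w v) R))"

text \<open>Facets are lists, the new vertex first. A step adds \<open>v\<close> to the current facet \<open>u\<close> and drops \<open>d\<close>; \<open>r\<close>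
  counts the repeats, \<open>e\<close> the forced ones among them. Only the vertices in \<open>orig\<close>, those that have been present
  since the beginning of the spoke or the rim, may be dropped. On the rim, all added vertices belong to
  the final facet \<open>tgt\<close>, and the length test makes sure that it can still be reached.\<close>

fun rim :: "nat \<Rightarrow> nat \<Rightarrow> nat \<Rightarrow> vertex list \<Rightarrow> vertex list \<Rightarrow> vertex list \<Rightarrow> rows
    \<Rightarrow> vertex list list \<Rightarrow> vertex list list list" where
  "rim 0 e s tgt u orig R p = [u # p]"
| "rim (Suc n) e s tgt u orig R p =
    concat (map (\<lambda>v. let q = filter (seen R v) u in
      if length q > Suc (s + e) then [] else
      concat (map (\<lambda>d. let r = length (remove1 d q); b = remove1 d u in
          if r \<le> s + e \<and> length (filter (\<lambda>x. x \<notin> set (v # b)) tgt) \<le> Suc n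
          then rim n (Suc e) (s + e - r) tgt (v # b) (remove1 d orig) (see v b R) (u # p) else [])
        orig))
      (filter (\<lambda>x. x \<notin> set u) tgt))"

text \<open>By symmetry, the first unused vertex is taken whenever a vertex from an unused orbit is added (\<open>fresh\<close>),
  and the orbit of \<open>a1\<close> may be rotated separately until one of its vertices is dropped.\<close>

fun spoke :: "nat \<Rightarrow> nat \<Rightarrow> nat \<Rightarrow> vertex list \<Rightarrow> vertex list \<Rightarrow> vertex list \<Rightarrow> vertex list \<Rightarrow> rows
    \<Rightarrow> vertex list list \<Rightarrow> vertex list list list" where
  "spoke 0 n s known fresh u orig R p =
     (let tgt = map \<phi> u in
      if length (filter (\<lambda>x. x \<notin> set u) tgt) \<le> Suc n
      then rim n (5 - n) s tgt u u R p else [])"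
| "spoke (Suc m) n s known fresh u orig R p =
    concat (map (\<lambda>v. let q = filter (seen R v) u in
      if length q > Suc s then [] else
      concat (map (\<lambda>d. let r = length (remove1 d q); b = remove1 d u in
          if r \<le> s
          then spoke m n (s - r) (if v \<in> set known then known else [v, \<phi> v, \<phi> (\<phi> v)] @ known)
             (remove1 v fresh) (v # b) (remove1 d orig) (see v b R) (u # p) else [])
        (if {a1,b1,c1} \<subseteq> set orig then filter (\<lambda>x. x \<noteq> a1 \<and> x \<noteq> b1) orig else orig)))
      (take 1 fresh @ filter (\<lambda>x. x \<notin> set u) known))"

section \<open>Symmetries of the search: permutations that commute with the rotation\<close>

definition commuting :: "(vertex \<Rightarrow> vertex) \<Rightarrow> bool" where
  "commuting f \<longleftrightarrow> bij f \<and> (\<forall>x. f (\<phi> x) = \<phi> (f x))"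

lemma commuting_id: "commuting id" by (simp add: commuting_def)

lemma commuting_comp: "commuting f \<Longrightarrow> commuting f' \<Longrightarrow> commuting (f \<circ> f')"
  unfolding commuting_def by (simp add: bij_comp)

lemma commuting_funpow: "commuting f \<Longrightarrow> (\<phi> ^^ s) (f x) = f ((\<phi> ^^ s) x)"
  by (induction s) (simp_all add: commuting_def)

text \<open>All conditions are about membership, cardinalities and rotation, so a commuting
  bijection preserves them. Every reduction by symmetry rests on this.\<close>

lemma config_image:
  assumes f: "commuting f" and c: "config U j" shows "config (\<lambda>i. f ` U i) j"
proof -
  interpret config U j by (rule c)
  have b: "bij f" "inj f" using f unfolding commuting_def bij_def by auto
  have im: "(\<phi> ^^ s) ` f ` A = f ` (\<phi> ^^ s) ` A" for s A
    by (simp add: image_image commuting_funpow[OF f])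
  have im1: "\<phi> ` f ` A = f ` \<phi> ` A" for A using im[of 1] by simp
  have cd: "card (f ` A) = card A" for A by (rule card_image) (use b in \<open>simp add: inj_on_def\<close>)
  have mem: "f x \<in> f ` A \<longleftrightarrow> x \<in> A" for x A using b by (simp add: inj_image_mem_iff)
  show ?thesis
  proof
    show "1 \<le> j" "j \<le> 6" by (rule j)+
    show "\<phi> ` f ` U 0 = f ` U 0" "card (f ` U 0) = 6" "f ` U 9 = \<phi> ` f ` U j"
      using zero U9 by (simp_all add: im1 cd)
    show "\<exists>d v. d \<in> f ` U k \<and> v \<notin> f ` U k \<and> f ` U (Suc k) = insert v (f ` U k - {d}) \<and>
      (k < j \<longrightarrow> (\<forall>i\<le>k. d \<in> f ` U i)) \<and> (j \<le> k \<longrightarrow> (\<forall>i. j \<le> i \<longrightarrow> i \<le> k \<longrightarrow> d \<in> f ` U i) \<and> v \<in> f ` U 9)"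
      if k: "k \<le> 8" for k
    proof -
      obtain d v where dv: "d \<in> U k" "v \<notin> U k" "U (Suc k) = insert v (U k - {d})"
        "k < j \<longrightarrow> (\<forall>i\<le>k. d \<in> U i)" "j \<le> k \<longrightarrow> (\<forall>i. j \<le> i \<longrightarrow> i \<le> k \<longrightarrow> d \<in> U i) \<and> v \<in> U 9" using step[OF k] by blast
      have "f ` U (Suc k) = insert (f v) (f ` U k - {f d})"
        unfolding dv(3) image_insert image_set_diff[OF b(2)] by simp
      then show ?thesis using dv by (intro exI[of _ "f d"] exI[of _ "f v"]) (simp add: mem)
    qed
    show "covered (\<lambda>i. f ` U i) 8 v w" if vw: "v \<noteq> w" for v w
    proof -
      obtain v' w' where e: "v = f v'" "w = f w'" using b(1) by (metis bij_pointE)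
      then have "v' \<noteq> w'" using vw by metis
      then have "\<exists>i\<le>8. \<exists>s. (\<phi> ^^ s) v' \<in> U i \<and> (\<phi> ^^ s) w' \<in> U i" using cover[of v' w'] unfolding covered_def by simp
      then show ?thesis using vw unfolding covered_def e commuting_funpow[OF f] mem by simp
    qed
    show "(\<phi> ^^ s) ` f ` U i = f ` U (k - 1) \<or> (\<phi> ^^ s) ` f ` U i = f ` U (Suc k)"
      if "1 \<le> k" "k \<le> 8" "k \<noteq> j" "i \<le> 8" "card (f ` U k \<inter> (\<phi> ^^ s) ` f ` U i) = 5" for k i s
    proof -
      have "f ` U k \<inter> (\<phi> ^^ s) ` f ` U i = f ` (U k \<inter> (\<phi> ^^ s) ` U i)" unfolding im by (simp add: image_Int[OF b(2)])
      then have "card (U k \<inter> (\<phi> ^^ s) ` U i) = 5" using that(5) by (simp only: cd)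
      then show ?thesis using nbs[OF that(1-4)] unfolding im by metis
    qed
  qed
qed

lemma unrot_inv:
  assumes "\<And>x y. C (\<phi> x) (\<phi> y) \<longleftrightarrow> C x y" shows "C (unrot v x) (unrot v y) \<longleftrightarrow> C x y"
  by (cases v) (simp_all add: assms)

lemma row_put: "row v (put a x R) = (if unrot v v = unrot a a then x # row v R else row v R)"
  by (cases R; cases a; cases v) simp_all

lemma seen_put: "seen (put a x R) v w \<Longrightarrow> seen R v w \<or> unrot v v = unrot a a \<and> unrot v w = x"
  by (auto simp: seen_def row_put split: if_splits)

text \<open>Rows contain only pairs of a relation that is symmetric and invariant under rotation.
  This direction is the one that matters: repeats are never overcounted, so no true step is
  pruned.\<close>

lemma seen_see:
  assumes inv: "\<And>x y. C (\<phi> x) (\<phi> y) \<longleftrightarrow> C x y" and sym: "\<And>x y. C x y \<Longrightarrow> C y x"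
    and R: "\<And>x y. seen R x y \<Longrightarrow> C x y" and ws: "\<And>w. w \<in> set ws \<Longrightarrow> C v w" and xy: "seen (see v ws R) x y"
  shows "C x y"
  using R ws xy
proof (induction ws arbitrary: R)
  case (Cons w ws)
  have p: "C x y" if "seen (put a (unrot a b) R) x y" "C a b" "\<And>x y. seen R x y \<Longrightarrow> C x y" for a b R x y
  proof -
    have "C (unrot a a) (unrot a b)" using that(2) unrot_inv[of C, OF inv] by simp
    then show ?thesis using seen_put[OF that(1)] that(3) unrot_inv[of C x x y, OF inv] by metis
  qed
  show ?case
  proof (rule Cons.IH)
    show "C v w" if "w \<in> set ws" for w using Cons.prems(2) that by simp
    show "seen (see v ws (if seen R v w then R else put v (unrot v w) (put w (unrot w v) R))) x y"
      using Cons.prems(3) by simp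
    fix x y assume s: "seen (if seen R v w then R else put v (unrot v w) (put w (unrot w v) R)) x y"
    have vw: "C v w" "C w v" using Cons.prems(2) sym by simp_all
    show "C x y"
    proof (cases "seen R v w")
      case False
      then show ?thesis using s p[OF _ vw(1), of "put w (unrot w v) R" x y] p[OF _ vw(2), of R] Cons.prems(1) by auto
    qed (use s Cons.prems(1) in simp)
  qed
qed simp

lemma in_concat_mapI: "a \<in> set xs \<Longrightarrow> x \<in> set (F a) \<Longrightarrow> x \<in> set (concat (map F xs))"
  by auto

lemma rim_SucI:
  assumes "v \<in> set tgt" "v \<notin> set u" "length (filter (seen R v) u) \<le> Suc (s + e)" "d \<in> set orig"
    "length (remove1 d (filter (seen R v) u)) \<le> s + e"
    "length (filter (\<lambda>x. x \<notin> set (v # remove1 d u)) tgt) \<le> Suc n"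
    "x \<in> set (rim n (Suc e) (s + e - length (remove1 d (filter (seen R v) u))) tgt (v # remove1 d u)
      (remove1 d orig) (see v (remove1 d u) R) (u # p))"
  shows "x \<in> set (rim (Suc n) e s tgt u orig R p)"
  unfolding rim.simps Let_def
  apply (rule in_concat_mapI[of v])
  subgoal using assms(1,2) by simp
  subgoal
    apply (subst if_not_P)
    subgoal using assms(3) by simp
    apply (rule in_concat_mapI[of d, OF assms(4)])
    apply (subst if_P)
    subgoal using assms(5,6) by blast
    by (rule assms(7))
  done

lemma spoke_SucI:
  assumes "v \<in> set (take 1 fresh @ filter (\<lambda>x. x \<notin> set u) known)" "length (filter (seen R v) u) \<le> Suc s"
    "d \<in> set (if {a1,b1,c1} \<subseteq> set orig then filter (\<lambda>x. x \<noteq> a1 \<and> x \<noteq> b1) orig else orig)"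
    "length (remove1 d (filter (seen R v) u)) \<le> s"
    "x \<in> set (spoke m n (s - length (remove1 d (filter (seen R v) u)))
      (if v \<in> set known then known else [v, \<phi> v, \<phi> (\<phi> v)] @ known) (remove1 v fresh)
      (v # remove1 d u) (remove1 d orig) (see v (remove1 d u) R) (u # p))"
  shows "x \<in> set (spoke (Suc m) n s known fresh u orig R p)"
  unfolding spoke.simps Let_def
  apply (rule in_concat_mapI[of v, OF assms(1)])
  apply (subst if_not_P[of "Suc s < length (filter (seen R v) u)"])
  subgoal using assms(2) by simp
  apply (rule in_concat_mapI[of d, OF assms(3)])
  apply (subst if_P[of "length (remove1 d (filter (seen R v) u)) \<le> s"])
  subgoal by (rule assms(4))
  by (rule assms(5))

section \<open>Completeness of the search on the rim\<close>

context config
begin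

text \<open>The list tested before \<open>d\<close> is chosen may contain \<open>d\<close> itself.
  This is the reason for the \<open>Suc\<close> in the early test of the search.\<close>

lemma repeats_filter:
  assumes k: "k \<le> 8" and u: "set u = U k" "distinct u" and dv: "d \<in> U k" "v \<notin> U k" "U (Suc k) = insert v (U k - {d})"
    and R: "\<And>x y. seen R x y \<Longrightarrow> covered U k x y"
  shows "length (remove1 d (filter (seen R v) u)) \<le> repeats U k"
    "length (filter (seen R v) u) \<le> Suc (length (remove1 d (filter (seen R v) u)))"
proof -
  let ?q = "remove1 d (filter (seen R v) u)"
  have "set ?q \<subseteq> {w \<in> U k \<inter> U (Suc k). \<exists>v\<in>U (Suc k) - U k. covered U k v w}"
  proof
    fix w assume "w \<in> set ?q"
    then have "w \<in> U k" "w \<noteq> d" "covered U k v w" using u R by auto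
    moreover have "v \<in> U (Suc k) - U k" using dv by simp
    ultimately show "w \<in> {w \<in> U k \<inter> U (Suc k). \<exists>v\<in>U (Suc k) - U k. covered U k v w}" using dv(3) by blast
  qed
  then have "card (set ?q) \<le> repeats U k" unfolding repeats_def by (rule card_mono[rotated]) simp
  moreover have "card (set ?q) = length ?q" by (rule distinct_card) (use u in simp)
  ultimately show "length ?q \<le> repeats U k" by simp
  show "length (filter (seen R v) u) \<le> Suc (length ?q)" by (simp add: length_remove1, linarith)
qed

lemma covered_Suc_see:
  assumes R: "\<And>x y. seen R x y \<Longrightarrow> covered U k x y" and b: "v \<notin> set b" "insert v (set b) = U (Suc k)"
    and xy: "seen (see v b R) x y"
  shows "covered U (Suc k) x y"
proof (rule seen_see[where C = "covered U (Suc k)", OF _ _ _ _ xy])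
  show "covered U (Suc k) x y" if "seen R x y" for x y using covered_mono[OF R[OF that], of "Suc k"] by simp
  show "covered U (Suc k) v w" if w: "w \<in> set b" for w
  proof -
    have "v \<noteq> w" "v \<in> U (Suc k)" "w \<in> U (Suc k)" using b w by auto
    then show ?thesis unfolding covered_def by (metis funpow_0 order_refl)
  qed
qed (simp_all add: covered_phi covered_sym)

lemma length_target:
  assumes "k \<le> 9" "distinct tgt" "set tgt = U 9" "set u = U k"
  shows "length (filter (\<lambda>x. x \<notin> set u) tgt) \<le> 9 - k"
proof -
  have "length (filter (\<lambda>x. x \<notin> set u) tgt) = card (set (filter (\<lambda>x. x \<notin> set u) tgt))"
    by (rule distinct_card[symmetric]) (use assms(2) in simp)
  also have "set (filter (\<lambda>x. x \<notin> set u) tgt) = U 9 - U k" using assms by auto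
  finally show ?thesis using card_target[OF assms(1)] by simp
qed

text \<open>The actual steps of the configuration pass every test, so their branch is never pruned.
  The list grows at its front, and \<open>U 9\<close> is not recorded, hence the reversed range up
  to 8.\<close>

lemma rim_complete:
  assumes "n + k = 8" "3 \<le> j" "j \<le> k" "set u = U k" "distinct u" "set tgt = U 9" "distinct tgt"
    "\<And>x. (\<And>i. j \<le> i \<Longrightarrow> i \<le> k \<Longrightarrow> x \<in> U i) \<Longrightarrow> x \<in> set orig"
    "\<And>x y. seen R x y \<Longrightarrow> covered U k x y" "10 \<le> s + budget U j k" "e = k - 3"
  shows "\<exists>q. q @ p \<in> set (rim n e s tgt u orig R p) \<and> map set q = rev (map U [k..<9])"
  using assms
proof (induction n arbitrary: k u orig R s e p)
  case 0
  then show ?case by (intro exI[of _ "[u]"]) (simp add: upt_conv_Cons)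
next
  case (Suc n)
  note pr = Suc.prems
  have k: "k \<le> 7" "k \<le> 8" using pr(1) by auto
  obtain d v where dv: "d \<in> U k" "v \<notin> U k" "U (Suc k) = insert v (U k - {d})"
    "\<forall>i. j \<le> i \<longrightarrow> i \<le> k \<longrightarrow> d \<in> U i" "v \<in> U 9" using step[OF k(2)] pr(3) by blast
  define b where "b = remove1 d u"
  define r where "r = length (remove1 d (filter (seen R v) u))"
  have b: "set b = U k - {d}" "distinct b" unfolding b_def using pr(4,5) by simp_all
  have r: "r \<le> repeats U k" "length (filter (seen R v) u) \<le> Suc r"
    unfolding r_def by (rule repeats_filter[OF k(2) pr(4,5) dv(1-3) pr(9)]; assumption)+
  have bud: "r \<le> s + e" "10 \<le> (s + e - r) + budget U j (Suc k)"
    using repeats_budget[OF k(1) pr(10) _ r(1), of e] pr(3,11) by simp_all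
  have vb: "set (v # b) = U (Suc k)" using b dv by simp
  have "\<exists>q. q @ (u # p) \<in> set (rim n (Suc e) (s + e - r) tgt (v # b) (remove1 d orig) (see v b R) (u # p)) \<and>
      map set q = rev (map U [Suc k..<9])"
  proof (rule Suc.IH)
    show "n + Suc k = 8" "3 \<le> j" "j \<le> Suc k" "set tgt = U 9" "distinct tgt" using pr by simp_all
    show "set (v # b) = U (Suc k)" by (rule vb)
    show "distinct (v # b)" using b dv by simp
    show "Suc e = Suc k - 3" using pr(2,3,11) by simp
    show "10 \<le> (s + e - r) + budget U j (Suc k)" by (rule bud)
    show "x \<in> set (remove1 d orig)" if x: "\<And>i. j \<le> i \<Longrightarrow> i \<le> Suc k \<Longrightarrow> x \<in> U i" for x
    proof -
      have "x \<in> set orig" by (rule pr(8)) (use x in simp)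
      moreover have "x \<noteq> d" using x[of "Suc k"] dv(1-3) pr(3) by auto
      ultimately show ?thesis by (simp add: in_set_remove1)
    qed
    show "covered U (Suc k) x y" if "seen (see v b R) x y" for x y
      by (rule covered_Suc_see[OF pr(9) _ _ that]) (use b dv in auto)
  qed
  then obtain q where q: "q @ (u # p) \<in> set (rim n (Suc e) (s + e - r) tgt (v # b) (remove1 d orig) (see v b R) (u # p))"
    "map set q = rev (map U [Suc k..<9])" by blast
  have "(q @ [u]) @ p \<in> set (rim (Suc n) e s tgt u orig R p)"
  proof (rule rim_SucI)
    show "v \<in> set tgt" "v \<notin> set u" using pr dv by simp_all
    show "d \<in> set orig" using pr(8) dv(4) by blast
    show "length (filter (seen R v) u) \<le> Suc (s + e)" using r bud by simp
    show "length (remove1 d (filter (seen R v) u)) \<le> s + e" using bud(1) unfolding r_def .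
    show "length (filter (\<lambda>x. x \<notin> set (v # remove1 d u)) tgt) \<le> Suc n"
      using length_target[of "Suc k" tgt "v # remove1 d u"] pr(1,6,7) vb unfolding b_def by simp
    show "(q @ [u]) @ p \<in> set (rim n (Suc e) (s + e - length (remove1 d (filter (seen R v) u))) tgt (v # remove1 d u)
      (remove1 d orig) (see v (remove1 d u) R) (u # p))" using q(1) unfolding b_def r_def by simp
  qed
  moreover have "map set (q @ [u]) = rev (map U [k..<9])" using q(2) pr(1,4) by (simp add: upt_conv_Cons)
  ultimately show ?case by blast
qed

end

section \<open>Completeness of the search on the spoke, up to relabelling\<close>

fun relabel :: "vertex \<Rightarrow> vertex \<Rightarrow> vertex \<Rightarrow> vertex \<Rightarrow> vertex" where
  "relabel x y z a1 = x" | "relabel x y z b1 = \<phi> x" | "relabel x y z c1 = \<phi> (\<phi> x)"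
| "relabel x y z a4 = y" | "relabel x y z b4 = \<phi> y" | "relabel x y z c4 = \<phi> (\<phi> y)"
| "relabel x y z a5 = z" | "relabel x y z b5 = \<phi> z" | "relabel x y z c5 = \<phi> (\<phi> z)"
| "relabel x y z v = v"

lemma commuting_relabel:
  assumes "\<And>v. relabel x' y' z' (relabel x y z v) = v" shows "commuting (relabel x y z)"
proof -
  have "inj (relabel x y z)" using assms by (rule inj_on_inverseI)
  then have "bij (relabel x y z)" by (simp add: bij_def finite_UNIV_inj_surj)
  moreover have "relabel x y z (\<phi> v) = \<phi> (relabel x y z v)" for v by (cases v) (simp_all add: phi3)
  ultimately show ?thesis unfolding commuting_def by simp
qed

lemma relabel_inverse:
  "relabel c1 a4 a5 (relabel b1 a4 a5 v) = v" "relabel b1 a4 a5 (relabel c1 a4 a5 v) = v"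
  "relabel a1 b4 a5 (relabel a1 c4 a5 v) = v" "relabel a1 c4 a5 (relabel a1 b4 a5 v) = v"
  "relabel a1 a4 b5 (relabel a1 a4 c5 v) = v" "relabel a1 a4 c5 (relabel a1 a4 b5 v) = v"
  "relabel a1 a5 a4 (relabel a1 a5 a4 v) = v"
  "relabel a1 b5 a4 (relabel a1 a5 c4 v) = v" "relabel a1 c5 a4 (relabel a1 a5 b4 v) = v"
  by (cases v; simp)+

definition known_fresh :: "vertex set \<Rightarrow> vertex list \<Rightarrow> bool" where
  "known_fresh K F \<longleftrightarrow> F = [a4, a5] \<and> K = {a1,b1,c1,a2,b2,c2,a3,b3,c3} \<or>
     F = [a5] \<and> K = {a1,b1,c1,a2,b2,c2,a3,b3,c3,a4,b4,c4} \<or> F = [] \<and> K = UNIV"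

lemma relabel_fresh:
  assumes "known_fresh K F" "v \<notin> K"
  shows "\<exists>f. commuting f \<and> (\<forall>x\<in>K. f x = x) \<and> F \<noteq> [] \<and> f v = hd F"
proof -
  note c = relabel_inverse[THEN commuting_relabel]
  consider "F = [a4, a5]" "K = {a1,b1,c1,a2,b2,c2,a3,b3,c3}" "v = a4 \<or> v = b4 \<or> v = c4 \<or> v = a5 \<or> v = b5 \<or> v = c5"
    | "F = [a5]" "K = {a1,b1,c1,a2,b2,c2,a3,b3,c3,a4,b4,c4}" "v = a5 \<or> v = b5 \<or> v = c5"
    using assms unfolding known_fresh_def by (cases v) auto
  then show ?thesis
  proof cases
    case 1
    show ?thesis
      using 1(3)
    proof (elim disjE)
      assume "v = a4" then show ?thesis using 1 commuting_id by (intro exI[of _ id]) simp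
    next
      assume "v = b4" then show ?thesis using 1 c(3) by (intro exI[of _ "relabel a1 c4 a5"]) simp
    next
      assume "v = c4" then show ?thesis using 1 c(4) by (intro exI[of _ "relabel a1 b4 a5"]) simp
    next
      assume "v = a5" then show ?thesis using 1 c(7) by (intro exI[of _ "relabel a1 a5 a4"]) simp
    next
      assume "v = b5" then show ?thesis using 1 c(8) by (intro exI[of _ "relabel a1 a5 c4"]) simp
    next
      assume "v = c5" then show ?thesis using 1 c(9) by (intro exI[of _ "relabel a1 a5 b4"]) simp
    qed
  next
    case 2
    show ?thesis
      using 2(3)
    proof (elim disjE)
      assume "v = a5" then show ?thesis using 2 commuting_id by (intro exI[of _ id]) simp
    next
      assume "v = b5" then show ?thesis using 2 c(5) by (intro exI[of _ "relabel a1 a4 c5"]) simp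
    next
      assume "v = c5" then show ?thesis using 2 c(6) by (intro exI[of _ "relabel a1 a4 b5"]) simp
    qed
  qed
qed

text \<open>The orbits come into use in a fixed order, so \<open>known_fresh\<close> has only three
  states; a fresh name is never already in use.\<close>

lemma known_fresh_disjoint: "known_fresh K F \<Longrightarrow> x \<in> set F \<Longrightarrow> x \<notin> K"
  by (auto simp: known_fresh_def)

lemma known_fresh_step:
  assumes "known_fresh (set known) F" "v \<in> set known \<or> F \<noteq> [] \<and> v = hd F"
  shows "known_fresh (set (if v \<in> set known then known else [v, \<phi> v, \<phi> (\<phi> v)] @ known)) (remove1 v F)"
proof (cases "v \<in> set known")
  case True
  then have "v \<notin> set F" using known_fresh_disjoint[OF assms(1)] by blast
  then have "remove1 v F = F" by (rule remove1_idem)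
  then show ?thesis using assms(1) True by simp
next
  case False
  then have F: "F \<noteq> []" "v = hd F" using assms(2) by auto
  have "F = [a4, a5] \<and> set known = {a1,b1,c1,a2,b2,c2,a3,b3,c3} \<or>
      F = [a5] \<and> set known = {a1,b1,c1,a2,b2,c2,a3,b3,c3,a4,b4,c4}"
    using assms(1) F(1) unfolding known_fresh_def by metis
  then show ?thesis
  proof (elim disjE conjE)
    assume e: "F = [a4, a5]" "set known = {a1,b1,c1,a2,b2,c2,a3,b3,c3}"
    then have "set ([v, \<phi> v, \<phi> (\<phi> v)] @ known) = {a1,b1,c1,a2,b2,c2,a3,b3,c3,a4,b4,c4}"
      using F(2) by (simp add: insert_commute)
    then show ?thesis using False e F(2) unfolding known_fresh_def by simp
  next
    assume e: "F = [a5]" "set known = {a1,b1,c1,a2,b2,c2,a3,b3,c3,a4,b4,c4}"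
    then have "set ([v, \<phi> v, \<phi> (\<phi> v)] @ known) = UNIV"
      using F(2) by (simp add: vertex_UNIV insert_commute)
    then show ?thesis using False e F(2) unfolding known_fresh_def by simp
  qed
qed

text \<open>A set that contains the whole first orbit does not notice a permutation of it. This is
  why the search may choose which vertex of that orbit is dropped first.\<close>

lemma relabel_first:
  assumes "{a1, b1, c1} \<subseteq> A" and f: "commuting f" "f ` {a1, b1, c1} \<subseteq> {a1, b1, c1}" "\<And>x. x \<notin> {a1, b1, c1} \<Longrightarrow> f x = x"
  shows "f ` A = A"
proof -
  have "f ` A \<subseteq> A"
  proof
    fix y assume "y \<in> f ` A"
    then obtain x where x: "x \<in> A" "y = f x" by blast
    show "y \<in> A"
    proof (cases "x \<in> {a1, b1, c1}")
      case True then show ?thesis using f(2) x assms(1) by blast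
    qed (use f(3) x in simp)
  qed
  moreover have "card (f ` A) = card A" using f(1) unfolding commuting_def bij_def
    by (intro card_image) (auto intro: inj_on_subset)
  ultimately show ?thesis by (simp add: card_subset_eq)
qed

lemma covered_cong: "(\<And>i. i \<le> k \<Longrightarrow> U' i = U i) \<Longrightarrow> covered U' k = covered U k"
  by (intro ext) (simp add: covered_def cong: conj_cong)

lemma repeats_cong: "(\<And>i. i \<le> Suc k \<Longrightarrow> U' i = U i) \<Longrightarrow> repeats U' k = repeats U k"
  using covered_cong[of k U' U] unfolding repeats_def by simp

lemma budget_cong:
  assumes "\<And>i. i \<le> k \<Longrightarrow> U' i = U i" shows "budget U' j k = budget U j k"
proof -
  have "(\<Sum>i<k. repeats U' i) = (\<Sum>i<k. repeats U i)"
    by (rule sum.cong[OF refl], rule repeats_cong) (use assms in simp)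
  then show ?thesis unfolding budget_def by simp
qed

text \<open>Each step may relabel what is still to come, so the induction varies the configuration
  too: its hypothesis is applied to the image under a map that keeps all facets found so far, and
  the relabellings are composed.\<close>

lemma spoke_complete:
  assumes "config U j" "3 \<le> j" "m + k = j" "n = 8 - j" "set u = U k" "distinct u" "distinct orig"
    "set orig = {x. \<forall>i\<le>k. x \<in> U i}" "\<And>i. i \<le> k \<Longrightarrow> U i \<subseteq> set known" "known_fresh (set known) F"
    "\<And>x y. seen R x y \<Longrightarrow> covered U k x y" "10 \<le> s + budget U j k"
  shows "\<exists>f q. commuting f \<and> (\<forall>i\<le>k. f ` U i = U i) \<and> q @ p \<in> set (spoke m n s known F u orig R p) \<and>
    map set q = rev (map (\<lambda>i. f ` U i) [k..<9])"
  using assms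
proof (induction m arbitrary: k u orig R s p U known F)
  case 0
  note pr = 0
  interpret config U j by (rule pr(1))
  have kj: "k = j" using pr by simp
  let ?t = "map \<phi> u"
  have t: "set ?t = U 9" "distinct ?t" using pr(5,6) U9 kj bij_phi
    by (auto simp: distinct_map bij_def intro: inj_on_subset)
  have "length (filter (\<lambda>x. x \<notin> set u) ?t) \<le> 9 - k"
    by (rule length_target[OF _ t(2,1) pr(5)]) (use kj j in simp)
  then have g: "length (filter (\<lambda>x. x \<notin> set u) ?t) \<le> Suc n" using pr(4) kj j by simp
  \<comment> \<open>With \<open>n = 8 - j\<close> the argument \<open>5 - n\<close> is
    \<open>j - 3\<close>, the number of forced repeats of the first rim step.\<close>
  have "\<exists>q. q @ p \<in> set (rim n (5 - n) s ?t u u R p) \<and> map set q = rev (map U [k..<9])"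
  proof (rule rim_complete)
    show "n + k = 8" "j \<le> k" "5 - n = k - 3" using pr(4) kj j pr(2) by simp_all
    show "x \<in> set u" if "\<And>i. j \<le> i \<Longrightarrow> i \<le> k \<Longrightarrow> x \<in> U i" for x using that[of k] pr(5) kj by simp
  qed (use pr t in simp_all)
  then obtain q where "q @ p \<in> set (rim n (5 - n) s ?t u u R p)" "map set q = rev (map U [k..<9])" by blast
  then show ?case using g commuting_id[unfolded id_def] by (intro exI[of _ "\<lambda>x. x"] exI[of _ q]) (simp add: Let_def)
next
  case (Suc m)
  note pr = Suc.prems
  interpret config U j by (rule pr(1))
  have k: "k < j" "k \<le> 7" and k8: "k \<le> 8" using pr(3) j by auto
  obtain d v where dv: "d \<in> U k" "v \<notin> U k" "U (Suc k) = insert v (U k - {d})" "\<forall>i\<le>k. d \<in> U i"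
    using step[OF k8] k(1) by blast
  have dorig: "d \<in> set orig" using pr(8) dv(4) by simp
  have Uk: "U k \<subseteq> set known" using pr(9) by simp
  \<comment> \<open>\<open>f1\<close> gives the added vertex the name that the search tries.\<close>
  obtain f1 where f1: "commuting f1" "\<forall>x\<in>set known. f1 x = x" "f1 v \<in> set (take 1 F @ filter (\<lambda>x. x \<notin> set u) known)"
    "f1 v \<in> set known \<or> F \<noteq> [] \<and> f1 v = hd F" "f1 v \<in> set known \<longrightarrow> f1 v = v"
  proof (cases "v \<in> set known")
    case True
    then show thesis using that[of id] commuting_id dv(2) pr(5) by simp
  next
    case False
    then obtain f where f: "commuting f" "\<forall>x\<in>set known. f x = x" "F \<noteq> []" "f v = hd F"
      using relabel_fresh[OF pr(10)] by blast
    have "hd F \<notin> set known" using known_fresh_disjoint[OF pr(10)] f(3) by simp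
    moreover have "hd F \<in> set (take 1 F)" using f(3) by (cases F) simp_all
    ultimately show thesis using that[OF f(1,2)] f by simp
  qed
  \<comment> \<open>As long as the whole first orbit is present, the added vertex is outside it and
    not affected by rotating this orbit.\<close>
  have v1: "f1 v \<notin> {a1, b1, c1} \<or> \<not> {a1, b1, c1} \<subseteq> set orig"
  proof (rule ccontr)
    assume "\<not> ?thesis"
    then have a: "f1 v \<in> {a1, b1, c1}" "{a1, b1, c1} \<subseteq> set orig" by auto
    then have "f1 v \<in> U k" using pr(8) by auto
    moreover then have "f1 v = v" using f1(5) Uk by blast
    ultimately show False using dv(2) by simp
  qed
  \<comment> \<open>\<open>f2\<close> rotates the first orbit such that a vertex dropped from it
    becomes \<open>c1\<close>.\<close>
  obtain f2 where f2: "commuting f2" "\<And>i. i \<le> k \<Longrightarrow> f2 ` U i = U i" "f2 (f1 v) = f1 v"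
    "f2 d \<in> set (if {a1,b1,c1} \<subseteq> set orig then filter (\<lambda>x. x \<noteq> a1 \<and> x \<noteq> b1) orig else orig)"
  proof (cases "{a1,b1,c1} \<subseteq> set orig \<and> (d = a1 \<or> d = b1)")
    case True
    define f where "f = relabel (if d = a1 then c1 else b1) a4 a5"
    have c: "commuting f" unfolding f_def using relabel_inverse(1,2)[THEN commuting_relabel] by simp
    have fx: "f x = x" if "x \<notin> {a1, b1, c1}" for x using that unfolding f_def by (cases x) simp_all
    have fi: "f ` {a1, b1, c1} \<subseteq> {a1, b1, c1}" "f d = c1" unfolding f_def using True by auto
    have "f ` U i = U i" if "i \<le> k" for i
      by (rule relabel_first[OF _ c fi(1) fx]) (use True pr(8) that in auto)
    moreover have "f (f1 v) = f1 v" using fx v1 True by blast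
    moreover have "f d \<in> set (filter (\<lambda>x. x \<noteq> a1 \<and> x \<noteq> b1) orig)" using True fi(2) by simp
    ultimately show thesis using that[OF c] True by simp
  next
    case False
    then show thesis using that[OF commuting_id] dorig by auto
  qed
  define f where "f = f2 \<circ> f1"
  define U' where "U' = (\<lambda>i. f ` U i)"
  have cf: "commuting f" unfolding f_def by (rule commuting_comp[OF f2(1) f1(1)])
  have fU: "U' i = U i" if "i \<le> k" for i
  proof -
    have "f1 ` U i = id ` U i" by (rule image_cong[OF refl]) (use pr(9)[OF that] f1(2) in auto)
    then show ?thesis unfolding U'_def f_def image_comp[symmetric] using f2(2)[OF that] by simp
  qed
  have fd: "f d = f2 d" unfolding f_def using f1(2) dv(1) Uk by auto
  have fv: "f v = f1 v" unfolding f_def using f2(3) by simp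
  have cU: "config U' j" unfolding U'_def by (rule config_image[OF cf pr(1)])
  have inj: "inj f" using cf unfolding commuting_def bij_def by simp
  have fdU: "f d \<in> U k" using fU[of k] dv(1) unfolding U'_def by blast
  have fvU: "f v \<notin> U k" using fU[of k] dv(2) inj_image_mem_iff[OF inj] unfolding U'_def by blast
  have U'S: "U' (Suc k) = insert (f v) (U k - {f d})"
    unfolding U'_def dv(3) image_insert image_set_diff[OF inj] using fU[of k] unfolding U'_def by simp
  have S': "U' (Suc k) = insert (f v) (U' k - {f d})" "f d \<in> U' k" "f v \<notin> U' k" using U'S fdU fvU fU[of k] by simp_all
  have covU: "covered U' k = covered U k" by (rule covered_cong) (rule fU)
  have budU: "budget U' j k = budget U j k" by (rule budget_cong) (rule fU)
  interpret C: config U' j by (rule cU)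
  define b where "b = remove1 (f d) u"
  define r where "r = length (remove1 (f d) (filter (seen R (f v)) u))"
  define known' where "known' = (if f v \<in> set known then known else [f v, \<phi> (f v), \<phi> (\<phi> (f v))] @ known)"
  have b: "set b = U k - {f d}" "distinct b" unfolding b_def using pr(5,6) by simp_all
  have u': "set u = U' k" using pr(5) fU[of k] by simp
  have R': "\<And>x y. seen R x y \<Longrightarrow> covered U' k x y" using pr(11) covU by simp
  have r: "r \<le> repeats U' k" "length (filter (seen R (f v)) u) \<le> Suc r"
    unfolding r_def by (rule C.repeats_filter[OF k8 u' pr(6) S'(2,3,1) R']; assumption)+
  have bud: "r \<le> s" "10 \<le> (s - r) + budget U' j (Suc k)"
    using C.repeats_budget[OF k(2) _ _ r(1), of s 0] pr(12) budU k(1) by simp_all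
  have "\<exists>f' q. commuting f' \<and> (\<forall>i\<le>Suc k. f' ` U' i = U' i) \<and>
      q @ (u # p) \<in> set (spoke m n (s - r) known' (remove1 (f v) F) (f v # b) (remove1 (f d) orig) (see (f v) b R) (u # p)) \<and>
      map set q = rev (map (\<lambda>i. f' ` U' i) [Suc k..<9])"
  proof (rule Suc.IH)
    show "config U' j" by (rule cU)
    show "3 \<le> j" "m + Suc k = j" "n = 8 - j" using pr by simp_all
    show "set (f v # b) = U' (Suc k)" using b U'S by simp
    show "distinct (f v # b)" using b fvU by simp
    show "distinct (remove1 (f d) orig)" using pr(7) by simp
    show "set (remove1 (f d) orig) = {x. \<forall>i\<le>Suc k. x \<in> U' i}"
    proof -
      have "x \<in> set orig - {f d} \<longleftrightarrow> (\<forall>i\<le>Suc k. x \<in> U' i)" for x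
      proof -
        have 1: "x \<in> set orig \<longleftrightarrow> (\<forall>i\<le>k. x \<in> U' i)" using pr(8) fU by simp
        have 2: "(\<forall>i\<le>Suc k. x \<in> U' i) \<longleftrightarrow> (\<forall>i\<le>k. x \<in> U' i) \<and> x \<in> U' (Suc k)" by (metis le_Suc_eq)
        have 3: "x \<in> U k" if "\<forall>i\<le>k. x \<in> U' i" using that fU[of k] by (metis order_refl)
        show ?thesis unfolding 2 U'S using 1 3 fvU by auto
      qed
      then show ?thesis using pr(7) by auto
    qed
    show "U' i \<subseteq> set known'" if "i \<le> Suc k" for i
    proof (cases "i = Suc k")
      case True
      then show ?thesis using U'S Uk unfolding known'_def by auto
    next
      case False
      then show ?thesis using that fU[of i] pr(9)[of i] unfolding known'_def by auto
    qed
    show "known_fresh (set known') (remove1 (f v) F)"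
      unfolding known'_def by (rule known_fresh_step[OF pr(10)]) (use f1(4) fv in simp)
    show "covered U' (Suc k) x y" if "seen (see (f v) b R) x y" for x y
      by (rule C.covered_Suc_see[OF R' _ _ that]) (use b fvU U'S in auto)
    show "10 \<le> (s - r) + budget U' j (Suc k)" by (rule bud)
  qed
  then obtain f' q where fq: "commuting f'" "\<forall>i\<le>Suc k. f' ` U' i = U' i"
    "q @ (u # p) \<in> set (spoke m n (s - r) known' (remove1 (f v) F) (f v # b) (remove1 (f d) orig) (see (f v) b R) (u # p))"
    "map set q = rev (map (\<lambda>i. f' ` U' i) [Suc k..<9])" by blast
  have ff: "(f' \<circ> f) ` U i = f' ` U' i" for i unfolding U'_def by (simp add: image_comp)
  have "(q @ [u]) @ p \<in> set (spoke (Suc m) n s known F u orig R p)"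
  proof (rule spoke_SucI)
    show "f v \<in> set (take 1 F @ filter (\<lambda>x. x \<notin> set u) known)" using f1(3) fv by simp
    show "length (filter (seen R (f v)) u) \<le> Suc s" using r bud by simp
    show "f d \<in> set (if {a1,b1,c1} \<subseteq> set orig then filter (\<lambda>x. x \<noteq> a1 \<and> x \<noteq> b1) orig else orig)" using f2(4) fd by simp
    show "length (remove1 (f d) (filter (seen R (f v)) u)) \<le> s" using bud(1) unfolding r_def .
    show "(q @ [u]) @ p \<in> set (spoke m n (s - length (remove1 (f d) (filter (seen R (f v)) u)))
      (if f v \<in> set known then known else [f v, \<phi> (f v), \<phi> (\<phi> (f v))] @ known) (remove1 (f v) F)
      (f v # remove1 (f d) u) (remove1 (f d) orig) (see (f v) (remove1 (f d) u) R) (u # p))"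
      using fq(3) unfolding b_def r_def known'_def by simp
  qed
  moreover have "map set (q @ [u]) = rev (map (\<lambda>i. (f' \<circ> f) ` U i) [k..<9])"
    unfolding ff using fq(2,4) u' k by (simp add: upt_conv_Cons)
  moreover have "\<forall>i\<le>k. (f' \<circ> f) ` U i = U i" unfolding ff using fq(2) fU by (metis le_SucI)
  ultimately show ?case using commuting_comp[OF fq(1) cf] by blast
qed

text \<open>The first step is the same up to symmetry: \<open>c2\<close> is replaced by \<open>a3\<close>.\<close>

definition start :: "nat \<Rightarrow> nat \<Rightarrow> vertex list list list" where
  "start j s = spoke (j - 1) (8 - j) s [a3,b3,c3,a1,b1,c1,a2,b2,c2] [a4,a5] [a3,a1,b1,c1,a2,b2]
    [a1,b1,c1,a2,b2] (see a3 [a1,b1,c1,a2,b2] (see c1 [a2] (see b1 [a2] (see a1 [b1,a2] (see a2 [b2] (Rows [] [] [] [] []))))))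
    [[c2,a1,b1,c1,a2,b2]]"

lemma covered_if_mem:
  assumes "v \<noteq> w" "i \<le> k" "v \<in> U i" "w \<in> U i" shows "covered U k v w"
proof -
  have "(\<phi> ^^ 0) v \<in> U i \<and> (\<phi> ^^ 0) w \<in> U i" using assms by simp
  then show ?thesis using assms unfolding covered_def by blast
qed

lemma start_complete:
  assumes c: "config U j" and j3: "3 \<le> j" and U0: "U 0 = {a1,b1,c1,a2,b2,c2}" and U1: "U 1 = {a3,a1,b1,c1,a2,b2}"
    and s: "10 \<le> s + (\<Sum>t\<in>{j..<8}. t - 3)"
  shows "\<exists>f q. commuting f \<and> q \<in> set (start j s) \<and> map set q = rev (map (\<lambda>i. f ` U i) [0..<9])"
proof -
  interpret config U j by (rule c)
  have cov: "covered U 1 v w" if "v \<noteq> w" "{v, w} \<subseteq> U 0 \<or> {v, w} \<subseteq> U 1" for v w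
    using that covered_if_mem[of v w 0 1 U] covered_if_mem[of v w 1 1 U] by auto
  have le1: "i \<le> 1 \<longleftrightarrow> i = 0 \<or> i = 1" for i :: nat by auto
  have sy: "covered U 1 y x" if "covered U 1 x y" for x y using that covered_sym by blast
  note see = seen_see[where C = "covered U 1", OF covered_phi]
  have none: "covered U 1 x y" if "seen (Rows [] [] [] [] []) x y" for x y
    using that unfolding seen_def by (cases x) simp_all
  \<comment> \<open>The initial rows hold the five orbits of pairs in \<open>U 0\<close>: one inside
    each of its two vertex orbits, and three between them, represented by the pairs of
    \<open>a2\<close> with \<open>a1\<close>, \<open>b1\<close> and \<open>c1\<close>. The pairs of
    \<open>a3\<close> follow last.\<close>
  have n1: "covered U 1 x y" if "seen (see a2 [b2] (Rows [] [] [] [] [])) x y" for x y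
  proof (rule see[OF _ none _ that], erule sy)
    show "covered U 1 a2 w" if "w \<in> set [b2]" for w
      by (rule cov) (use that U0 in auto)
  qed
  have n2: "covered U 1 x y" if "seen (see a1 [b1,a2] (see a2 [b2] (Rows [] [] [] [] []))) x y" for x y
  proof (rule see[OF _ n1 _ that], erule sy)
    show "covered U 1 a1 w" if "w \<in> set [b1,a2]" for w
      by (rule cov) (use that U0 in auto)
  qed
  have n3: "covered U 1 x y" if "seen (see b1 [a2] (see a1 [b1,a2] (see a2 [b2] (Rows [] [] [] [] [])))) x y" for x y
  proof (rule see[OF _ n2 _ that], erule sy)
    show "covered U 1 b1 w" if "w \<in> set [a2]" for w
      by (rule cov) (use that U0 in auto)
  qed
  have n4: "covered U 1 x y" if "seen (see c1 [a2] (see b1 [a2] (see a1 [b1,a2] (see a2 [b2] (Rows [] [] [] [] []))))) x y" for x y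
  proof (rule see[OF _ n3 _ that], erule sy)
    show "covered U 1 c1 w" if "w \<in> set [a2]" for w
      by (rule cov) (use that U0 in auto)
  qed
  have n5: "covered U 1 x y" if "seen (see a3 [a1,b1,c1,a2,b2] (see c1 [a2] (see b1 [a2] (see a1 [b1,a2] (see a2 [b2] (Rows [] [] [] [] [])))))) x y" for x y
  proof (rule see[OF _ n4 _ that], erule sy)
    show "covered U 1 a3 w" if "w \<in> set [a1,b1,c1,a2,b2]" for w
      by (rule cov) (use that U1 in auto)
  qed
  have "\<exists>f q. commuting f \<and> (\<forall>i\<le>1. f ` U i = U i) \<and> q @ [[c2,a1,b1,c1,a2,b2]] \<in> set (start j s) \<and>
    map set q = rev (map (\<lambda>i. f ` U i) [1..<9])"
    unfolding start_def
  proof (rule spoke_complete[OF c j3])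
    show "j - 1 + 1 = j" using j by simp
    show "8 - j = 8 - j" ..
    show "set [a3,a1,b1,c1,a2,b2] = U 1" using U1 by simp
    show "distinct [a3,a1,b1,c1,a2,b2]" "distinct [a1,b1,c1,a2,b2]" by simp_all
    show "set [a1,b1,c1,a2,b2] = {x. \<forall>i\<le>1. x \<in> U i}" unfolding le1 using U0 U1 by auto
    show "U i \<subseteq> set [a3,b3,c3,a1,b1,c1,a2,b2,c2]" if "i \<le> 1" for i using that U0 U1 unfolding le1 by auto
    show "known_fresh (set [a3,b3,c3,a1,b1,c1,a2,b2,c2]) [a4,a5]" by (simp add: known_fresh_def insert_commute)
    show "10 \<le> s + budget U j 1" using s j unfolding budget_def by (simp add: max_absorb1)
  qed (rule n5)
  then obtain f q where fq: "commuting f" "f ` U 0 = U 0" "q @ [[c2,a1,b1,c1,a2,b2]] \<in> set (start j s)"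
    "map set q = rev (map (\<lambda>i. f ` U i) [1..<9])" by blast
  have "set [c2,a1,b1,c1,a2,b2] = f ` U 0" using fq(2) U0 by auto
  then have "map set (q @ [[c2,a1,b1,c1,a2,b2]]) = rev (map (\<lambda>i. f ` U i) [0..<9])"
    using fq(4) by (simp add: upt_conv_Cons[of 0])
  then show ?thesis using fq by blast
qed

section \<open>The search results\<close>

text \<open>The representatives as lists, on which membership and equality of sets can be decided by
  rewriting.\<close>

definition orbit_reps :: "vertex list list list" where
  "orbit_reps =
    [[[a1,b1,c1,a2,b2,a3],[a1,b1,a2,b2,a3,a4],[a1,a2,b2,a3,a4,a5],[a1,a2,a3,a4,b4,a5],
      [a1,a3,a4,b4,a5,b5],[a3,b3,a4,b4,a5,b5],[c2,a3,b3,b4,a5,b5],[b1,c2,b3,b4,a5,b5]],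
     [[a1,b1,c1,a2,b2,a3],[a1,b1,a2,b2,a3,a4],[a1,a2,b2,a3,a4,a5],[a1,a2,a3,a4,b4,a5],
      [a1,a2,a3,b4,a5,b5],[a2,a3,b3,b4,a5,b5],[a3,b3,b4,c4,a5,b5],[b1,b3,b4,c4,a5,b5]],
     [[a1,b1,c1,a2,b2,a3],[a1,b1,a2,b2,a3,a4],[a1,b1,a2,a3,a4,a5],[a1,a2,a3,a4,b4,a5],
      [a1,a2,a3,b4,a5,b5],[a2,a3,b3,b4,a5,b5],[a3,b3,b4,c4,a5,b5],[b2,b3,b4,c4,a5,b5]],
     [[a1,b1,c1,a2,b2,a3],[a1,b1,a2,b2,a3,a4],[a1,b1,a2,a3,a4,a5],[b1,a2,a3,a4,a5,c5],
      [a2,a3,b3,a4,a5,c5],[a2,a3,b3,a4,b4,a5],[a2,b3,a4,b4,a5,b5],[c1,b3,a4,b4,a5,b5]],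
     [[a1,b1,c1,a2,b2,a3],[a1,b1,c1,a2,a3,a4],[a1,b1,a2,a3,a4,a5],[a1,a2,a3,a4,a5,b5],
      [a2,a3,a4,b4,a5,b5],[a2,a3,b3,b4,a5,b5],[a2,a3,b3,b4,c4,b5],[a2,b3,b4,c4,b5,c5]],
     [[a1,b1,c1,a2,b2,a3],[a1,b1,c1,a2,a3,a4],[a1,b1,a2,a3,a4,a5],[a1,a2,a3,a4,a5,b5],
      [a2,a3,a4,b4,a5,b5],[a2,a3,b3,a4,b4,b5],[a2,a3,b3,b4,b5,c5],[a2,b3,b4,c4,b5,c5]],
     [[a1,b1,c1,a2,b2,a3],[a1,b1,c1,a2,a3,a4],[a1,b1,a2,a3,a4,a5],[b1,a2,a3,a4,a5,c5],
      [a2,a3,a4,b4,a5,c5],[a2,a3,b3,b4,a5,c5],[a2,a3,b3,b4,c4,a5],[a2,b3,b4,c4,a5,b5]],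
     [[a1,b1,c1,a2,b2,a3],[a1,b1,c1,a2,a3,a4],[a1,b1,a2,a3,a4,a5],[b1,a2,a3,a4,a5,c5],
      [a2,a3,a4,b4,a5,c5],[a2,a3,b3,a4,b4,a5],[a2,a3,b3,b4,a5,b5],[a2,b3,b4,c4,a5,b5]],
     [[a1,b1,c1,a2,b2,a3],[a1,b1,c1,a2,a3,a4],[a1,b1,a2,a3,a4,a5],[a1,a2,a3,a4,a5,b5],
      [a2,a3,a4,c4,a5,b5],[a2,a3,b3,a4,c4,b5],[a2,a3,b3,a4,b5,c5],[a2,b3,a4,b4,b5,c5]],
     [[a1,b1,c1,a2,b2,a3],[a1,b1,c1,a2,a3,a4],[a1,b1,a2,a3,a4,a5],[b1,a2,a3,a4,a5,c5],
      [a2,a3,a4,c4,a5,c5],[a2,a3,b3,a4,c4,a5],[a2,a3,b3,a4,a5,b5],[a2,b3,a4,b4,a5,b5]],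
     [[a1,b1,c1,a2,b2,a3],[a1,b1,c1,a2,a3,a4],[a1,b1,a2,a3,a4,a5],[a1,a2,a3,a4,a5,b5],
      [a2,a3,b3,a4,a5,b5],[a2,b3,a4,b4,a5,b5],[b2,b3,a4,b4,a5,b5],[b2,b3,c3,a4,b4,b5]],
     [[a1,b1,c1,a2,b2,a3],[a1,b1,c1,a2,a3,a4],[a1,b1,a2,a3,a4,a5],[b1,a2,a3,a4,a5,c5],
      [a2,a3,b3,a4,a5,c5],[a2,b3,a4,b4,a5,c5],[b2,b3,a4,b4,a5,c5],[b2,b3,c3,a4,b4,a5]]]"

lemma facet_orbit_reps_eq: "facet_orbit_reps = map (map set) orbit_reps"
  by (simp add: facet_orbit_reps_def orbit_reps_def)

definition orbit_lists :: "vertex list list \<Rightarrow> vertex list list" where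
  "orbit_lists us = concat (map (\<lambda>u. [u, map \<phi> u, map \<phi> (map \<phi> u)]) us)"

definition N_lists :: "nat \<Rightarrow> vertex list list" where
  "N_lists i = [a1,b1,c1,a2,b2,c2] # orbit_lists (orbit_reps ! (i - 1))"

lemma set_orbit_lists: "set ` set (orbit_lists us) = (\<Union>u\<in>set (map set us). {u, \<phi> ` u, \<phi> ` \<phi> ` u})"
  unfolding orbit_lists_def by (induction us) (simp_all add: image_image)

lemma set_N_lists: assumes "i \<in> {1..12}" shows "set ` set (N_lists i) = N_facets i"
proof -
  have "i - 1 < length orbit_reps" using assms by (auto simp: orbit_reps_def)
  then have "facet_orbit_reps ! (i - 1) = map set (orbit_reps ! (i - 1))" unfolding facet_orbit_reps_eq by simp
  then show ?thesis unfolding N_lists_def N_facets_def by (simp add: set_orbit_lists del: set_map)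
qed

definition same_set :: "vertex list \<Rightarrow> vertex list \<Rightarrow> bool" where
  "same_set xs ys \<longleftrightarrow> list_all (\<lambda>x. x \<in> set ys) xs \<and> list_all (\<lambda>y. y \<in> set xs) ys"

lemma same_set_iff: "same_set xs ys \<longleftrightarrow> set xs = set ys"
  unfolding same_set_def list_all_iff by auto

text \<open>Each of the twelve complexes is found twice, since \<open>\<phi>\<close> and its inverse generate the same group.
  The following involution conjugates one into the other.\<close>

fun reflection :: "vertex \<Rightarrow> vertex" where
  "reflection a1 = a1" | "reflection b1 = c1" | "reflection c1 = b1"
| "reflection a2 = a2" | "reflection b2 = c2" | "reflection c2 = b2"
| "reflection a3 = c3" | "reflection b3 = b3" | "reflection c3 = a3"
| "reflection a4 = c4" | "reflection b4 = b4" | "reflection c4 = a4"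
| "reflection a5 = c5" | "reflection b5 = b5" | "reflection c5 = a5"

lemma inj_reflection: "inj reflection"
proof (rule inj_on_inverseI)
  show "reflection (reflection v) = v" for v by (cases v) simp_all
qed

definition matches :: "vertex list list \<Rightarrow> (vertex \<Rightarrow> vertex) \<Rightarrow> nat \<Rightarrow> bool" where
  "matches L f i \<longleftrightarrow> (let N = N_lists i; M = map (map f) L in
     list_all (\<lambda>x. list_ex (same_set x) N) M \<and> list_all (\<lambda>y. list_ex (same_set y) M) N)"

text \<open>A candidate may satisfy all counts and still contain two facets that share five vertices
  without being neighbours on the path. Away from the branch facet this contradicts degree
  two.\<close>

definition extra_adjacency :: "nat \<Rightarrow> vertex list list \<Rightarrow> bool" where
  "extra_adjacency j L \<longleftrightarrow> list_ex (\<lambda>k. k \<noteq> j \<and> list_ex (\<lambda>i. list_ex (\<lambda>f. let x = map f (L ! i) in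
     length (remdups (filter (\<lambda>v. v \<in> set x) (L ! k))) = 5 \<and> \<not> same_set x (L ! (k - 1)) \<and> \<not> same_set x (L ! Suc k))
     [\<lambda>v. v, \<phi>, \<lambda>v. \<phi> (\<phi> v)]) [0..<9]) [1..<9]"

text \<open>Results have the newest facet first. So \<open>last q\<close> is the invariant facet,
  the only one that is not rotated, and \<open>rev q\<close> is completed by the rotated branch
  facet in position 9.\<close>

definition accepted :: "nat \<Rightarrow> vertex list list \<Rightarrow> bool" where
  "accepted j q \<longleftrightarrow> extra_adjacency j (rev q @ [map \<phi> (rev q ! j)]) \<or>
     list_ex (\<lambda>f. list_ex (matches (last q # orbit_lists (butlast q)) f) [1..<13]) [\<lambda>v. v, reflection]"

text \<open>The second argument of \<open>start\<close> is 10 minus the forced repeats, which are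
  the sum of \<open>t - 3\<close> for \<open>t\<close> from \<open>j\<close> to 7.\<close>

lemma accepted_3: "list_all (accepted 3) (start 3 0)" by code_simp

lemma accepted_4: "list_all (accepted 4) (start 4 0)" by code_simp

lemma accepted_5: "list_all (accepted 5) (start 5 1)" by code_simp

lemma accepted_6: "list_all (accepted 6) (start 6 3)" by code_simp

lemma not_extra_adjacency:
  assumes c: "config V j" and q: "map set q = rev (map V [0..<9])"
  shows "\<not> extra_adjacency j (rev q @ [map \<phi> (rev q ! j)])"
proof
  interpret config V j by (rule c)
  define L where "L = rev q @ [map \<phi> (rev q ! j)]"
  have mm: "map set (rev q) = map V [0..<9]" using arg_cong[OF q, of rev] by (simp add: rev_map[symmetric])
  have l9: "length (rev q) = 9" using arg_cong[OF mm, of length] by simp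
  have m: "set (rev q ! i) = V i" if i: "i < 9" for i
  proof -
    have "set (rev q ! i) = map set (rev q) ! i" by (rule nth_map[symmetric]) (use i l9 in simp)
    also have "\<dots> = V i" unfolding mm using i by simp
    finally show ?thesis .
  qed
  have L: "set (L ! i) = V i" if "i \<le> 9" for i
  proof (cases "i = 9")
    case True
    then have "L ! i = map \<phi> (rev q ! j)" unfolding L_def using l9 by (metis nth_append_length)
    then show ?thesis using True U9 m[of j] j by simp
  next
    case False
    then have i: "i < 9" using that by simp
    then have "L ! i = rev q ! i" unfolding L_def using l9 by (simp add: nth_append)
    then show ?thesis using m[OF i] by simp
  qed
  assume "extra_adjacency j (rev q @ [map \<phi> (rev q ! j)])"
  then obtain k i f where k: "k \<in> set [1..<9]" "k \<noteq> j" "i \<in> set [0..<9]" "f \<in> set [\<lambda>v. v, \<phi>, \<lambda>v. \<phi> (\<phi> v)]"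
    and a: "length (remdups (filter (\<lambda>v. v \<in> set (map f (L ! i))) (L ! k))) = 5"
      "\<not> same_set (map f (L ! i)) (L ! (k - 1))" "\<not> same_set (map f (L ! i)) (L ! Suc k)"
    unfolding extra_adjacency_def L_def[symmetric] Let_def list_ex_iff by blast
  have k': "1 \<le> k" "k \<le> 8" "i \<le> 8" using k by auto
  obtain s where s: "f = \<phi> ^^ s"
  proof -
    have "(\<lambda>v. v) = \<phi> ^^ 0" "\<phi> = \<phi> ^^ 1" "(\<lambda>v. \<phi> (\<phi> v)) = \<phi> ^^ 2" by (simp_all add: fun_eq_iff numeral_2_eq_2)
    then show thesis using k(4) that by (metis empty_iff insert_iff list.set)
  qed
  have "set (filter (\<lambda>v. v \<in> set (map f (L ! i))) (L ! k)) = V k \<inter> (\<phi> ^^ s) ` V i"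
    using L[of i] L[of k] k' unfolding s by auto
  then have "card (V k \<inter> (\<phi> ^^ s) ` V i) = 5" using a(1) by (simp only: length_remdups_card_conv)
  then have "(\<phi> ^^ s) ` V i = V (k - 1) \<or> (\<phi> ^^ s) ` V i = V (Suc k)" using nbs[OF k'(1,2) k(2) k'(3)] by blast
  then show False using a(2,3) L[of i] L[of "k - 1"] L[of "Suc k"] k' unfolding same_set_iff s by simp
qed

lemma matches_image:
  assumes "matches L f i" "i \<in> {1..12}"
  shows "(`) f ` set ` set L = N_facets i"
proof -
  have m: "\<forall>x\<in>set (map (map f) L). \<exists>y\<in>set (N_lists i). set x = set y"
    "\<forall>y\<in>set (N_lists i). \<exists>x\<in>set (map (map f) L). set y = set x"
    using assms(1) unfolding matches_def Let_def list_all_iff list_ex_iff same_set_iff by blast+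
  then have "set ` set (map (map f) L) = set ` set (N_lists i)" by (auto simp: image_iff)
  moreover have "set ` set (map (map f) L) = (`) f ` set ` set L" by (simp add: image_image)
  ultimately show ?thesis using set_N_lists[OF assms(2)] by simp
qed

lemma config_classification:
  assumes c: "config U j" and j3: "3 \<le> j" and U0: "U 0 = {a1,b1,c1,a2,b2,c2}" and U1: "U 1 = {a3,a1,b1,c1,a2,b2}"
  shows "\<exists>i\<in>{1..12}. \<exists>f. inj f \<and>
    (`) f ` insert (U 0) (\<Union>k\<in>{1..8}. {U k, \<phi> ` U k, \<phi> ` \<phi> ` U k}) = N_facets i"
proof -
  interpret config U j by (rule c)
  have j36: "j = 3 \<or> j = 4 \<or> j = 5 \<or> j = 6" using j j3 by auto
  have sums: "(\<Sum>t\<in>{3..<8}. t - 3) = (10::nat)" "(\<Sum>t\<in>{4..<8}. t - 3) = (10::nat)"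
    "(\<Sum>t\<in>{5..<8}. t - 3) = (9::nat)" "(\<Sum>t\<in>{6..<8}. t - 3) = (7::nat)"
    by (simp_all add: eval_nat_numeral)
  from j36 obtain s where s: "10 \<le> s + (\<Sum>t\<in>{j..<8}. t - 3)" "list_all (accepted j) (start j s)"
  proof (elim disjE)
    assume e: "j = 3"
    show thesis by (rule that[of 0]; unfold e sums) (simp, rule accepted_3)
  next
    assume e: "j = 4"
    show thesis by (rule that[of 0]; unfold e sums) (simp, rule accepted_4)
  next
    assume e: "j = 5"
    show thesis by (rule that[of 1]; unfold e sums) (simp, rule accepted_5)
  next
    assume e: "j = 6"
    show thesis by (rule that[of 3]; unfold e sums) (simp, rule accepted_6)
  qed
  obtain f q where f: "commuting f" and q: "q \<in> set (start j s)" "map set q = rev (map (\<lambda>i. f ` U i) [0..<9])"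
    using start_complete[OF c j3 U0 U1 s(1)] by blast
  define V where "V = (\<lambda>i. f ` U i)"
  have cV: "config V j" unfolding V_def by (rule config_image[OF f c])
  have qV: "map set q = rev (map V [0..<9])" using q(2) unfolding V_def .
  have "accepted j q" using s(2) q(1) unfolding list_all_iff by blast
  then obtain h i where hi: "h \<in> set [\<lambda>v. v, reflection]" "i \<in> set [1..<13]" "matches (last q # orbit_lists (butlast q)) h i"
    using not_extra_adjacency[OF cV qV] unfolding accepted_def list_ex_iff by blast
  have "i \<in> {1..12}" using hi(2) by auto
  then have ih: "i \<in> {1..12}" "inj h" "(`) h ` set ` set (last q # orbit_lists (butlast q)) = N_facets i"
    using hi(1) inj_reflection matches_image[OF hi(3)] by auto
  have sp: "map set q = rev (map V [1..<9]) @ [V 0]" unfolding qV by (simp add: upt_conv_Cons)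
  then have "q \<noteq> []" by auto
  then have "set (last q) = V 0" using sp by (metis last_map last_snoc)
  moreover have "map set (butlast q) = rev (map V [1..<9])" using sp by (metis butlast_snoc map_butlast)
  ultimately have "set ` set (last q # orbit_lists (butlast q)) = insert (V 0) (\<Union>u\<in>V ` {1..8}. {u, \<phi> ` u, \<phi> ` \<phi> ` u})"
    by (simp only: list.set image_insert set_orbit_lists set_rev set_map set_upt) (simp add: atLeastLessThanSuc_atLeastAtMost[symmetric] eval_nat_numeral)
  also have "\<dots> = (`) f ` insert (U 0) (\<Union>k\<in>{1..8}. {U k, \<phi> ` U k, \<phi> ` \<phi> ` U k})"
  proof -
    have "\<phi> ` f ` A = f ` \<phi> ` A" for A using f unfolding commuting_def by (simp add: image_image)
    then show ?thesis unfolding V_def by (simp add: image_UN)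
  qed
  finally have "(`) (h \<circ> f) ` insert (U 0) (\<Union>k\<in>{1..8}. {U k, \<phi> ` U k, \<phi> ` \<phi> ` U k}) = N_facets i"
    using ih(3) by (simp add: image_comp)
  moreover have "inj (h \<circ> f)" using ih(2) f unfolding commuting_def bij_def by (simp add: inj_compose)
  ultimately show ?thesis using ih(1) by blast
qed

section \<open>From complexes to the search\<close>

text \<open>The facets of the link of \<open>v\<close> are the facets through \<open>v\<close>
  without \<open>v\<close>. Hence intersections shrink by exactly one vertex, and the properties of
  stacked 4-balls carry over to stars.\<close>

lemma facet_system_facets:
  fixes N :: "'a set set"
  assumes fc: "fin_complex N" and links: "\<forall>x\<in>\<Union>N. stacked_ball 4 (vertex_link x N)"
    and nbl: "neighborly N" and c15: "card (\<Union>N) = 15"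
  shows "facet_system (\<Union>N) (facets N)" "\<And>\<sigma>. \<sigma> \<in> N \<Longrightarrow> \<exists>F\<in>facets N. \<sigma> \<subseteq> F"
proof -
  have sub: "\<And>\<sigma> \<tau>. \<sigma> \<in> N \<Longrightarrow> \<tau> \<subseteq> \<sigma> \<Longrightarrow> \<tau> \<in> N" and finN: "finite N" and fins: "\<And>\<sigma>. \<sigma> \<in> N \<Longrightarrow> finite \<sigma>"
    using fc unfolding fin_complex_def by auto
  have edge: "\<And>x y. x \<in> \<Union>N \<Longrightarrow> y \<in> \<Union>N \<Longrightarrow> x \<noteq> y \<Longrightarrow> {x, y} \<in> N"
    by (rule nbl[unfolded neighborly_def, rule_format])
  have FN: "facets N \<subseteq> N" unfolding facets_def by auto
  define st where "st = (\<lambda>v. {F \<in> facets N. v \<in> F})"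
  define lk where "lk = (\<lambda>v. facets (vertex_link v N))"
  have lk: "lk v = (\<lambda>F. F - {v}) ` st v" if "v \<in> \<Union>N" for v
    unfolding lk_def st_def by (rule facets_vertex_link[OF fc that])
  have lkst: "F - {v} \<in> lk v" if "v \<in> \<Union>N" "F \<in> st v" for F v using lk that by blast
  have inj: "inj_on (\<lambda>F. F - {v}) (st v)" for v
    unfolding inj_on_def st_def by (metis (no_types, lifting) insert_Diff mem_Collect_eq)
  \<comment> \<open>By neighborliness every link has all 14 other vertices.\<close>
  have vl: "\<Union>(vertex_link v N) = \<Union>N - {v}" if v: "v \<in> \<Union>N" for v
  proof
    show "\<Union>(vertex_link v N) \<subseteq> \<Union>N - {v}" unfolding vertex_link_def by auto
    show "\<Union>N - {v} \<subseteq> \<Union>(vertex_link v N)"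
    proof
      fix w assume w: "w \<in> \<Union>N - {v}"
      then have wv: "w \<in> \<Union>N" "v \<noteq> w" by auto
      have vw: "{v, w} \<in> N" by (rule edge[OF v wv])
      then have wN: "{w} \<in> N" by (rule sub) simp
      then have "{w} \<in> vertex_link v N" using vw wv unfolding vertex_link_def by simp
      then show "w \<in> \<Union>(vertex_link v N)" by blast
    qed
  qed
  have finU: "finite (\<Union>N)" using finN fins by auto
  note sb = stacked_ball_facets[OF bspec[OF links]]
  have lk_card: "\<forall>\<sigma>\<in>lk v. card \<sigma> = 4 + 1" if "v \<in> \<Union>N" for v
    using sb[OF that] unfolding lk_def by (elim conjE)
  have lk_size: "card (lk v) + 4 = card (\<Union>(vertex_link v N))" if "v \<in> \<Union>N" for v
    using sb[OF that] unfolding lk_def by (elim conjE)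
  have lk_pairs: "card (adjacent_pairs 4 (lk v)) + 2 = 2 * card (lk v)" if "v \<in> \<Union>N" for v
    using sb[OF that] unfolding lk_def by (elim conjE)
  have lk_conn: "\<forall>A\<subseteq>lk v. A \<noteq> {} \<longrightarrow> (\<forall>F\<in>A. \<forall>G\<in>lk v. card (F \<inter> G) = 4 \<longrightarrow> G \<in> A) \<longrightarrow> A = lk v" if "v \<in> \<Union>N" for v
    using sb[OF that] unfolding lk_def by (elim conjE)
  have lk_thin: "\<forall>F\<in>lk v. \<forall>G\<in>lk v. \<forall>H\<in>lk v. 4 \<le> card (F \<inter> G \<inter> H) \<longrightarrow> F = G \<or> G = H \<or> F = H" if "v \<in> \<Union>N" for v
    using sb[OF that] unfolding lk_def by (elim conjE)
  have card_st: "card (st v) = 10" if v: "v \<in> \<Union>N" for v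
  proof -
    have "card (lk v) + 4 = card (\<Union>N - {v})" using lk_size[OF v] vl[OF v] by simp
    then have "card (lk v) = 10" using c15 finU v by simp
    then show ?thesis using lk[OF v] card_image[OF inj] by simp
  qed
  have card_F: "card F = 6" if v: "v \<in> \<Union>N" and F: "F \<in> st v" for F v
  proof -
    have "card (F - {v}) = 4 + 1" using lk_card[OF v] lkst[OF v F] by (rule bspec)
    moreover have "v \<in> F" "finite F" using F FN fins unfolding st_def by auto
    ultimately show ?thesis using card_Suc_Diff1[of F v] by simp
  qed
  have card_int: "card (F \<inter> G) = 5 \<longleftrightarrow> card ((F - {v}) \<inter> (G - {v})) = 4" if F: "F \<in> st v" "G \<in> st v" for F G v
  proof -
    have "F \<inter> G = insert v ((F - {v}) \<inter> (G - {v}))" using F unfolding st_def by auto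
    moreover have "finite ((F - {v}) \<inter> (G - {v}))" using F FN fins unfolding st_def by auto
    ultimately show ?thesis by simp
  qed
  have ext: "\<exists>F\<in>facets N. \<sigma> \<subseteq> F" if s: "\<sigma> \<in> N" for \<sigma>
  proof -
    have "finite {\<tau> \<in> N. \<sigma> \<subseteq> \<tau>}" "{\<tau> \<in> N. \<sigma> \<subseteq> \<tau>} \<noteq> {}" using finN s by auto
    then obtain F where F: "F \<in> {\<tau> \<in> N. \<sigma> \<subseteq> \<tau>}" "\<forall>\<tau>\<in>{\<tau> \<in> N. \<sigma> \<subseteq> \<tau>}. F \<subseteq> \<tau> \<longrightarrow> \<tau> = F"
      using finite_has_maximal[of "{\<tau> \<in> N. \<sigma> \<subseteq> \<tau>}"] by metis
    then have "F \<in> facets N" unfolding facets_def by auto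
    then show ?thesis using F by auto
  qed
  then show "\<And>\<sigma>. \<sigma> \<in> N \<Longrightarrow> \<exists>F\<in>facets N. \<sigma> \<subseteq> F" .
  \<comment> \<open>The empty face is not maximal, as the complex has vertices.\<close>
  have F_ne: "\<exists>v. v \<in> F" if F: "F \<in> facets N" for F
  proof (rule ccontr)
    assume "\<nexists>v. v \<in> F"
    then have "F = {}" by auto
    obtain x where "x \<in> \<Union>N" using c15 by (metis card.empty ex_in_conv zero_neq_numeral)
    then obtain \<tau> where "\<tau> \<in> N" "x \<in> \<tau>" by blast
    then show False using F \<open>F = {}\<close> unfolding facets_def by auto
  qed
  have V: "v \<in> \<Union>N" if "F \<in> facets N" "v \<in> F" for F v using that FN by auto
  show "facet_system (\<Union>N) (facets N)"
  proof
    show "finite (\<Union>N)" "card (\<Union>N) = 15" by (rule finU c15)+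
    show "X \<subseteq> \<Union>N \<and> card X = 6" if X: "X \<in> facets N" for X
    proof -
      obtain v where "v \<in> X" using F_ne[OF X] by blast
      then have "card X = 6" using card_F[of v X] X V[OF X] unfolding st_def by simp
      then show ?thesis using V[OF X] by auto
    qed
    show "card {X \<in> facets N. v \<in> X} = 10" if "v \<in> \<Union>N" for v using card_st[OF that] unfolding st_def .
    show "A = {X \<in> facets N. v \<in> X}" if v: "v \<in> \<Union>N" and A: "A \<subseteq> {X \<in> facets N. v \<in> X}" "A \<noteq> {}"
      and cl: "\<And>X Y. X \<in> A \<Longrightarrow> Y \<in> facets N \<Longrightarrow> v \<in> Y \<Longrightarrow> card (X \<inter> Y) = 5 \<Longrightarrow> Y \<in> A" for v A
    proof -
      have As: "A \<subseteq> st v" using A unfolding st_def by simp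
      have "(\<lambda>F. F - {v}) ` A \<subseteq> lk v" using lkst[OF v] As by blast
      moreover have "(\<lambda>F. F - {v}) ` A \<noteq> {}" using A by simp
      moreover have "\<forall>F\<in>(\<lambda>F. F - {v}) ` A. \<forall>G\<in>lk v. card (F \<inter> G) = 4 \<longrightarrow> G \<in> (\<lambda>F. F - {v}) ` A"
      proof (intro ballI impI)
        fix F G assume F: "F \<in> (\<lambda>F. F - {v}) ` A" and G: "G \<in> lk v" and c: "card (F \<inter> G) = 4"
        obtain F' where F': "F' \<in> A" "F = F' - {v}" using F by blast
        obtain G' where G': "G' \<in> st v" "G = G' - {v}" using G lk[OF v] by blast
        have "card (F' \<inter> G') = 5" using card_int[of F' v G'] F' G' As c by auto
        then have "G' \<in> A" using cl[OF F'(1)] G' unfolding st_def by simp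
        then show "G \<in> (\<lambda>F. F - {v}) ` A" using G' by blast
      qed
      ultimately have "(\<lambda>F. F - {v}) ` A = lk v" using lk_conn[OF v] by metis
      then have "(\<lambda>F. F - {v}) ` A = (\<lambda>F. F - {v}) ` st v" using lk[OF v] by simp
      then have "A = st v" using inj_on_image_eq_iff[OF inj As subset_refl] by simp
      then show ?thesis unfolding st_def .
    qed
    show "card {(X, Y). X \<in> facets N \<and> Y \<in> facets N \<and> v \<in> X \<and> v \<in> Y \<and> card (X \<inter> Y) = 5} = 18" if v: "v \<in> \<Union>N" for v
    proof -
      define P where "P = {(X, Y). X \<in> facets N \<and> Y \<in> facets N \<and> v \<in> X \<and> v \<in> Y \<and> card (X \<inter> Y) = 5}"
      define f where "f = map_prod (\<lambda>F. F - {v}) (\<lambda>F. F - {v})"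
      have Ps: "P \<subseteq> st v \<times> st v" unfolding P_def st_def by auto
      have "adjacent_pairs 4 (lk v) = f ` P"
      proof (intro equalityI subsetI)
        fix x assume "x \<in> adjacent_pairs 4 (lk v)"
        then obtain F G where x: "x = (F, G)" "F \<in> lk v" "G \<in> lk v" "card (F \<inter> G) = 4" unfolding adjacent_pairs_def by blast
        have "F \<in> (\<lambda>F. F - {v}) ` st v" "G \<in> (\<lambda>F. F - {v}) ` st v" using x(2,3) lk[OF v] by simp_all
        then obtain F' G' where F': "F' \<in> st v" "F = F' - {v}" and G': "G' \<in> st v" "G = G' - {v}" by (elim imageE)
        have "card (F' \<inter> G') = 5" using card_int[OF F'(1) G'(1)] x F' G' by simp
        then have "(F', G') \<in> P" using F' G' unfolding P_def st_def by simp
        moreover have "x = f (F', G')" unfolding f_def x(1) F'(2) G'(2) by simp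
        ultimately show "x \<in> f ` P" by blast
      next
        fix x assume "x \<in> f ` P"
        then obtain F' G' where x: "(F', G') \<in> P" "x = f (F', G')" by auto
        then have s: "F' \<in> st v" "G' \<in> st v" "card (F' \<inter> G') = 5" unfolding P_def st_def by auto
        then have "card ((F' - {v}) \<inter> (G' - {v})) = 4" using card_int by blast
        then show "x \<in> adjacent_pairs 4 (lk v)" using s lkst[OF v] unfolding adjacent_pairs_def x(2) f_def by simp
      qed
      moreover have "inj_on f P" unfolding f_def
        by (rule inj_on_subset[OF map_prod_inj_on[OF inj inj] Ps])
      moreover note lk_pairs[OF v]
      moreover have "card (lk v) = 10" using lk[OF v] card_image[OF inj] card_st[OF v] by simp
      ultimately have "card P = 18" using card_image[of f P] by simp
      then show ?thesis unfolding P_def .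
    qed
    show "\<exists>X\<in>facets N. v \<in> X \<and> w \<in> X" if vw: "v \<in> \<Union>N" "w \<in> \<Union>N" for v w
    proof -
      have "{v, w} \<in> N"
      proof (cases "v = w")
        case True
        obtain \<tau> where "\<tau> \<in> N" "v \<in> \<tau>" using vw(1) by blast
        then show ?thesis using True sub[of \<tau> "{v, w}"] by simp
      qed (rule edge[OF vw])
      then show ?thesis using ext[of "{v, w}"] by simp
    qed
    show "X = Y \<or> Y = Z \<or> X = Z" if F: "X \<in> facets N" "Y \<in> facets N" "Z \<in> facets N" and c: "5 \<le> card (X \<inter> Y \<inter> Z)" for X Y Z
    proof -
      obtain v where v: "v \<in> X" "v \<in> Y" "v \<in> Z" using c by (metis Int_iff all_not_in_conv card.empty not_numeral_le_zero)
      have vN: "v \<in> \<Union>N" using V F v by blast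
      have s: "X \<in> st v" "Y \<in> st v" "Z \<in> st v" using F v unfolding st_def by auto
      have "finite (X \<inter> Y \<inter> Z)" using F FN fins by blast
      moreover have "X \<inter> Y \<inter> Z = insert v ((X - {v}) \<inter> (Y - {v}) \<inter> (Z - {v}))" using v by auto
      ultimately have "4 \<le> card ((X - {v}) \<inter> (Y - {v}) \<inter> (Z - {v}))" using c by simp
      moreover note lk_thin[OF vN]
      ultimately have "X - {v} = Y - {v} \<or> Y - {v} = Z - {v} \<or> X - {v} = Z - {v}"
        using lkst[OF vN s(1)] lkst[OF vN s(2)] lkst[OF vN s(3)] by blast
      then show ?thesis using inj_onD[OF inj] s by metis
    qed
  qed
qed

text \<open>The automorphism is the group element that corresponds to 1.\<close>

lemma order_3_automorphism:
  fixes N :: "'a set set"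
  assumes "\<exists>H. subgroup H (aut_group N) \<and> (aut_group N)\<lparr>carrier := H\<rparr> \<cong> integer_mod_group 3"
  shows "\<exists>h. bij_betw h (\<Union>N) (\<Union>N) \<and> (`) h ` N = N \<and> (\<forall>v\<in>\<Union>N. h (h (h v)) = v) \<and> (\<exists>v\<in>\<Union>N. h v \<noteq> v)"
proof -
  obtain H where H: "subgroup H (aut_group N)" "(aut_group N)\<lparr>carrier := H\<rparr> \<cong> integer_mod_group 3" using assms by blast
  let ?G = "(aut_group N)\<lparr>carrier := H\<rparr>"
  let ?V = "\<Union>N"
  obtain \<psi> where psi: "\<psi> \<in> iso ?G (integer_mod_group 3)" using H(2) unfolding is_iso_def by blast
  have hm: "\<psi> (x \<otimes>\<^bsub>?G\<^esub> y) = (\<psi> x + \<psi> y) mod 3" if "x \<in> H" "y \<in> H" for x y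
    using psi that unfolding iso_def hom_def by (simp add: mult_integer_mod_group)
  have b: "bij_betw \<psi> H {0..<3}" using psi unfolding iso_def by (simp add: carrier_integer_mod_group)
  have HB: "H \<subseteq> {f \<in> Bij ?V. complex_iso_map f N N}"
    using subgroup.subset[OF H(1)] unfolding aut_group_def by simp
  have mult: "x \<otimes>\<^bsub>?G\<^esub> y = compose ?V x y" if "x \<in> H" "y \<in> H" for x y
    using that HB unfolding aut_group_def BijGroup_def by auto
  have cl: "compose ?V x y \<in> H" if "x \<in> H" "y \<in> H" for x y
    using subgroup.m_closed[OF H(1) that] mult[OF that] by simp
  obtain h where h: "h \<in> H" "\<psi> h = 1" using b unfolding bij_betw_def by (metis atLeastLessThan_iff imageE one_less_numeral_iff semiring_norm(77) zero_le_one)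
  have hB: "h \<in> Bij ?V" "complex_iso_map h N N" using h HB by auto
  have bij: "bij_betw h ?V ?V" using hB(1) unfolding Bij_def by simp
  have hV: "h v \<in> ?V" if "v \<in> ?V" for v using bij that by (rule bij_betwE[rule_format])
  define h2 where "h2 = compose ?V h h"
  define h3 where "h3 = compose ?V h h2"
  have h2: "h2 \<in> H" "\<psi> h2 = 2" using cl[OF h(1) h(1)] hm[OF h(1) h(1)] mult[OF h(1) h(1)] h(2) unfolding h2_def by simp_all
  have h3: "h3 \<in> H" "\<psi> h3 = 0" using cl[OF h(1) h2(1)] hm[OF h(1) h2(1)] mult[OF h(1) h2(1)] h(2) h2(2) unfolding h3_def by simp_all
  have h4: "\<psi> (compose ?V h3 h) = 1" using hm[OF h3(1) h(1)] mult[OF h3(1) h(1)] h(2) h3(2) by simp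
  \<comment> \<open>\<open>h3\<close> corresponds to 0, so composing it with \<open>h\<close> gives
    an element with the same image as \<open>h\<close>, hence \<open>h\<close> itself. As
    \<open>h\<close> is onto, \<open>h3\<close> is the identity on the vertices.\<close>
  then have "compose ?V h3 h = h" using b cl[OF h3(1) h(1)] h unfolding bij_betw_def by (metis inj_onD)
  then have e: "h3 (h v) = h v" if "v \<in> ?V" for v using that by (metis compose_eq)
  have "h (h (h v)) = v" if v: "v \<in> ?V" for v
  proof -
    obtain u where u: "u \<in> ?V" "h u = v" using bij v by (metis bij_betw_imp_surj_on imageE)
    have "h3 v = h (h (h v))" unfolding h3_def h2_def using v hV by (simp add: compose_eq)
    then show ?thesis using e[OF u(1)] u(2) by simp
  qed
  moreover have "\<exists>v\<in>?V. h v \<noteq> v"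
  proof (rule ccontr)
    assume "\<not> ?thesis"
    \<comment> \<open>Extensionality makes the maps agree outside the vertex set as well. But their
      images under \<open>\<psi>\<close> are 2 and 1.\<close>
    then have "h2 v = h v" for v unfolding h2_def compose_def
      using Bij_imp_extensional[OF hB(1)] by (auto simp: extensional_def)
    then have "h2 = h" by auto
    then show False using h2(2) h(2) by simp
  qed
  moreover have "(`) h ` N = N" using hB(2) unfolding complex_iso_map_def by simp
  ultimately show ?thesis using bij by blast
qed

section \<open>Transfer to the standard names of the 15 vertices\<close>

primrec label :: "('a \<Rightarrow> 'a) \<Rightarrow> 'a \<Rightarrow> 'a \<Rightarrow> 'a \<Rightarrow> 'a \<Rightarrow> 'a \<Rightarrow> vertex \<Rightarrow> 'a" where
  "label h r1 r2 r3 r4 r5 a1 = r1" | "label h r1 r2 r3 r4 r5 b1 = h r1" | "label h r1 r2 r3 r4 r5 c1 = h (h r1)"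
| "label h r1 r2 r3 r4 r5 a2 = r2" | "label h r1 r2 r3 r4 r5 b2 = h r2" | "label h r1 r2 r3 r4 r5 c2 = h (h r2)"
| "label h r1 r2 r3 r4 r5 a3 = r3" | "label h r1 r2 r3 r4 r5 b3 = h r3" | "label h r1 r2 r3 r4 r5 c3 = h (h r3)"
| "label h r1 r2 r3 r4 r5 a4 = r4" | "label h r1 r2 r3 r4 r5 b4 = h r4" | "label h r1 r2 r3 r4 r5 c4 = h (h r4)"
| "label h r1 r2 r3 r4 r5 a5 = r5" | "label h r1 r2 r3 r4 r5 b5 = h r5" | "label h r1 r2 r3 r4 r5 c5 = h (h r5)"

context lollipop
begin

text \<open>No vertex is fixed, so \<open>V\<close> splits into five orbits of size three. Two of
  them form \<open>p 0\<close>, the third contains the vertex added in the first step, and the names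
  of the other two are arbitrary.\<close>

lemma ex_labelling:
  obtains e :: "vertex \<Rightarrow> 'a" where "inj e" "range e = V" "\<And>v. e (\<phi> v) = h (e v)"
    "e -` p 0 = {a1,b1,c1,a2,b2,c2}" "e -` p 1 = {a3,a1,b1,c1,a2,b2}"
proof -
  obtain d w where dw: "d \<in> p 0" "w \<notin> p 0" "p 1 = insert w (p 0 - {d})" "w \<in> V" using step_facet[OF p0(1) y(1)] by metis
  define T where "T = (\<lambda>u. {u, h u, h (h u)})"
  have V0: "p 0 \<subseteq> V" "card (p 0) = 6" "finite (p 0)" using facet[OF p0(1)] fin_facet[OF p0(1)] by auto
  have inv0: "h u \<in> p 0" if "u \<in> p 0" for u using gstar[OF that] p0(2) by simp
  have TV: "T u \<subseteq> V" if "u \<in> V" for u unfolding T_def using hV that by simp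
  have cT: "card (T u) = 3" "finite (T u)" if u: "u \<in> V" for u
  proof -
    have "h (h u) \<noteq> u" using free[OF u] h3[OF u] by metis
    then show "card (T u) = 3" unfolding T_def using free[OF u] free[OF hV[OF u]] by (simp add: eq_commute)
    show "finite (T u)" unfolding T_def by simp
  qed
  have disj: "T u \<inter> A = {}" if u: "u \<in> V" "u \<notin> A" and A: "\<And>x. x \<in> A \<Longrightarrow> h x \<in> A" for u A
  proof -
    have "h u \<notin> A" "h (h u) \<notin> A" using A[of "h (h u)"] A[of "h u"] h3[OF u(1)] u(2) by metis+
    then show ?thesis unfolding T_def using u by simp
  qed
  have Tinv: "h x \<in> T u" if "u \<in> V" "x \<in> T u" for x u using that h3[OF that(1)] unfolding T_def by auto
  have dV: "d \<in> V" using V0 dw by blast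
  have Td: "T d \<subseteq> p 0" unfolding T_def using inv0 dw(1) by simp
  have "card (p 0 - T d) = 3" using card_Diff_subset[OF cT(2)[OF dV] Td] cT(1)[OF dV] V0 by simp
  then have "p 0 - T d \<noteq> {}" by (metis card.empty zero_neq_numeral)
  then obtain x where x: "x \<in> p 0" "x \<notin> T d" by blast
  have xV: "x \<in> V" using V0 x by blast
  have Tx: "T x \<subseteq> p 0" unfolding T_def using inv0 x(1) by simp
  have dx: "T x \<inter> T d = {}" by (rule disj[OF xV x(2) Tinv[OF dV]])
  have P0: "T x \<union> T d = p 0"
    by (rule card_subset_eq) (use V0 Tx Td dx cT xV dV in \<open>simp_all add: card_Un_disjoint\<close>)
  define A where "A = p 0 \<union> T w"
  have Ainv: "h u \<in> A" if "u \<in> A" for u using that inv0 Tinv[OF dw(4)] unfolding A_def by blast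
  have "T w \<inter> p 0 = {}" by (rule disj[OF dw(4,2) inv0])
  then have cA: "card A = 9" "finite A" "A \<subseteq> V" unfolding A_def using V0 cT[OF dw(4)] TV[OF dw(4)]
    by (simp_all add: card_Un_disjoint Int_commute)
  have "card (V - A) = 6" using card_Diff_subset[OF cA(2,3)] cA cardV by simp
  then have "V - A \<noteq> {}" by (metis card.empty zero_neq_numeral)
  then obtain y where y: "y \<in> V" "y \<notin> A" by blast
  define B where "B = A \<union> T y"
  have Binv: "h u \<in> B" if "u \<in> B" for u using that Ainv Tinv[OF y(1)] unfolding B_def by blast
  have "T y \<inter> A = {}" by (rule disj[OF y Ainv])
  then have cB: "card B = 12" "finite B" "B \<subseteq> V" unfolding B_def using cA cT[OF y(1)] TV[OF y(1)]
    by (simp_all add: card_Un_disjoint Int_commute)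
  have "card (V - B) = 3" using card_Diff_subset[OF cB(2,3)] cB cardV by simp
  then have "V - B \<noteq> {}" by (metis card.empty zero_neq_numeral)
  then obtain t where t: "t \<in> V" "t \<notin> B" by blast
  have "T t \<inter> B = {}" by (rule disj[OF t Binv])
  then have "card (B \<union> T t) = card V" using cB cT[OF t(1)] cardV by (simp add: card_Un_disjoint Int_commute)
  then have VB: "B \<union> T t = V" using cB TV[OF t(1)] finV by (intro card_subset_eq) simp_all
  \<comment> \<open>The name \<open>a2\<close> goes to \<open>h d\<close>, so that the dropped
    vertex \<open>d = h (h (h d))\<close> becomes \<open>c2\<close>.\<close>
  define e where "e = label h x (h d) w y t"
  have ev: "e a1 = x" "e b1 = h x" "e c1 = h (h x)" "e a2 = h d" "e b2 = h (h d)" "e c2 = d"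
    "e a3 = w" "e b3 = h w" "e c3 = h (h w)" "e a4 = y" "e b4 = h y" "e c4 = h (h y)" "e a5 = t" "e b5 = h t" "e c5 = h (h t)"
    unfolding e_def using h3[OF dV] by simp_all
  have r: "range e = V"
    unfolding vertex_UNIV VB[symmetric] B_def A_def P0[symmetric] T_def by (simp add: ev insert_commute)
  have "card (range e) = card (UNIV :: vertex set)" unfolding r cardV card_vertex ..
  then have inj: "inj e" by (rule eq_card_imp_inj_on[rotated]) simp
  have com: "e (\<phi> v) = h (e v)" for v
    using h3[OF xV] h3[OF dV] h3[OF dw(4)] h3[OF y(1)] h3[OF t(1)] by (cases v) (simp_all add: ev)
  have "e ` {a1,b1,c1,a2,b2,c2} = p 0" unfolding P0[symmetric] T_def by (auto simp: ev)
  then have v0: "e -` p 0 = {a1,b1,c1,a2,b2,c2}" using inj by (metis inj_vimage_image_eq)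
  have "e ` {a3,a1,b1,c1,a2,b2} = insert w (p 0 - {d})"
  proof -
    have "{a3,a1,b1,c1,a2,b2} = insert a3 ({a1,b1,c1,a2,b2,c2} - {c2})" by auto
    then have "e ` {a3,a1,b1,c1,a2,b2} = insert (e a3) (e ` {a1,b1,c1,a2,b2,c2} - {e c2})"
      by (simp only: image_insert image_set_diff[OF inj] image_empty)
    then show ?thesis using \<open>e ` {a1,b1,c1,a2,b2,c2} = p 0\<close> ev by simp
  qed
  then have v1: "e -` p 1 = {a3,a1,b1,c1,a2,b2}" unfolding dw(3) using inj by (metis inj_vimage_image_eq)
  show thesis by (rule that[OF inj r com v0 v1])
qed

lemma vimage_equivariant:
  fixes e :: "vertex \<Rightarrow> 'a"
  assumes e: "inj e" "range e = V" "\<And>v. e (\<phi> v) = h (e v)" and A: "A \<subseteq> V"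
  shows "\<phi> ` (e -` A) = e -` g A"
proof (intro equalityI subsetI)
  fix x assume "x \<in> \<phi> ` (e -` A)"
  then show "x \<in> e -` g A" unfolding g_def using e(3) by auto
next
  fix x assume "x \<in> e -` g A"
  then obtain a where a: "a \<in> A" "e x = h a" unfolding g_def by auto
  then obtain v where v: "a = e v" using A e(2) by blast
  then have "e x = e (\<phi> v)" using a e(3) by simp
  then have "x = \<phi> v" using e(1) by (simp add: inj_eq)
  then show "x \<in> \<phi> ` (e -` A)" using a v by auto
qed

lemma config_labelled:
  fixes e :: "vertex \<Rightarrow> 'a"
  assumes e: "inj e" "range e = V" "\<And>v. e (\<phi> v) = h (e v)"
  shows "config (\<lambda>i. e -` p i) j"
proof -
  have es: "e ((\<phi> ^^ s) v) = (h ^^ s) (e v)" for s v by (induction s) (simp_all add: e(3))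
  note vim = vimage_equivariant[OF e]
  have pV: "p i \<subseteq> V" if "i \<le> 9" for i using facet[OF pF9[OF that]] by blast
  have gs: "(g ^^ s) X \<in> \<F>" if "X \<in> \<F>" for s X by (induction s) (use that gF in simp_all)
  have vims: "(\<phi> ^^ s) ` (e -` X) = e -` (g ^^ s) X" if X: "X \<in> \<F>" for s X
  proof (induction s)
    case (Suc s)
    have "(\<phi> ^^ Suc s) ` (e -` X) = \<phi> ` (\<phi> ^^ s) ` (e -` X)" by (simp add: image_comp)
    then show ?case using Suc vim[of "(g ^^ s) X"] gs[OF X, of s] facet by simp
  qed simp
  have cd: "card (e -` A) = card A" if "A \<subseteq> V" for A using card_vimage_inj[OF e(1), of A] that e(2) by simp
  show ?thesis
  proof
    show "1 \<le> j" "j \<le> 6" using j j_bounds by simp_all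
    show "\<phi> ` (e -` p 0) = e -` p 0" "e -` p 9 = \<phi> ` (e -` p j)" using vim pV p0 p9 j by simp_all
    show "card (e -` p 0) = 6" using cd pV[of 0] facet[OF p0(1)] by simp
    show "\<exists>d v. d \<in> e -` p k \<and> v \<notin> e -` p k \<and> e -` p (Suc k) = insert v (e -` p k - {d}) \<and>
      (k < j \<longrightarrow> (\<forall>i\<le>k. d \<in> e -` p i)) \<and>
      (j \<le> k \<longrightarrow> (\<forall>i. j \<le> i \<longrightarrow> i \<le> k \<longrightarrow> d \<in> e -` p i) \<and> v \<in> e -` p 9)" if k: "k \<le> 8" for k
    proof -
      obtain d v where dv: "d \<in> p k" "v \<notin> p k" "p (Suc k) = insert v (p k - {d})" "v \<in> V"
        using step_facet[OF pF[OF k] step[OF k]] by metis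
      obtain d' v' where d': "d = e d'" and v': "v = e v'" using dv pV[of k] k e(2) by (metis imageE le_SucI numeral_eq_Suc pred_numeral_simps(3) subsetD)
      have nd: "d \<notin> p (Suc k)" "v \<in> p (Suc k)" using dv by auto
      have 1: "e -` p (Suc k) = insert v' (e -` p k - {d'})" unfolding dv(3) d' v' using inj_eq[OF e(1)] by auto
      have 2: "k < j \<longrightarrow> (\<forall>i\<le>k. d \<in> p i)" using drop_spoke[OF _ dv(1) nd(1)] by blast
      have 3: "j \<le> k \<longrightarrow> (\<forall>i. j \<le> i \<longrightarrow> i \<le> k \<longrightarrow> d \<in> p i)" using drop_rim[OF _ k dv(1) nd(1)] by blast
      have 4: "j \<le> k \<longrightarrow> v \<in> p 9" using add_rim[OF _ dv(2) nd(2), of 9] k by simp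
      show ?thesis using 1 2 3 4 dv(1,2) d' v' by (intro exI[of _ d'] exI[of _ v']) simp
    qed
    show "covered (\<lambda>i. e -` p i) 8 v w" if vw: "v \<noteq> w" for v w
    proof -
      have V: "e v \<in> V" "e w \<in> V" using e(2) by auto
      obtain X where X: "X \<in> \<F>" "e v \<in> X" "e w \<in> X" using meet[OF V] by blast
      \<comment> \<open>The three members of the orbit of \<open>p i\<close> return to
        \<open>p i\<close> after zero, two and one rotations.\<close>
      have "\<exists>i\<le>8. \<exists>s. (h ^^ s) (e v) \<in> p i \<and> (h ^^ s) (e w) \<in> p i"
      proof (cases "X = p 0")
        case True
        then have "(h ^^ 0) (e v) \<in> p 0 \<and> (h ^^ 0) (e w) \<in> p 0" using X by simp
        then show ?thesis by blast
      next
        case False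
        then obtain i where i: "1 \<le> i" "i \<le> 8" "X \<in> orb (p i)" using all_cases[OF X(1)] by blast
        have g3i: "g (g (g (p i))) = p i" using g3 pF i by simp
        consider "X = p i" | "X = g (p i)" | "X = g (g (p i))" using i(3) unfolding orb_def by blast
        then have "\<exists>s. (h ^^ s) (e v) \<in> p i \<and> (h ^^ s) (e w) \<in> p i"
        proof cases
          case 1
          then have "(h ^^ 0) (e v) \<in> p i \<and> (h ^^ 0) (e w) \<in> p i" using X by simp
          then show ?thesis by blast
        next
          case 2
          have "(h ^^ 2) (e v) \<in> g (g X) \<and> (h ^^ 2) (e w) \<in> g (g X)" using X gstar by (simp add: numeral_2_eq_2)
          then have "(h ^^ 2) (e v) \<in> p i \<and> (h ^^ 2) (e w) \<in> p i" using 2 g3i by simp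
          then show ?thesis by blast
        next
          case 3
          have "(h ^^ 1) (e v) \<in> g X \<and> (h ^^ 1) (e w) \<in> g X" using X gstar by simp
          then have "(h ^^ 1) (e v) \<in> p i \<and> (h ^^ 1) (e w) \<in> p i" using 3 g3i by simp
          then show ?thesis by blast
        qed
        then show ?thesis using i by blast
      qed
      then show ?thesis unfolding covered_def using vw by (simp add: es)
    qed
    show "(\<phi> ^^ s) ` (e -` p i) = e -` p (k - 1) \<or> (\<phi> ^^ s) ` (e -` p i) = e -` p (Suc k)"
      if k: "1 \<le> k" "k \<le> 8" "k \<noteq> j" "i \<le> 8" and c: "card (e -` p k \<inter> (\<phi> ^^ s) ` (e -` p i)) = 5" for k i s
    proof -
      have v: "(\<phi> ^^ s) ` (e -` p i) = e -` (g ^^ s) (p i)" by (rule vims[OF pF[OF k(4)]])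
      have "card (p k \<inter> (g ^^ s) (p i)) = 5"
        using c cd[of "p k \<inter> (g ^^ s) (p i)"] pV[of k] k(2) unfolding v vimage_Int by (simp add: le_infI1)
      then have "(g ^^ s) (p i) \<in> nb (p k)" using gs[OF pF[OF k(4)]] unfolding nb_def by simp
      then show ?thesis using nbp[OF k(1-3)] unfolding v by auto
    qed
  qed
qed

lemma isomorphic_to_N:
  shows "\<exists>i\<in>{1..12}. \<exists>f. inj_on f V \<and> (`) f ` \<F> = N_facets i"
proof -
  obtain e :: "vertex \<Rightarrow> 'a" where e: "inj e" "range e = V" "\<And>v. e (\<phi> v) = h (e v)"
    and e0: "e -` p 0 = {a1,b1,c1,a2,b2,c2}" and e1: "e -` p 1 = {a3,a1,b1,c1,a2,b2}" by (rule ex_labelling) blast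
  define U where "U = (\<lambda>i. e -` p i)"
  have c: "config U j" unfolding U_def by (rule config_labelled[OF e])
  obtain i f where f: "i \<in> {1..12}" "inj f"
    "(`) f ` insert (U 0) (\<Union>k\<in>{1..8}. {U k, \<phi> ` U k, \<phi> ` \<phi> ` U k}) = N_facets i"
    using config_classification[OF c j_bounds(1)] e0 e1 unfolding U_def by blast
  \<comment> \<open>The isomorphism passes through the names: the inverse labelling comes first,
    then the relabelling found by the search.\<close>
  define k where "k = inv_into UNIV e"
  have k: "k ` X = e -` X" if "X \<subseteq> V" for X
    unfolding k_def using that e(1,2) by (auto simp: image_iff) (metis inv_f_f f_inv_into_f subsetD)+
  have kV: "inj_on k V" unfolding k_def e(2)[symmetric] by (rule inj_on_inv_into) simp
  have com: "\<phi> ` (e -` X) = e -` g X" if "X \<in> \<F>" for X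
    using vimage_equivariant[OF e, of X] facet[OF that] by simp
  have "(`) k ` \<F> = (\<lambda>X. e -` X) ` \<F>" by (rule image_cong[OF refl]) (use k facet in blast)
  also have "\<dots> = (\<lambda>X. e -` X) ` insert (p 0) (\<Union>i\<in>{1..8}. orb (p i))" using all by simp
  also have "\<dots> = insert (U 0) (\<Union>i\<in>{1..8}. {U i, \<phi> ` U i, \<phi> ` \<phi> ` U i})"
  proof -
    have "(\<lambda>X. e -` X) ` orb (p i) = {U i, \<phi> ` U i, \<phi> ` \<phi> ` U i}" if "i \<in> {1..8}" for i
      unfolding orb_def U_def using com[OF pF[of i]] com[OF gF[OF pF[of i]]] that by simp
    then show ?thesis by (simp add: image_UN U_def)
  qed
  finally have "(`) f ` (`) k ` \<F> = N_facets i" using f(3) by (simp only:)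
  then have "(`) (f \<circ> k) ` \<F> = N_facets i" by (simp only: image_image o_def)
  moreover have "inj_on (f \<circ> k) V" using kV f(2) by (intro comp_inj_on) (auto intro: inj_on_subset)
  ultimately show ?thesis using f(1) by blast
qed

end

theorem theorem3p2:
  fixes N :: "'a set set"
  assumes "N \<in> Kbar_star 5"
    and "card (\<Union>N) = 15"
    and "\<exists>H. subgroup H (aut_group N) \<and>
             (aut_group N)\<lparr>carrier := H\<rparr> \<cong> integer_mod_group 3"
  shows "\<exists>i\<in>{1..12}. complex_iso N (N_complex i)"
proof -
  have fc: "fin_complex N" and links: "\<forall>x\<in>\<Union>N. stacked_ball 4 (vertex_link x N)" and nbl: "neighborly N"
    using assms(1) unfolding Kbar_star_def Kbar_def triangulated_manifold_def by auto
  note fs = facet_system_facets[OF fc links nbl assms(2)]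
  obtain h where h: "bij_betw h (\<Union>N) (\<Union>N)" "(`) h ` N = N" "\<forall>v\<in>\<Union>N. h (h (h v)) = v" "\<exists>v\<in>\<Union>N. h v \<noteq> v"
    using order_3_automorphism[OF assms(3)] by blast
  interpret facet_system "\<Union>N" "facets N" by (rule fs(1))
  have sub: "\<And>\<sigma> \<tau>. \<sigma> \<in> N \<Longrightarrow> \<tau> \<subseteq> \<sigma> \<Longrightarrow> \<tau> \<in> N" using fc unfolding fin_complex_def by auto
  have hV: "h v \<in> \<Union>N" if "v \<in> \<Union>N" for v using h(1) that by (rule bij_betwE[rule_format])
  have hF: "h ` X \<in> facets N" if X: "X \<in> facets N" for X
  proof -
    have XN: "X \<in> N" using X unfolding facets_def by simp
    have "\<tau> = h ` X" if t: "\<tau> \<in> N" "h ` X \<subseteq> \<tau>" for \<tau>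
    proof -
      have "\<tau> \<in> (`) h ` N" using t h(2) by simp
      then obtain \<sigma> where s: "\<sigma> \<in> N" "\<tau> = h ` \<sigma>" by blast
      have "X \<subseteq> \<sigma>"
      proof
        fix x assume x: "x \<in> X"
        then obtain y where y: "y \<in> \<sigma>" "h x = h y" using t(2) s(2) by blast
        then have "x = y" using bij_betw_imp_inj_on[OF h(1)] x XN s(1) by (metis UnionI inj_onD)
        then show "x \<in> \<sigma>" using y by simp
      qed
      then have "\<sigma> = X" using X s unfolding facets_def by auto
      then show ?thesis using s by simp
    qed
    moreover have "h ` X \<in> N" using imageI[OF XN, of "(`) h"] h(2) by simp
    ultimately show ?thesis unfolding facets_def by simp
  qed
  interpret auto_system "\<Union>N" "facets N" h
    by standard (use hV hF h(3,4) in auto)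
  \<comment> \<open>Here \<open>h'\<close> may be another rotation than \<open>h\<close>, but the
    conclusion concerns only the facets.\<close>
  obtain h' p j where L: "lollipop (\<Union>N) (facets N) h' p j" using ex_lollipop by blast
  obtain i f where f: "i \<in> {1..12}" "inj_on f (\<Union>N)" "(`) f ` facets N = N_facets i"
    using lollipop.isomorphic_to_N[OF L] by (elim bexE exE conjE)
  \<comment> \<open>Both complexes consist of the subsets of their facets, so it suffices that
    facets correspond.\<close>
  have im: "(`) f ` N = N_complex i"
  proof (intro equalityI subsetI)
    fix \<rho> assume "\<rho> \<in> (`) f ` N"
    then obtain \<sigma> where s: "\<sigma> \<in> N" "\<rho> = f ` \<sigma>" by blast
    obtain X where "X \<in> facets N" "\<sigma> \<subseteq> X" using fs(2)[OF s(1)] by blast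
    then have "f ` X \<in> N_facets i" "\<rho> \<subseteq> f ` X" using f(3) s(2) by auto
    then show "\<rho> \<in> N_complex i" unfolding N_complex_def generated_complex_def by blast
  next
    fix \<rho> assume "\<rho> \<in> N_complex i"
    then obtain G where G: "G \<in> N_facets i" "\<rho> \<subseteq> G" unfolding N_complex_def generated_complex_def by blast
    have "G \<in> (`) f ` facets N" using f(3) G(1) by simp
    then obtain X where X: "X \<in> facets N" "G = f ` X" by blast
    obtain \<sigma> where "\<sigma> \<subseteq> X" "\<rho> = f ` \<sigma>" using G(2) X(2) by (metis subset_imageE)
    moreover have "X \<in> N" using X(1) unfolding facets_def by simp
    ultimately show "\<rho> \<in> (`) f ` N" using sub by blast
  qed
  have "\<Union>(N_complex i) = f ` \<Union>N" unfolding im[symmetric] by auto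
  then have "bij_betw f (\<Union>N) (\<Union>(N_complex i))" using f(2) by (simp add: bij_betw_def)
  then show ?thesis using im f(1) unfolding complex_iso_def complex_iso_map_def by blast
qed

end
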